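(* The solitary-wave equation has no nontrivial solution $\varphi\in\mathcal X$ if any one of the following holds: 1. $\beta<0$, $\gamma>0$ and $c^3<\dfrac{27(3p+1)\gamma\beta^2}{(p-1)^3}$; 2. $\beta>0$, $\gamma<0$ and $c^3>\dfrac{27(3p+1)\gamma\beta^2}{(p-1)^3}$; 3. $f(u)=|u|^{p-1}u$, $\beta>0$ and $\gamma<0$; 4. $f(u)=-|u|^{p-1}u$, $\beta<0$ and $\gamma>0$.
   Context: Fix $p>1$ and a $C^2$ function $f:\mathbb R\to\mathbb R$ homogeneous of degree $p$, i.e. $f(\lambda s)=\lambda^p f(s)$ for all $\lambda>0$ and $s\in\mathbb R$. In cases 3 and 4 the specific $f$ given there is used. The operators are defined as follows. $\mathcal H$ is the Hilbert transform, $\mathcal Hu(x)=\mathrm{p.v.}\frac1\pi\int_{\mathbb R}\frac{u(z)}{x-z}dz$, with Fourier symbol $-i\,\mathrm{sgn}\,\xi$. $\partial_x^{-1}$ is the Fourier multiplier with symbol $(i\xi)^{-1}$, and $\partial_x^{-2}=(\partial_x^{-1})^2$. Let $\mathcal X=\{u\in H^{1/2}(\mathbb R):\partial_x^{-1}u\in L^2(\mathbb R)\}$. The solitary-wave equation for real parameters $\beta,c,\gamma$ is $$\beta\mathcal H\varphi_x-c\varphi+f(\varphi)=\gamma\partial_x^{-2}\varphi,$$ understood in the distributional sense for $\varphi\in\mathcal X$. *)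

theory Defs
  imports "HOL-Analysis.Analysis"
begin

definition L2 :: "(real \<Rightarrow> 'a::real_normed_vector) \<Rightarrow> bool" where
  "L2 u \<longleftrightarrow> u \<in> borel_measurable lborel \<and> integrable lborel (\<lambda>x. (norm (u x))^2)"

definition fourier_trunc :: "(real \<Rightarrow> real) \<Rightarrow> real \<Rightarrow> real \<Rightarrow> complex" where
  "fourier_trunc u R \<xi> =
     (LINT x|lborel. indicator {-R..R} x * complex_of_real (u x) * cis (- (x * \<xi>)))"

text \<open>U is (a representative of) the L2 (Plancherel) Fourier transform of u:
  the L2-limit of the truncated Fourier integrals.\<close>
definition is_fourier :: "(real \<Rightarrow> real) \<Rightarrow> (real \<Rightarrow> complex) \<Rightarrow> bool" where
  "is_fourier u U \<longleftrightarrow> L2 u \<and> L2 U \<and>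
     ((\<lambda>R. \<integral>\<^sup>+ \<xi>. ennreal ((cmod (U \<xi> - fourier_trunc u R \<xi>))^2) \<partial>lborel) \<longlongrightarrow> 0) at_top"

definition H_half :: "(real \<Rightarrow> real) \<Rightarrow> bool" where
  "H_half u \<longleftrightarrow> (\<exists>U. is_fourier u U \<and>
     (\<integral>\<^sup>+ \<xi>. ennreal ((1 + \<bar>\<xi>\<bar>) * (cmod (U \<xi>))^2) \<partial>lborel) < \<infinity>)"

definition is_hilbert :: "(real \<Rightarrow> real) \<Rightarrow> (real \<Rightarrow> real) \<Rightarrow> bool" where
  "is_hilbert u v \<longleftrightarrow> (\<exists>U. is_fourier u U \<and> is_fourier v (\<lambda>\<xi>. - \<i> * complex_of_real (sgn \<xi>) * U \<xi>))"

definition is_dinv :: "(real \<Rightarrow> real) \<Rightarrow> (real \<Rightarrow> real) \<Rightarrow> bool" where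
  "is_dinv u w \<longleftrightarrow> (\<exists>U. is_fourier u U \<and> is_fourier w (\<lambda>\<xi>. U \<xi> / (\<i> * complex_of_real \<xi>)))"

definition in_X :: "(real \<Rightarrow> real) \<Rightarrow> bool" where
  "in_X u \<longleftrightarrow> H_half u \<and> (\<exists>w. is_dinv u w)"

definition test_fun :: "(real \<Rightarrow> real) \<Rightarrow> bool" where
  "test_fun \<psi> \<longleftrightarrow> (\<forall>k x. ((deriv ^^ k) \<psi>) differentiable (at x)) \<and>
     (\<exists>R. \<forall>x. \<bar>x\<bar> > R \<longrightarrow> \<psi> x = 0)"

text \<open>phi in X solves  beta H phi_x - c phi + f(phi) = gamma \<partial>_x^{-2} phi  in the
  distributional sense. Since \<partial>_x^{-1} phi is the L2 function w, the equation is
  read as  \<partial>_x (beta H phi_x - c phi + f(phi)) = gamma w  in D'(R), tested against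
  all test functions psi.\<close>
definition solves :: "real \<Rightarrow> real \<Rightarrow> real \<Rightarrow> (real \<Rightarrow> real) \<Rightarrow> (real \<Rightarrow> real) \<Rightarrow> bool" where
  "solves \<beta> c \<gamma> f \<phi> \<longleftrightarrow> in_X \<phi> \<and>
     (\<exists>h w. is_hilbert \<phi> h \<and> is_dinv \<phi> w \<and>
       (\<forall>\<psi>. test_fun \<psi> \<longrightarrow>
          \<beta> * (LINT x|lborel. h x * deriv (deriv \<psi>) x)
          + c * (LINT x|lborel. \<phi> x * deriv \<psi> x)
          - (LINT x|lborel. f (\<phi> x) * deriv \<psi> x)
          = \<gamma> * (LINT x|lborel. w x * \<psi> x)))"

definition C2 :: "(real \<Rightarrow> real) \<Rightarrow> bool" where
  "C2 f \<longleftrightarrow> (\<forall>x. f differentiable (at x)) \<and> (\<forall>x. (deriv f) differentiable (at x))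
           \<and> continuous_on UNIV (deriv (deriv f))"

definition homogeneous :: "real \<Rightarrow> (real \<Rightarrow> real) \<Rightarrow> bool" where
  "homogeneous p f \<longleftrightarrow> (\<forall>t>0. \<forall>s. f (t * s) = t powr p * f s)"

end

theory Submission
  imports Defs "HOL-Probability.Probability" "HOL-Real_Asymp.Real_Asymp"
begin

text \<open>Following Pohozaev, the solution is tested with itself and with \<open>x\<close> times its derivative.  On the
  Fourier side the equation says that the transform of \<open>f \<circ> \<phi>\<close> is
  \<open>(c - \<beta> * \<bar>\<xi>\<bar> - \<gamma> / \<xi>^2) * U \<xi>\<close>.  With \<open>A\<close>, \<open>B\<close>, \<open>W\<close> the integrals of \<open>\<bar>U\<bar>^2\<close> against
  \<open>\<bar>\<xi>\<bar>\<close>, \<open>1\<close>, \<open>1 / \<xi>^2\<close> and \<open>Y\<close> the integral of \<open>\<phi> * f \<phi>\<close>, the two tests give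
  \<open>2 * pi * Y = c * B - \<beta> * A - \<gamma> * W\<close> and \<open>4 * pi * Y = (p + 1) * (c * B - 3 * \<gamma> * W)\<close>.
  Eliminating \<open>Y\<close> leaves \<open>(p - 1) * c * B + 2 * \<beta> * A = (3 * p + 1) * \<gamma> * W\<close>, which the pointwise
  arithmetic-geometric mean inequality contradicts in the first two cases; in the other two, eliminating
  \<open>c * B\<close> contradicts the sign of \<open>Y\<close>.  The second test needs \<open>\<phi>\<close> bounded with square integrable
  derivative, which follows from the equation once \<open>f \<circ> \<phi>\<close> is known to be square integrable; the
  latter holds because \<open>H^(1/2)\<close> embeds into every \<open>L^q\<close> with finite \<open>q \<ge> 2\<close>.\<close>

section \<open>The Hilbert space of square integrable functions\<close>

text \<open>The virial test acts on a Fourier symbol \<open>m\<close> as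
  \<open>m - \<xi> * m'\<close>. This keeps the constant \<open>c\<close>, annihilates
  \<bar>\<xi>\<bar>, which is homogeneous of degree one, and multiplies 1 / \<xi>^2 by 3: hence the
  second identity contains no \<open>A\<close> and has the coefficient \<open>3 * \<gamma>\<close>.
  The factor p + 1 comes from the primitive s * f s / (p + 1) of f. The obstacle is regularity.
  Neither x times the derivative of \<phi> nor f \<circ> \<phi> is square integrable a priori, and
  H^(1/2) does not embed into the bounded functions. So the derivative is replaced by difference
  quotients and x by sin (r * x) / r; the step of the quotient tends to 0 first, r afterwards. On
  the Fourier side sin (r * x) is a difference of two shifts, so continuity of translations in L2
  suffices and the transform U is never differentiated.\<close>

lemma borel_measurable_cnj [measurable]:
  "f \<in> borel_measurable M \<Longrightarrow> (\<lambda>x. cnj (f x)) \<in> borel_measurable M"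
  by (rule borel_measurable_continuous_on[OF continuous_on_cnj[OF continuous_on_id]])

text \<open>For a function outside \<open>L2\<close> the Bochner integral takes its default value 0,
  so a small norm carries information only together with \<open>L2 u\<close>. This is why the
  statements below repeat that hypothesis.\<close>

definition L2_norm :: "(real \<Rightarrow> complex) \<Rightarrow> real" where
  "L2_norm u = sqrt (LINT x|lborel. (cmod (u x))^2)"

definition L2_inner :: "(real \<Rightarrow> complex) \<Rightarrow> (real \<Rightarrow> complex) \<Rightarrow> complex" where
  "L2_inner u v = (LINT x|lborel. u x * cnj (v x))"

lemma L2_measurable: "L2 u \<Longrightarrow> u \<in> borel_measurable borel"
  by (simp add: L2_def)

lemma L2_norm_nonneg [simp]: "0 \<le> L2_norm u"
  by (simp add: L2_norm_def)

lemma L2_norm_power2: "(L2_norm u)^2 = (LINT x|lborel. (cmod (u x))^2)"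
  by (simp add: L2_norm_def)

lemma L2_bound:
  fixes u :: "real \<Rightarrow> 'a::real_normed_vector" and v :: "real \<Rightarrow> 'b::real_normed_vector"
  assumes "u \<in> borel_measurable borel" "L2 v" "AE x in lborel. norm (u x) \<le> C * norm (v x)"
  shows "L2 u"
proof -
  have "integrable lborel (\<lambda>x. (norm (u x))^2)"
  proof (rule Bochner_Integration.integrable_bound)
    show "integrable lborel (\<lambda>x. C^2 * (norm (v x))^2)"
      using assms(2) by (auto simp: L2_def)
    show "AE x in lborel. norm ((norm (u x))\<^sup>2) \<le> norm (C\<^sup>2 * (norm (v x))\<^sup>2)"
      using assms(3)
    proof eventually_elim
      case (elim x)
      have "(norm (u x))^2 \<le> (C * norm (v x))^2"
        using elim by (intro power_mono) auto
      then show ?case by (simp add: power_mult_distrib)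
    qed
  qed (use assms(1) in simp)
  with assms(1) show ?thesis by (simp add: L2_def)
qed

lemma L2_of_real [simp]: "L2 (\<lambda>x. complex_of_real (u x)) \<longleftrightarrow> L2 u"
proof
  assume a: "L2 (\<lambda>x. complex_of_real (u x))"
  then have [measurable]: "(\<lambda>x. complex_of_real (u x)) \<in> borel_measurable borel"
    by (simp add: L2_def)
  have "(\<lambda>x. Re (complex_of_real (u x))) \<in> borel_measurable borel"
    by measurable
  with a show "L2 u" by (simp add: L2_def)
qed (auto simp: L2_def)

lemma L2_zero [simp]: "L2 (\<lambda>x. 0)"
  by (simp add: L2_def)

lemma L2_cong_AE:
  fixes u v :: "real \<Rightarrow> 'a::real_normed_vector"
  assumes "L2 u" "v \<in> borel_measurable borel" "AE x in lborel. u x = v x"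
  shows "L2 v"
  using assms(3) by (intro L2_bound[OF assms(2,1), of 1]) auto

lemma L2_cmult:
  fixes u :: "real \<Rightarrow> complex" shows "L2 u \<Longrightarrow> L2 (\<lambda>x. a * u x)"
  by (rule L2_bound[where v=u and C="cmod a"]) (auto simp: L2_def norm_mult)

lemma L2_mult_bounded:
  fixes u b :: "real \<Rightarrow> complex"
  assumes "L2 u" "b \<in> borel_measurable borel" "\<And>x. cmod (b x) \<le> C"
  shows "L2 (\<lambda>x. b x * u x)"
proof (rule L2_bound)
  note [measurable] = L2_measurable[OF assms(1)] assms(2)
  show "(\<lambda>x. b x * u x) \<in> borel_measurable borel" by measurable
  show "AE x in lborel. norm (b x * u x) \<le> C * norm (u x)"
    using assms(3) by (intro AE_I2) (simp add: norm_mult mult_right_mono)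
qed (fact assms(1))

lemma L2_add:
  fixes u v :: "real \<Rightarrow> complex"
  assumes "L2 u" "L2 v" shows "L2 (\<lambda>x. u x + v x)"
proof -
  note [measurable] = assms[THEN L2_measurable]
  have "integrable lborel (\<lambda>x. (norm (u x + v x))^2)"
  proof (rule Bochner_Integration.integrable_bound)
    show "integrable lborel (\<lambda>x. 2 * (norm (u x))^2 + 2 * (norm (v x))^2)"
      using assms by (auto simp: L2_def)
    show "AE x in lborel. norm ((norm (u x + v x))\<^sup>2) \<le> norm (2 * (norm (u x))\<^sup>2 + 2 * (norm (v x))\<^sup>2)"
    proof (rule AE_I2)
      fix x
      have "(norm (u x + v x))^2 \<le> (norm (u x) + norm (v x))^2"
        by (intro power_mono norm_triangle_ineq) auto
      also have "\<dots> \<le> 2 * (norm (u x))\<^sup>2 + 2 * (norm (v x))\<^sup>2"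
        using sum_squares_bound[of "norm (u x)" "norm (v x)"] by (simp add: power2_sum)
      finally show "norm ((norm (u x + v x))\<^sup>2) \<le> norm (2 * (norm (u x))\<^sup>2 + 2 * (norm (v x))\<^sup>2)"
        by simp
    qed
  qed simp
  then show ?thesis by (simp add: L2_def)
qed

lemma L2_diff:
  fixes u v :: "real \<Rightarrow> complex"
  assumes "L2 u" "L2 v" shows "L2 (\<lambda>x. u x - v x)"
  using L2_add[OF assms(1) L2_cmult[OF assms(2), of "-1"]] by simp

lemma integrable_L2_mult:
  fixes u v :: "real \<Rightarrow> complex"
  assumes "L2 u" "L2 v"
  shows "integrable lborel (\<lambda>x. cmod (u x) * cmod (v x))" "integrable lborel (\<lambda>x. u x * cnj (v x))"
    "integrable lborel (\<lambda>x. u x * v x)"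
proof -
  note [measurable] = assms[THEN L2_measurable]
  show *: "integrable lborel (\<lambda>x. cmod (u x) * cmod (v x))"
  proof (rule Bochner_Integration.integrable_bound)
    show "integrable lborel (\<lambda>x. (norm (u x))^2 + (norm (v x))^2)"
      using assms by (auto simp: L2_def)
    have "2 * (norm (u x) * norm (v x)) \<le> (norm (u x))\<^sup>2 + (norm (v x))\<^sup>2" for x
      using sum_squares_bound[of "norm (u x)" "norm (v x)"] by simp
    then have "norm (u x) * norm (v x) \<le> (norm (u x))\<^sup>2 + (norm (v x))\<^sup>2" for x
      using mult_nonneg_nonneg[of "norm (u x)" "norm (v x)"] by (smt (verit) norm_ge_zero)
    then show "AE x in lborel. norm (cmod (u x) * cmod (v x)) \<le> norm ((norm (u x))\<^sup>2 + (norm (v x))\<^sup>2)"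
      by auto
  qed simp
  show "integrable lborel (\<lambda>x. u x * cnj (v x))" "integrable lborel (\<lambda>x. u x * v x)"
    by (rule Bochner_Integration.integrable_bound[OF *], measurable, simp add: norm_mult)+
qed

lemma L2_Cauchy_Schwarz:
  fixes u v :: "real \<Rightarrow> complex"
  assumes "L2 u" "L2 v"
  shows "(LINT x|lborel. cmod (u x) * cmod (v x)) \<le> L2_norm u * L2_norm v"
proof -
  note [measurable] = assms[THEN L2_measurable]
  have I: "integrable lborel (\<lambda>x. (cmod (u x))^2)" "integrable lborel (\<lambda>x. (cmod (v x))^2)"
    using assms by (auto simp: L2_def)
  have "(\<integral>\<^sup>+x. ennreal (cmod (u x)) * ennreal (cmod (v x)) \<partial>lborel)^2
     \<le> (\<integral>\<^sup>+x. (ennreal (cmod (u x)))^2 \<partial>lborel) * (\<integral>\<^sup>+x. (ennreal (cmod (v x)))^2 \<partial>lborel)"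
    by (rule Cauchy_Schwarz_nn_integral) auto
  then have "ennreal (LINT x|lborel. cmod (u x) * cmod (v x))^2 \<le> ennreal ((L2_norm u)^2) * ennreal ((L2_norm v)^2)"
    unfolding L2_norm_power2
    by (simp add: ennreal_power nn_integral_eq_integral[OF integrable_L2_mult(1)[OF assms]]
         nn_integral_eq_integral[OF I(1)] nn_integral_eq_integral[OF I(2)] flip: ennreal_mult)
  then have "(LINT x|lborel. cmod (u x) * cmod (v x))^2 \<le> (L2_norm u * L2_norm v)^2"
    by (simp add: ennreal_power power_mult_distrib flip: ennreal_mult)
  then show ?thesis by (rule power2_le_imp_le) simp
qed

lemma L2_inner_le:
  assumes "L2 u" "L2 v" shows "cmod (L2_inner u v) \<le> L2_norm u * L2_norm v"
proof -
  have "cmod (L2_inner u v) \<le> (LINT x|lborel. cmod (u x * cnj (v x)))"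
    unfolding L2_inner_def by (rule integral_norm_bound)
  also have "\<dots> \<le> L2_norm u * L2_norm v"
    using L2_Cauchy_Schwarz[OF assms] by (simp add: norm_mult)
  finally show ?thesis .
qed

lemma L2_norm_triangle:
  assumes "L2 u" "L2 v" shows "L2_norm (\<lambda>x. u x + v x) \<le> L2_norm u + L2_norm v"
proof (rule power2_le_imp_le)
  have I: "integrable lborel (\<lambda>x. (cmod (u x))^2)" "integrable lborel (\<lambda>x. (cmod (v x))^2)"
    using assms by (auto simp: L2_def)
  have "(L2_norm (\<lambda>x. u x + v x))^2 \<le> (LINT x|lborel. (cmod (u x))^2 + (cmod (v x))^2 + 2 * (cmod (u x) * cmod (v x)))"
    unfolding L2_norm_power2
  proof (rule integral_mono)
    show "integrable lborel (\<lambda>x. (cmod (u x + v x))\<^sup>2)" using L2_add[OF assms] by (simp add: L2_def)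
    show "(cmod (u x + v x))\<^sup>2 \<le> (cmod (u x))^2 + (cmod (v x))^2 + 2 * (cmod (u x) * cmod (v x))" for x
      using power_mono[OF norm_triangle_ineq[of "u x" "v x"], of 2] by (simp add: power2_sum)
  qed (use I integrable_L2_mult(1)[OF assms] in auto)
  also have "\<dots> = (L2_norm u)^2 + (L2_norm v)^2 + 2 * (LINT x|lborel. cmod (u x) * cmod (v x))"
    unfolding L2_norm_power2 using I integrable_L2_mult(1)[OF assms] by simp
  also have "\<dots> \<le> (L2_norm u + L2_norm v)^2"
    using L2_Cauchy_Schwarz[OF assms] by (simp add: power2_sum)
  finally show "(L2_norm (\<lambda>x. u x + v x))^2 \<le> (L2_norm u + L2_norm v)^2" .
qed simp

lemma L2_norm_cmult: "L2_norm (\<lambda>x. a * u x) = cmod a * L2_norm u"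
  by (simp add: L2_norm_def norm_mult power_mult_distrib real_sqrt_mult)

lemma L2_norm_minus_commute: "L2_norm (\<lambda>x. u x - v x) = L2_norm (\<lambda>x. v x - u x)"
  by (simp add: L2_norm_def norm_minus_commute)

lemma L2_norm_le:
  assumes "L2 v" "u \<in> borel_measurable borel" "AE x in lborel. cmod (u x) \<le> cmod (v x)"
  shows "L2_norm u \<le> L2_norm v"
proof -
  have "L2 u" by (rule L2_bound[where v=v and C=1]) (use assms in auto)
  then show ?thesis unfolding L2_norm_def using assms
    by (intro real_sqrt_le_mono integral_mono_AE) (auto simp: L2_def intro!: power_mono)
qed

lemma L2_norm_cong_AE:
  assumes "u \<in> borel_measurable borel" "v \<in> borel_measurable borel" "AE x in lborel. u x = v x"
  shows "L2_norm u = L2_norm v"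
  unfolding L2_norm_def using assms(3)
  by (intro arg_cong[where f=sqrt] integral_cong_AE) (use assms in auto)

lemma L2_norm_eq_0:
  assumes "L2 u" "L2_norm u = 0" shows "AE x in lborel. u x = 0"
proof -
  have "(LINT x|lborel. (cmod (u x))^2) = 0"
    using assms(2) L2_norm_power2[of u] by simp
  moreover have "integrable lborel (\<lambda>x. (cmod (u x))^2)" using assms by (auto simp: L2_def)
  ultimately have "AE x in lborel. (cmod (u x))^2 = 0"
    by (simp add: integral_nonneg_eq_0_iff_AE)
  then show ?thesis by simp
qed

lemma L2_inner_diff_left: "L2 u \<Longrightarrow> L2 v \<Longrightarrow> L2 w \<Longrightarrow> L2_inner (\<lambda>x. u x - v x) w = L2_inner u w - L2_inner v w"
  unfolding L2_inner_def by (simp add: left_diff_distrib integrable_L2_mult(2))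

lemma L2_inner_diff_right: "L2 u \<Longrightarrow> L2 v \<Longrightarrow> L2 w \<Longrightarrow> L2_inner w (\<lambda>x. u x - v x) = L2_inner w u - L2_inner w v"
  unfolding L2_inner_def by (simp add: right_diff_distrib integrable_L2_mult(2))

lemma L2_inner_cmult_left: "L2_inner (\<lambda>x. a * u x) v = a * L2_inner u v"
  unfolding L2_inner_def by (simp add: mult.assoc)

lemma L2_inner_cmult_right: "L2_inner u (\<lambda>x. a * v x) = cnj a * L2_inner u v"
  unfolding L2_inner_def by (simp add: mult.left_commute)

lemma L2_inner_self: "L2_inner u u = complex_of_real ((L2_norm u)^2)"
  unfolding L2_inner_def L2_norm_power2
  by (simp add: complex_norm_square flip: integral_complex_of_real of_real_power)

text \<open>Membership of all terms and of the limit belongs to the notion: the norm of a difference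
  that is not square integrable would be 0 by default.\<close>

definition L2_tendsto :: "(nat \<Rightarrow> real \<Rightarrow> complex) \<Rightarrow> (real \<Rightarrow> complex) \<Rightarrow> bool" where
  "L2_tendsto v u \<longleftrightarrow> (\<forall>n. L2 (v n)) \<and> L2 u \<and> (\<lambda>n. L2_norm (\<lambda>x. v n x - u x)) \<longlonglongrightarrow> 0"

lemma L2_tendstoD:
  assumes "L2_tendsto v u"
  shows "L2 (v n)" "L2 u" "(\<lambda>n. L2_norm (\<lambda>x. v n x - u x)) \<longlonglongrightarrow> 0"
  using assms by (auto simp: L2_tendsto_def)

lemma L2_tendsto_const: "L2 u \<Longrightarrow> L2_tendsto (\<lambda>n. u) u"
  by (simp add: L2_tendsto_def L2_norm_def)

lemma L2_tendsto_cmult: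
  assumes "L2_tendsto v u" shows "L2_tendsto (\<lambda>n x. a * v n x) (\<lambda>x. a * u x)"
proof -
  have "L2_norm (\<lambda>x. a * v n x - a * u x) = cmod a * L2_norm (\<lambda>x. v n x - u x)" for n
    by (simp add: flip: L2_norm_cmult right_diff_distrib)
  moreover have "(\<lambda>n. cmod a * L2_norm (\<lambda>x. v n x - u x)) \<longlonglongrightarrow> cmod a * 0"
    by (intro tendsto_intros L2_tendstoD assms)
  ultimately show ?thesis using L2_tendstoD[OF assms] by (auto simp: L2_tendsto_def L2_cmult)
qed

lemma L2_tendsto_add:
  assumes "L2_tendsto v u" "L2_tendsto v' u'"
  shows "L2_tendsto (\<lambda>n x. v n x + v' n x) (\<lambda>x. u x + u' x)"
proof -
  note L = L2_tendstoD[OF assms(1)] L2_tendstoD[OF assms(2)]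
  have "(\<lambda>n. L2_norm (\<lambda>x. v n x + v' n x - (u x + u' x))) \<longlonglongrightarrow> 0"
  proof (rule Lim_null_comparison)
    show "(\<lambda>n. L2_norm (\<lambda>x. v n x - u x) + L2_norm (\<lambda>x. v' n x - u' x)) \<longlonglongrightarrow> 0"
      using tendsto_add[OF L(3,6)] by simp
    show "\<forall>\<^sub>F n in sequentially. norm (L2_norm (\<lambda>x. v n x + v' n x - (u x + u' x)))
        \<le> L2_norm (\<lambda>x. v n x - u x) + L2_norm (\<lambda>x. v' n x - u' x)"
      using L2_norm_triangle[OF L2_diff[OF L(1,2)] L2_diff[OF L(4,5)]]
      by (auto simp: algebra_simps)
  qed
  with L show ?thesis by (auto simp: L2_tendsto_def L2_add)
qed

lemma L2_tendsto_norm: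
  assumes "L2_tendsto v u" shows "(\<lambda>n. L2_norm (v n)) \<longlonglongrightarrow> L2_norm u"
proof -
  note L = L2_tendstoD[OF assms]
  have "norm (L2_norm (v n) - L2_norm u) \<le> L2_norm (\<lambda>x. v n x - u x)" for n
    using L2_norm_triangle[OF L2_diff[OF L(1)[of n] L(2)] L(2)]
      L2_norm_triangle[OF L2_diff[OF L(2) L(1)[of n]] L(1)[of n]] L2_norm_minus_commute[of u "v n"]
    by (simp add: abs_le_iff)
  then have "(\<lambda>n. L2_norm (v n) - L2_norm u) \<longlonglongrightarrow> 0"
    by (intro Lim_null_comparison[OF _ L(3)] always_eventually allI)
  then show ?thesis by (rule LIM_zero_cancel)
qed

lemma L2_tendsto_inner:
  assumes "L2_tendsto v u" "L2_tendsto v' u'"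
  shows "(\<lambda>n. L2_inner (v n) (v' n)) \<longlonglongrightarrow> L2_inner u u'"
proof -
  note L = L2_tendstoD[OF assms(1)] L2_tendstoD[OF assms(2)]
  have "(\<lambda>n. L2_norm (\<lambda>x. v n x - u x) * L2_norm (v' n) + L2_norm u * L2_norm (\<lambda>x. v' n x - u' x)) \<longlonglongrightarrow> 0 * L2_norm u' + L2_norm u * 0"
    by (intro tendsto_intros L L2_tendsto_norm[OF assms(2)])
  moreover have "norm (L2_inner (v n) (v' n) - L2_inner u u')
      \<le> L2_norm (\<lambda>x. v n x - u x) * L2_norm (v' n) + L2_norm u * L2_norm (\<lambda>x. v' n x - u' x)" for n
  proof -
    have "L2_inner (v n) (v' n) - L2_inner u u' = L2_inner (\<lambda>x. v n x - u x) (v' n) + L2_inner u (\<lambda>x. v' n x - u' x)"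
      using L by (simp add: L2_inner_diff_left L2_inner_diff_right)
    then show ?thesis
      using L2_inner_le[OF L2_diff[OF L(1)[of n] L(2)] L(4)[of n]] L2_inner_le[OF L(2) L2_diff[OF L(4)[of n] L(5)]]
        norm_triangle_ineq[of "L2_inner (\<lambda>x. v n x - u x) (v' n)" "L2_inner u (\<lambda>x. v' n x - u' x)"]
      by simp
  qed
  ultimately have "(\<lambda>n. L2_inner (v n) (v' n) - L2_inner u u') \<longlonglongrightarrow> 0"
    by - (rule Lim_null_comparison[OF always_eventually[OF allI]], assumption, simp)
  then show ?thesis by (rule LIM_zero_cancel)
qed

lemma L2_tendsto_dominated:
  assumes "\<And>n. v n \<in> borel_measurable borel" "u \<in> borel_measurable borel" "L2 w"
    and "\<And>n. AE x in lborel. cmod (v n x) \<le> cmod (w x)"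
    and "AE x in lborel. (\<lambda>n. v n x) \<longlonglongrightarrow> u x"
  shows "L2_tendsto v u"
proof -
  have v: "L2 (v n)" for n
    by (rule L2_bound[where v=w and C=1]) (use assms in auto)
  have "AE x in lborel. \<forall>n. cmod (v n x) \<le> cmod (w x)"
    using assms(4) by (simp add: AE_all_countable)
  with assms(5) have "AE x in lborel. cmod (u x) \<le> cmod (w x)"
  proof eventually_elim
    case (elim x)
    show ?case by (rule tendsto_upperbound[OF tendsto_norm[OF elim(1)]]) (use elim(2) in auto)
  qed
  then have u: "L2 u" and uw: "AE x in lborel. cmod (u x) \<le> cmod (w x)"
    by (auto intro!: L2_bound[where v=w and u=u and C=1] assms)
  have "(\<lambda>n. LINT x|lborel. (cmod (v n x - u x))^2) \<longlonglongrightarrow> (LINT x|(lborel::real measure). 0)"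
  proof (rule integral_dominated_convergence[where w="\<lambda>x. 4 * (cmod (w x))^2"])
    show "integrable lborel (\<lambda>x. 4 * (cmod (w x))^2)"
      using assms(3) by (auto simp: L2_def)
    show "AE x in lborel. (\<lambda>n. (cmod (v n x - u x))\<^sup>2) \<longlonglongrightarrow> 0"
      using assms(5)
    proof eventually_elim
      case (elim x)
      have "(\<lambda>n. (cmod (v n x - u x))\<^sup>2) \<longlonglongrightarrow> (cmod (u x - u x))^2"
        by (intro tendsto_intros elim)
      then show ?case by simp
    qed
    show "AE x in lborel. norm ((cmod (v n x - u x))\<^sup>2) \<le> 4 * (cmod (w x))\<^sup>2" for n
      using assms(4)[of n] uw
    proof eventually_elim
      case (elim x)
      have "cmod (v n x - u x) \<le> 2 * cmod (w x)"
        using elim norm_triangle_ineq4[of "v n x" "u x"] by simp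
      from power_mono[OF this, of 2] show ?case by (simp add: power_mult_distrib)
    qed
  qed (use assms in auto)
  then have "(\<lambda>n. sqrt (LINT x|lborel. (cmod (v n x - u x))^2)) \<longlonglongrightarrow> sqrt 0"
    by (intro tendsto_real_sqrt) simp
  then show ?thesis using u v by (simp add: L2_tendsto_def L2_norm_def)
qed

text \<open>The limit is found pointwise: the weighted series of squared increments has finite integral,
  so almost every orbit has geometrically small increments; Fatou then controls the distance.\<close>
lemma L2_complete:
  assumes v: "\<And>n. L2 (v n)" and fast: "\<And>n m. m \<ge> n \<Longrightarrow> (L2_norm (\<lambda>x. v m x - v n x))^2 \<le> (1/4)^n"
  shows "\<exists>u. L2_tendsto v u"
proof -
  note [measurable] = v[THEN L2_measurable]
  have nn: "(\<integral>\<^sup>+x. ennreal ((cmod (v m x - v n x))^2) \<partial>lborel) = ennreal ((L2_norm (\<lambda>x. v m x - v n x))^2)" for m n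
    unfolding L2_norm_power2 using L2_diff[OF v[of m] v[of n]]
    by (intro nn_integral_eq_integral) (auto simp: L2_def)
  \<comment> \<open>The weight 2^k divides the rate (1/4)^k in two: (1/2)^k remains to make the
    integral of the series finite, and finiteness of S x bounds the k-th increment at x by a
    multiple of (1/2)^(k/2).\<close>
  define S where "S x = (\<Sum>k. ennreal (2^k * (cmod (v (Suc k) x - v k x))^2))" for x
  have [measurable]: "S \<in> borel_measurable borel" unfolding S_def by measurable
  have "(\<integral>\<^sup>+x. S x \<partial>lborel) = (\<Sum>k. \<integral>\<^sup>+x. ennreal (2^k * (cmod (v (Suc k) x - v k x))^2) \<partial>lborel)"
    unfolding S_def by (rule nn_integral_suminf) measurable
  also have "\<dots> = (\<Sum>k. ennreal (2^k * (L2_norm (\<lambda>x. v (Suc k) x - v k x))^2))"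
    by (simp add: ennreal_mult nn_integral_cmult nn)
  also have "\<dots> \<le> (\<Sum>k. ennreal ((1/2)^k))"
  proof (intro suminf_le summableI ennreal_leI)
    fix k
    have "2^k * (L2_norm (\<lambda>x. v (Suc k) x - v k x))\<^sup>2 \<le> 2^k * (1/4::real)^k"
      using fast[of k "Suc k"] by (intro mult_left_mono) auto
    also have "\<dots> = (1/2)^k" by (simp flip: power_mult_distrib)
    finally show "2^k * (L2_norm (\<lambda>x. v (Suc k) x - v k x))\<^sup>2 \<le> (1/2)^k" .
  qed
  also have "\<dots> < \<infinity>"
    by (subst suminf_ennreal_eq[of _ 2]) (use geometric_sums[of "1/2::real"] in auto)
  finally have "AE x in lborel. S x \<noteq> \<infinity>"
    by (intro nn_integral_PInf_AE) auto
  then have conv: "AE x in lborel. convergent (\<lambda>n. v n x)"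
  proof eventually_elim
    case (elim x)
    define C where "C = enn2real (S x)"
    have SC: "S x = ennreal C" using elim by (simp add: C_def less_top)
    have b: "2^k * (cmod (v (Suc k) x - v k x))^2 \<le> C" for k
    proof -
      have "(\<Sum>i\<in>{k}. ennreal (2^i * (cmod (v (Suc i) x - v i x))^2)) \<le> S x"
        unfolding S_def by (rule sum_le_suminf) (auto intro: summableI)
      then show ?thesis unfolding SC by (simp add: C_def)
    qed
    have b': "cmod (v (Suc k) x - v k x) \<le> sqrt C * (sqrt (1/2))^k" for k
    proof -
      have "(cmod (v (Suc k) x - v k x))^2 \<le> C * (1/2)^k"
        using b[of k] by (simp add: field_simps power_one_over)
      from real_sqrt_le_mono[OF this] show ?thesis by (simp add: real_sqrt_mult real_sqrt_power)
    qed
    have "summable (\<lambda>k. v (Suc k) x - v k x)"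
    proof (rule summable_comparison_test)
      show "\<exists>N. \<forall>n\<ge>N. norm (v (Suc n) x - v n x) \<le> sqrt C * (sqrt (1/2))^n" using b' by auto
      show "summable (\<lambda>k. sqrt C * (sqrt (1/2))^k)"
        by (intro summable_mult summable_geometric) (simp add: real_less_lsqrt)
    qed
    then have "convergent (\<lambda>n. \<Sum>k<n. v (Suc k) x - v k x)" by (simp add: summable_iff_convergent)
    then have "convergent (\<lambda>n. v n x - v 0 x)" by (subst (asm) sum_lessThan_telescope)
    then obtain l where "(\<lambda>n. v n x - v 0 x) \<longlonglongrightarrow> l" by (auto simp: convergent_def)
    from tendsto_add[OF this tendsto_const[of "v 0 x"]] show ?case by (auto simp: convergent_def)
  qed
  define u where "u x = lim (\<lambda>n. v n x)" for x
  have [measurable]: "u \<in> borel_measurable borel" unfolding u_def by measurable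
  have lim: "AE x in lborel. (\<lambda>n. v n x) \<longlonglongrightarrow> u x"
    using conv by eventually_elim (simp add: u_def convergent_LIMSEQ_iff)
  have F: "(\<integral>\<^sup>+x. ennreal ((cmod (v n x - u x))^2) \<partial>lborel) \<le> ennreal ((1/4)^n)" for n
  proof -
    have "(\<integral>\<^sup>+x. ennreal ((cmod (v n x - u x))^2) \<partial>lborel)
        = (\<integral>\<^sup>+x. liminf (\<lambda>m. ennreal ((cmod (v m x - v n x))^2)) \<partial>lborel)"
    proof (rule nn_integral_cong_AE)
      show "AE x in lborel. ennreal ((cmod (v n x - u x))^2) = liminf (\<lambda>m. ennreal ((cmod (v m x - v n x))^2))"
        using lim
      proof eventually_elim
        case (elim x)
        have "(\<lambda>m. ennreal ((cmod (v m x - v n x))^2)) \<longlonglongrightarrow> ennreal ((cmod (u x - v n x))^2)"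
          by (intro tendsto_intros elim tendsto_ennrealI)
        from lim_imp_Liminf[OF _ this] show ?case by (simp add: norm_minus_commute)
      qed
    qed
    also have "\<dots> \<le> liminf (\<lambda>m. \<integral>\<^sup>+x. ennreal ((cmod (v m x - v n x))^2) \<partial>lborel)"
      by (rule nn_integral_liminf) measurable
    also have "\<dots> \<le> limsup (\<lambda>m. \<integral>\<^sup>+x. ennreal ((cmod (v m x - v n x))^2) \<partial>lborel)"
      by (rule Liminf_le_Limsup) simp
    also have "\<dots> \<le> ennreal ((1/4)^n)"
    proof (rule Limsup_bounded)
      show "\<forall>\<^sub>F m in sequentially. (\<integral>\<^sup>+x. ennreal ((cmod (v m x - v n x))^2) \<partial>lborel) \<le> ennreal ((1/4)^n)"
        unfolding nn using eventually_ge_at_top[of n]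
        by eventually_elim (intro ennreal_leI fast)
    qed
    finally show ?thesis .
  qed
  have d: "L2 (\<lambda>x. v n x - u x)" for n
    unfolding L2_def
  proof
    show "integrable lborel (\<lambda>x. (cmod (v n x - u x))\<^sup>2)"
      using F[of n] by (intro integrableI_nonneg) (auto simp: order.strict_trans1)
  qed simp
  have u: "L2 u" using L2_diff[OF v[of 0] d[of 0]] by simp
  have "L2_norm (\<lambda>x. v n x - u x) \<le> (1/2)^n" for n
  proof (rule power2_le_imp_le)
    have "ennreal ((L2_norm (\<lambda>x. v n x - u x))^2) \<le> ennreal ((1/4)^n)"
      unfolding L2_norm_power2 using F[of n] d[of n]
      by (subst nn_integral_eq_integral[symmetric]) (auto simp: L2_def)
    then show "(L2_norm (\<lambda>x. v n x - u x))^2 \<le> ((1/2)^n)^2"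
      by (simp add: power_one_over flip: power_mult) (simp add: power_mult mult.commute[of n])
  qed simp
  then have "\<forall>\<^sub>F n in sequentially. norm (L2_norm (\<lambda>x. v n x - u x)) \<le> (1/2)^n"
    by simp
  then have "(\<lambda>n. L2_norm (\<lambda>x. v n x - u x)) \<longlonglongrightarrow> 0"
    by (rule Lim_null_comparison) (simp add: LIMSEQ_power_zero)
  with u v show ?thesis by (auto simp: L2_tendsto_def)
qed

section \<open>Translations in the space of square integrable functions\<close>

lemma integral_translate:
  fixes f :: "real \<Rightarrow> 'a::{banach, second_countable_topology}"
  shows "(LINT x|lborel. f (x + t)) = (LINT x|lborel. f x)"
  using lborel_integral_real_affine[of 1 f t] by (simp add: add.commute)

lemma integrable_translate:
  fixes f :: "real \<Rightarrow> 'a::{banach, second_countable_topology}"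
  shows "integrable lborel f \<Longrightarrow> integrable lborel (\<lambda>x. f (x + t))"
  using lborel_integrable_real_affine[of f 1 t] by (simp add: add.commute)

lemma L2_translate: "L2 (u :: real \<Rightarrow> complex) \<Longrightarrow> L2 (\<lambda>x. u (x + t))"
  unfolding L2_def using integrable_translate[of "\<lambda>x. (norm (u x))^2" t] by auto

lemma L2_norm_translate: "L2_norm (\<lambda>x. u (x + t)) = L2_norm u"
  unfolding L2_norm_def using integral_translate[of "\<lambda>x. (cmod (u x))^2" t] by simp

text \<open>A three-epsilon argument. Translation preserves the norm, so replacing v by s k costs
  the same before and after translation, uniformly in n; only then is n chosen.\<close>

lemma L2_tendsto_translate_limit:
  assumes sv: "L2_tendsto s v" and P: "\<And>k. L2_tendsto (\<lambda>n x. s k (x + t n)) (s k)"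
  shows "L2_tendsto (\<lambda>n x. v (x + t n)) v"
proof -
  note L = L2_tendstoD[OF sv]
  have "(\<lambda>n. L2_norm (\<lambda>x. v (x + t n) - v x)) \<longlonglongrightarrow> 0"
  proof (rule LIMSEQ_I)
    fix e :: real assume "e > 0"
    then have "\<forall>\<^sub>F k in sequentially. L2_norm (\<lambda>x. s k x - v x) < e/3"
      by (intro order_tendstoD(2)[OF L(3)]) auto
    then obtain k where k: "L2_norm (\<lambda>x. s k x - v x) < e/3"
      by (auto simp: eventually_sequentially)
    have "\<forall>\<^sub>F n in sequentially. L2_norm (\<lambda>x. s k (x + t n) - s k x) < e/3"
      using \<open>e > 0\<close> by (intro order_tendstoD(2)[OF L2_tendstoD(3)[OF P]]) auto
    then obtain N where N: "\<And>n. n \<ge> N \<Longrightarrow> L2_norm (\<lambda>x. s k (x + t n) - s k x) < e/3"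
      by (auto simp: eventually_sequentially)
    show "\<exists>N. \<forall>n\<ge>N. norm (L2_norm (\<lambda>x. v (x + t n) - v x) - 0) < e"
    proof (intro exI allI impI)
      fix n assume "n \<ge> N"
      define a where "a = (\<lambda>x. s k (x + t n) - v (x + t n))"
      define b where "b = (\<lambda>x. s k x - v x)"
      define c where "c = (\<lambda>x. s k (x + t n) - s k x)"
      have L2: "L2 a" "L2 b" "L2 c"
        unfolding a_def b_def c_def using L by (auto intro!: L2_diff L2_translate[of "s k"] L2_translate[of v])
      have an: "L2_norm a = L2_norm b"
        using L2_norm_translate[of b "t n"] by (simp add: a_def b_def)
      have "L2_norm (\<lambda>x. v (x + t n) - v x) = L2_norm (\<lambda>x. (- 1 * a x) + (c x + b x))"
        by (simp add: a_def b_def c_def)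
      also have "\<dots> \<le> L2_norm (\<lambda>x. -1 * a x) + L2_norm (\<lambda>x. c x + b x)"
        by (intro L2_norm_triangle L2_cmult L2_add L2)
      also have "\<dots> \<le> L2_norm a + (L2_norm c + L2_norm b)"
        using L2_norm_triangle[OF L2(3,2)] L2_norm_cmult[of "-1" a] by simp
      also have "\<dots> < e/3 + (e/3 + e/3)"
        using k N[OF \<open>n \<ge> N\<close>] an by (simp add: b_def c_def)
      finally show "norm (L2_norm (\<lambda>x. v (x + t n) - v x) - 0) < e" by simp
    qed
  qed
  then show ?thesis using L L2_translate[OF L(2)] by (simp add: L2_tendsto_def)
qed

lemma L2_indicator:
  assumes "A \<in> sets borel" "emeasure lborel A < \<infinity>" shows "L2 (indicator A :: real \<Rightarrow> complex)"
proof -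
  have "integrable lborel (indicator A :: real \<Rightarrow> real)"
    using assms by (intro integrable_real_indicator) auto
  moreover have "(\<lambda>x. (cmod (indicator A x))\<^sup>2) = (indicator A :: real \<Rightarrow> real)"
    by (auto split: split_indicator)
  ultimately show ?thesis unfolding L2_def using assms by auto
qed

text \<open>Only points of the open set itself need the indicator to be continuous along the
  translations: the squared distance is expressed by the overlap with the translate.\<close>
lemma L2_tendsto_translate_open:
  assumes "open A" "emeasure lborel A < \<infinity>" "t \<longlonglongrightarrow> 0"
  shows "L2_tendsto (\<lambda>n x. indicator A (x + t n)) (indicator A)"
proof -
  have [measurable]: "A \<in> sets borel" using assms(1) by simp
  have L: "L2 (indicator A :: real \<Rightarrow> complex)" by (rule L2_indicator) (use assms in auto)
  have I: "integrable lborel (indicator A :: real \<Rightarrow> real)"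
    using assms(2) by (intro integrable_real_indicator) auto
  let ?i = "indicator A :: real \<Rightarrow> real"
  have It: "integrable lborel (\<lambda>x. ?i (x + s))" for s by (rule integrable_translate[OF I])
  have Ip: "integrable lborel (\<lambda>x. ?i (x + s) * ?i x)" for s
    by (rule Bochner_Integration.integrable_bound[OF I]) (auto split: split_indicator)
  have lim: "(\<lambda>n. LINT x|lborel. ?i (x + t n) * ?i x) \<longlonglongrightarrow> (LINT x|lborel. ?i x)"
  proof (rule integral_dominated_convergence)
    show "integrable lborel ?i" by (rule I)
    show "AE x in lborel. (\<lambda>n. ?i (x + t n) * ?i x) \<longlonglongrightarrow> ?i x"
    proof (rule AE_I2)
      fix x
      show "(\<lambda>n. ?i (x + t n) * ?i x) \<longlonglongrightarrow> ?i x"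
      proof (cases "x \<in> A")
        case True
        have "(\<lambda>n. x + t n) \<longlonglongrightarrow> x + 0" by (intro tendsto_intros assms)
        then have "\<forall>\<^sub>F n in sequentially. x + t n \<in> A"
          using assms(1) True by (intro topological_tendstoD) auto
        then have "\<forall>\<^sub>F n in sequentially. ?i (x + t n) * ?i x = ?i x"
          by eventually_elim (use True in simp)
        then show ?thesis by (rule tendsto_eventually)
      qed simp
    qed
  qed (auto split: split_indicator)
  have sq: "(L2_norm (\<lambda>x. indicator A (x + t n) - indicator A x))^2
      = 2 * (LINT x|lborel. ?i x) - 2 * (LINT x|lborel. ?i (x + t n) * ?i x)" for n
  proof -
    have "(L2_norm (\<lambda>x. indicator A (x + t n) - indicator A x))^2
      = (LINT x|lborel. ?i (x + t n) + ?i x - 2 * (?i (x + t n) * ?i x))"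
      unfolding L2_norm_power2 by (intro Bochner_Integration.integral_cong) (auto split: split_indicator)
    also have "\<dots> = (LINT x|lborel. ?i (x + t n)) + (LINT x|lborel. ?i x) - 2 * (LINT x|lborel. ?i (x + t n) * ?i x)"
      using I It[of "t n"] Ip[of "t n"] by simp
    finally show ?thesis using integral_translate[of ?i "t n"] by simp
  qed
  have "(\<lambda>n. (L2_norm (\<lambda>x. indicator A (x + t n) - indicator A x))^2) \<longlonglongrightarrow> 2 * (LINT x|lborel. ?i x) - 2 * (LINT x|lborel. ?i x)"
    unfolding sq by (intro tendsto_intros lim)
  from tendsto_real_sqrt[OF this]
  have "(\<lambda>n. L2_norm (\<lambda>x. indicator A (x + t n) - indicator A x)) \<longlonglongrightarrow> 0"
    by simp
  then show ?thesis using L L2_translate[OF L] by (simp add: L2_tendsto_def)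
qed

text \<open>Outer regularity reduces the claim to open sets: A is approximated by open supersets B
  k, and the indicators differ in norm by the root of the measure of B k - A.\<close>

lemma L2_tendsto_translate_set:
  assumes A: "A \<in> sets borel" "emeasure lborel A < \<infinity>" and t: "t \<longlonglongrightarrow> 0"
  shows "L2_tendsto (\<lambda>n x. indicator A (x + t n)) (indicator A)"
proof -
  have "\<exists>B. open B \<and> A \<subseteq> B \<and> emeasure lborel (B - A) < ennreal (1 / Suc k)" for k
    using outer_regular_lborel[of A "1 / Suc k"] A by (metis of_nat_0_less_iff zero_less_Suc zero_less_divide_1_iff)
  then obtain B where B: "\<And>k. open (B k)" "\<And>k. A \<subseteq> B k" "\<And>k. emeasure lborel (B k - A) < ennreal (1 / Suc k)"
    by metis
  have [measurable]: "B k \<in> sets borel" for k using B(1) by simp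
  note [measurable] = A(1)
  have fin: "emeasure lborel (B k) < \<infinity>" for k
  proof -
    have "emeasure lborel (B k) \<le> emeasure lborel (B k - A) + emeasure lborel A"
      using emeasure_subadditive[of "B k - A" lborel A] B(2)[of k] by (simp add: Un_absorb2)
    also have "\<dots> < \<infinity>" using B(3)[of k] A(2) by (auto simp: less_top order.strict_trans2)
    finally show ?thesis .
  qed
  have nrm: "L2_norm (\<lambda>x. indicator (B k) x - indicator A x) \<le> sqrt (1 / Suc k)" for k
  proof -
    have "(LINT x|lborel. (cmod (indicator (B k) x - indicator A x))^2) = (LINT x|lborel. indicator (B k - A) x)"
      using B(2)[of k] by (intro Bochner_Integration.integral_cong) (auto split: split_indicator)
    also have "\<dots> = measure lborel (B k - A)" by simp
    also have "\<dots> \<le> 1 / Suc k"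
      using B(3)[of k] by (simp add: measure_def enn2real_leI less_imp_le)
    finally show ?thesis by (simp add: L2_norm_def)
  qed
  have "L2_tendsto (\<lambda>k. indicator (B k)) (indicator A)"
    unfolding L2_tendsto_def
  proof (intro conjI allI)
    have "(\<lambda>k. sqrt (1 / Suc k)) \<longlonglongrightarrow> sqrt 0"
      by (intro tendsto_real_sqrt LIMSEQ_Suc lim_1_over_n)
    then have l0: "(\<lambda>k. sqrt (1 / Suc k)) \<longlonglongrightarrow> 0" by simp
    show "(\<lambda>n. L2_norm (\<lambda>x. indicator (B n) x - indicator A x)) \<longlonglongrightarrow> 0"
      by (rule Lim_null_comparison[OF _ l0]) (use nrm in simp)
  qed (use fin A in \<open>auto intro!: L2_indicator\<close>)
  then show ?thesis
    by (rule L2_tendsto_translate_limit) (intro L2_tendsto_translate_open B fin t)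
qed

lemma L2_tendsto_sum:
  assumes "finite I" "\<And>i. i \<in> I \<Longrightarrow> L2_tendsto (v i) (u i)"
  shows "L2_tendsto (\<lambda>n x. \<Sum>i\<in>I. v i n x) (\<lambda>x. \<Sum>i\<in>I. u i x)"
  using assms by (induction I) (auto intro: L2_tendsto_add L2_tendsto_const)

lemma L2_tendsto_translate:
  assumes v: "L2 v" and t: "t \<longlonglongrightarrow> 0"
  shows "L2_tendsto (\<lambda>n x. v (x + t n)) v"
proof -
  have [measurable]: "v \<in> borel_measurable lborel" using v by (simp add: L2_def)
  obtain s where s: "\<And>i. simple_function lborel (s i)" "\<And>x. (\<lambda>i. s i x) \<longlonglongrightarrow> v x"
    "\<And>i x. dist (s i x) 0 \<le> 2 * dist (v x) 0"
    using borel_measurable_implies_sequence_metric[of v lborel 0] by auto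
  have sm: "s i \<in> borel_measurable borel" for i
    using borel_measurable_simple_function[OF s(1)[of i]] by simp
  have sv: "L2_tendsto s v"
  proof (rule L2_tendsto_dominated)
    show "L2 (\<lambda>x. 2 * v x)" using v by (rule L2_cmult)
  qed (use s(2,3) sm v in \<open>auto simp: norm_mult L2_def\<close>)
  show ?thesis
  proof (rule L2_tendsto_translate_limit[OF sv])
    fix k
    \<comment> \<open>The value 0 is left out because only the level sets of nonzero values are
      known to have finite measure; its term in the sum vanishes anyway.\<close>
    define R where "R = s k ` UNIV - {0}"
    define A where "A y = s k -` {y}" for y
    have fR: "finite R" using simple_functionD(1)[OF s(1)[of k]] by (simp add: R_def)
    have Am [measurable]: "A y \<in> sets borel" for y
      using measurable_sets[OF sm[of k], of "{y}"] by (simp add: A_def)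
    have Af: "emeasure lborel (A y) < \<infinity>" if "y \<in> R" for y
    proof -
      have "integrable lborel (\<lambda>x. (cmod (s k x))^2)" using L2_tendstoD(1)[OF sv, of k] by (simp add: L2_def)
      then have "(\<integral>\<^sup>+x. ennreal ((cmod (s k x))^2) \<partial>lborel) < \<infinity>"
        by (simp add: integrable_iff_bounded)
      moreover have "(\<integral>\<^sup>+x. ennreal ((cmod y)^2) * indicator (A y) x \<partial>lborel) \<le> (\<integral>\<^sup>+x. ennreal ((cmod (s k x))^2) \<partial>lborel)"
        by (intro nn_integral_mono) (auto simp: A_def split: split_indicator)
      ultimately have "ennreal ((cmod y)^2) * emeasure lborel (A y) < \<infinity>"
        by (subst (asm) nn_integral_cmult_indicator) auto
      then show ?thesis using that by (auto simp: ennreal_mult_less_top R_def)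
    qed
    have eq: "s k = (\<lambda>x. \<Sum>y\<in>R. y * indicator (A y) x)"
    proof
      fix x
      have "(\<Sum>y\<in>R. y * indicator (A y) x) = (\<Sum>y\<in>R. if y = s k x then y else 0)"
        by (intro sum.cong) (auto simp: A_def)
      also have "\<dots> = s k x" using fR by (auto simp: R_def)
      finally show "s k x = (\<Sum>y\<in>R. y * indicator (A y) x)" by simp
    qed
    show "L2_tendsto (\<lambda>n x. s k (x + t n)) (s k)"
      unfolding eq by (intro L2_tendsto_sum fR L2_tendsto_cmult L2_tendsto_translate_set Am Af t)
  qed
qed

section \<open>The Fourier transform and Plancherel's theorem\<close>

text \<open>The transform carries no normalising constant, in accordance with
  \<open>fourier_trunc\<close>; the factors 2 * pi in the Plancherel and Parseval identities have
  this origin.\<close>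

definition ft :: "(real \<Rightarrow> complex) \<Rightarrow> real \<Rightarrow> complex" where
  "ft v \<xi> = (LINT x|lborel. v x * cis (- (x * \<xi>)))"

abbreviation ft_real :: "(real \<Rightarrow> real) \<Rightarrow> real \<Rightarrow> complex" where
  "ft_real \<psi> \<equiv> ft (\<lambda>x. complex_of_real (\<psi> x))"

lemma borel_measurable_cis [measurable]:
  "f \<in> borel_measurable M \<Longrightarrow> (\<lambda>x. cis (f x)) \<in> borel_measurable M"
  by (rule borel_measurable_continuous_on[of cis]) (auto intro: continuous_intros)

lemma integrable_mult_cis:
  assumes "integrable lborel v" "g \<in> borel_measurable borel"
  shows "integrable lborel (\<lambda>x. v x * cis (g x))"
proof (rule Bochner_Integration.integrable_bound[OF assms(1)])
  note [measurable] = borel_measurable_integrable[OF assms(1)] assms(2)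
  show "(\<lambda>x. v x * cis (g x)) \<in> borel_measurable lborel" by measurable
qed (simp add: norm_mult)

lemma ft_measurable [measurable]:
  assumes "integrable lborel v" shows "ft v \<in> borel_measurable borel"
proof -
  note [measurable] = borel_measurable_integrable[OF assms]
  have "(\<lambda>\<xi>. LINT x|lborel. v x * cis (- (x * \<xi>))) \<in> borel_measurable borel"
    by measurable
  then show ?thesis unfolding ft_def[abs_def] .
qed

lemma ft_bound:
  assumes "integrable lborel v" shows "cmod (ft v \<xi>) \<le> (LINT x|lborel. cmod (v x))"
  unfolding ft_def using integral_norm_bound[of lborel "\<lambda>x. v x * cis (- (x * \<xi>))"]
  by (simp add: norm_mult)

lemma ft_add: "integrable lborel u \<Longrightarrow> integrable lborel v \<Longrightarrow> ft (\<lambda>x. u x + v x) \<xi> = ft u \<xi> + ft v \<xi>"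
  unfolding ft_def by (simp add: distrib_right integrable_mult_cis)

lemma ft_cmult: "ft (\<lambda>x. a * u x) \<xi> = a * ft u \<xi>"
  unfolding ft_def by (simp add: mult.assoc)

lemma cnj_ft: "cnj (ft v \<xi>) = (LINT y|lborel. cnj (v y) * cis (y * \<xi>))"
proof -
  have "cnj (ft v \<xi>) = (LINT y|lborel. cnj (v y * cis (- (y * \<xi>))))"
    unfolding ft_def by (rule Bochner_Integration.integral_cnj[symmetric])
  then show ?thesis by (simp only: complex_cnj_mult cis_cnj minus_minus)
qed

lemma ft_translate: "ft (\<lambda>x. v (x + s)) \<xi> = cis (s * \<xi>) * ft v \<xi>"
proof -
  have "ft (\<lambda>x. v (x + s)) \<xi> = (LINT x|lborel. cis (s * \<xi>) * (v (x + s) * cis (- ((x + s) * \<xi>))))"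
    unfolding ft_def by (intro Bochner_Integration.integral_cong) (auto simp: cis_mult algebra_simps)
  also have "\<dots> = cis (s * \<xi>) * ft v \<xi>"
    unfolding ft_def using integral_translate[of "\<lambda>x. v x * cis (- (x * \<xi>))" s] by simp
  finally show ?thesis .
qed

lemma ft_modulate: "ft (\<lambda>x. cis (r * x) * v x) \<xi> = ft v (\<xi> - r)"
  unfolding ft_def by (intro Bochner_Integration.integral_cong) (auto simp: cis_mult algebra_simps)

text \<open>In the applications K is an oscillating exponential, which is bounded but not
  integrable. The product a x * b y serves as integrable majorant.\<close>

lemma Fubini_bounded_kernel:
  fixes a b :: "real \<Rightarrow> complex"
  assumes a: "integrable lborel a" and b: "integrable lborel b"
    and K: "(\<lambda>(x, y). K x y) \<in> borel_measurable (lborel \<Otimes>\<^sub>M lborel)" "\<And>x y. cmod (K x y) \<le> 1"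
  shows "(LINT x|lborel. LINT y|lborel. K x y * a x * b y) = (LINT y|lborel. LINT x|lborel. K x y * a x * b y)"
proof -
  note [measurable] = borel_measurable_integrable[OF a] borel_measurable_integrable[OF b] K(1)
  have "integrable (lborel \<Otimes>\<^sub>M lborel) (\<lambda>(x, y). K x y * a x * b y)"
  proof (rule Bochner_Integration.integrable_bound)
    show "integrable (lborel \<Otimes>\<^sub>M lborel) (\<lambda>(x, y). a x * b y)"
    proof (rule lborel_pair.Fubini_integrable)
      show "integrable lborel (\<lambda>x. LINT y|lborel. norm (case (x, y) of (x, y) \<Rightarrow> a x * b y))"
        using a by (simp add: norm_mult)
    qed (use b in auto)
    have "(\<lambda>p. (case p of (x, y) \<Rightarrow> K x y) * a (fst p) * b (snd p)) \<in> borel_measurable (lborel \<Otimes>\<^sub>M lborel)"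
      by measurable
    then show "(\<lambda>(x, y). K x y * a x * b y) \<in> borel_measurable (lborel \<Otimes>\<^sub>M lborel)"
      by (simp add: case_prod_beta')
    show "AE x in lborel \<Otimes>\<^sub>M lborel. cmod (case x of (x, y) \<Rightarrow> K x y * a x * b y) \<le> cmod (case x of (x, y) \<Rightarrow> a x * b y)"
      by (rule AE_I2) (auto simp: norm_mult mult.assoc intro!: mult_left_le_one_le K(2))
  qed
  from lborel_pair.Fubini_integral[OF this] show ?thesis by simp
qed

section \<open>Gaussian damping and Plancherel's theorem for integrable functions\<close>

abbreviation gauss :: "real \<Rightarrow> real" where "gauss \<equiv> std_normal_density"

lemma gauss_bounded: "gauss x \<le> gauss 0"
  by (simp add: normal_density_def divide_right_mono)

lemma integrable_gauss: "integrable lborel gauss"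
  using integrable_normal_density[of 1 0] by simp

text \<open>The left-hand side is the characteristic function of the standard normal
  distribution.\<close>

lemma integral_gauss_cis: "(LINT z|lborel. complex_of_real (gauss z) * cis (t * z)) = complex_of_real (exp (- (t^2) / 2))"
proof -
  have "(LINT z|lborel. complex_of_real (gauss z) * cis (t * z)) = char std_normal_distribution t"
    unfolding char_def by (subst integral_density) (auto simp: scaleR_conv_of_real cis_conv_exp)
  then show ?thesis by (simp add: char_std_normal_distribution)
qed

lemma integral_gauss_cis_scaled:
  assumes "e > 0"
  shows "(LINT \<xi>|lborel. complex_of_real (gauss (e * \<xi>)) * cis (- (s * \<xi>))) = complex_of_real (sqrt (2 * pi) / e * gauss (s / e))"
proof -
  have "(LINT z|lborel. complex_of_real (gauss z) * cis ((- s/e) * z))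
      = \<bar>e\<bar> *\<^sub>R (LINT \<xi>|lborel. complex_of_real (gauss (0 + e * \<xi>)) * cis ((- s/e) * (0 + e * \<xi>)))"
    by (rule lborel_integral_real_affine) (use assms in simp)
  then have "(LINT \<xi>|lborel. complex_of_real (gauss (e * \<xi>)) * cis (- (s * \<xi>))) = complex_of_real (exp (- ((-s/e)^2)/2) / e)"
    using assms unfolding integral_gauss_cis by (simp add: scaleR_conv_of_real field_simps)
  also have "exp (- ((-s/e)^2)/2) / e = sqrt (2 * pi) / e * gauss (s / e)"
    by (simp add: normal_density_def)
  finally show ?thesis .
qed

lemma integrable_gauss_scaled: "e > 0 \<Longrightarrow> integrable lborel (\<lambda>x. gauss (e * x))"
  using lborel_integrable_real_affine[OF integrable_gauss, of e 0] by simp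

text \<open>This is the inner product of u with the convolution of v and a Gaussian of width e.
  Substituting y = x - e * z in the convolution puts e into a translation, so the limit e
  \<rightarrow> 0 becomes a question about continuity of translations.\<close>

abbreviation gauss_average :: "real \<Rightarrow> (real \<Rightarrow> complex) \<Rightarrow> (real \<Rightarrow> complex) \<Rightarrow> complex" where
  "gauss_average e u v \<equiv> LINT z|lborel. complex_of_real (gauss z) * L2_inner u (\<lambda>x. v (x + (- (e * z))))"

text \<open>The Gaussian factor makes the frequency integral absolutely convergent, so all integrals
  may be exchanged. Carrying out the frequency integral first leaves a Gaussian in x - y, that is, a
  mollification of v.\<close>

lemma Plancherel_regularized:
  assumes u: "integrable lborel u" "L2 u" and v: "integrable lborel v" "L2 v" and e: "e > 0"
  shows "(LINT \<xi>|lborel. complex_of_real (gauss (e * \<xi>)) * (ft u \<xi> * cnj (ft v \<xi>)))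
      = sqrt (2 * pi) * gauss_average e u v"
proof -
  let ?g = "\<lambda>\<xi>. complex_of_real (gauss (e * \<xi>))"
  note [measurable] = borel_measurable_integrable[OF u(1)] borel_measurable_integrable[OF v(1)] u(1) v(1)
  have G: "integrable lborel (\<lambda>x. complex_of_real (gauss (e * x)))"
    using integrable_gauss_scaled[OF e] by simp
  have Gv: "integrable lborel (\<lambda>\<xi>. ?g \<xi> * cnj (ft v \<xi>))"
  proof (rule Bochner_Integration.integrable_bound)
    show "integrable lborel (\<lambda>x. (LINT x|lborel. cmod (v x)) * gauss (e * x))"
      using integrable_gauss_scaled[OF e] by simp
    show "AE x in lborel. norm (complex_of_real (gauss (e * x)) * cnj (ft v x)) \<le> norm ((LINT x|lborel. cmod (v x)) * gauss (e * x))"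
      by (intro AE_I2) (simp add: norm_mult mult.commute mult_right_mono ft_bound[OF v(1)])
  qed measurable
  \<comment> \<open>For fixed x the frequency integral yields, up to sqrt (2 * pi), the conjugate of
    a Gaussian mean of v around x.\<close>
  have h: "(LINT \<xi>|lborel. ?g \<xi> * cnj (ft v \<xi>) * cis (- (x * \<xi>)))
      = sqrt (2 * pi) * (LINT z|lborel. complex_of_real (gauss z) * cnj (v (x + (- (e * z)))))" for x
  proof -
    have "(LINT \<xi>|lborel. ?g \<xi> * cnj (ft v \<xi>) * cis (- (x * \<xi>)))
        = (LINT \<xi>|lborel. LINT y|lborel. cis (- ((x - y) * \<xi>)) * ?g \<xi> * cnj (v y))"
    proof (intro Bochner_Integration.integral_cong refl)
      fix \<xi>
      have "?g \<xi> * cnj (ft v \<xi>) * cis (- (x * \<xi>)) =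
         ?g \<xi> * cis (- (x * \<xi>)) * (LINT y|lborel. cnj (v y) * cis (y * \<xi>))"
        unfolding cnj_ft by (simp only: mult.assoc mult.commute mult.left_commute)
      also have "\<dots> = (LINT y|lborel. ?g \<xi> * cis (- (x * \<xi>)) * (cnj (v y) * cis (y * \<xi>)))"
        by simp
      also have "\<dots> = (LINT y|lborel. cis (- ((x - y) * \<xi>)) * ?g \<xi> * cnj (v y))"
        by (intro Bochner_Integration.integral_cong) (auto simp: cis_mult algebra_simps)
      finally show "?g \<xi> * cnj (ft v \<xi>) * cis (- (x * \<xi>)) = (LINT y|lborel. cis (- ((x - y) * \<xi>)) * ?g \<xi> * cnj (v y))" .
    qed
    also have "\<dots> = (LINT y|lborel. LINT \<xi>|lborel. cis (- ((x - y) * \<xi>)) * ?g \<xi> * cnj (v y))"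
      by (rule Fubini_bounded_kernel[OF G]) (use v in auto)
    also have "\<dots> = (LINT y|lborel. complex_of_real (sqrt (2 * pi) / e * gauss ((x - y) / e)) * cnj (v y))"
    proof (intro Bochner_Integration.integral_cong refl)
      fix y
      have "(LINT \<xi>|lborel. cis (- ((x - y) * \<xi>)) * ?g \<xi> * cnj (v y))
         = (LINT \<xi>|lborel. ?g \<xi> * cis (- ((x - y) * \<xi>))) * cnj (v y)"
        by (simp add: mult.commute)
      then show "(LINT \<xi>|lborel. cis (- ((x - y) * \<xi>)) * ?g \<xi> * cnj (v y)) =
          complex_of_real (sqrt (2 * pi) / e * gauss ((x - y) / e)) * cnj (v y)"
        unfolding integral_gauss_cis_scaled[OF e] .
    qed
    \<comment> \<open>Substitution y = x - e * z; its Jacobian e cancels the 1 / e in front of the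
      scaled Gaussian.\<close>
    also have "\<dots> = \<bar>- e\<bar> *\<^sub>R (LINT z|lborel. complex_of_real (sqrt (2 * pi) / e * gauss ((x - (x + (- e) * z)) / e)) * cnj (v (x + (- e) * z)))"
      by (rule lborel_integral_real_affine) (use e in simp)
    also have "\<dots> = (LINT z|lborel. sqrt (2 * pi) * (complex_of_real (gauss z) * cnj (v (x + (- (e * z))))))"
      unfolding integral_scaleR_right[symmetric] using e
      by (intro Bochner_Integration.integral_cong) (auto simp: scaleR_conv_of_real)
    finally show ?thesis by simp
  qed
  have "(LINT \<xi>|lborel. ?g \<xi> * (ft u \<xi> * cnj (ft v \<xi>)))
     = (LINT \<xi>|lborel. LINT x|lborel. cis (- (x * \<xi>)) * (?g \<xi> * cnj (ft v \<xi>)) * u x)"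
  proof (intro Bochner_Integration.integral_cong refl)
    fix \<xi>
    have "?g \<xi> * (ft u \<xi> * cnj (ft v \<xi>)) = (?g \<xi> * cnj (ft v \<xi>)) * (LINT x|lborel. u x * cis (- (x * \<xi>)))"
      unfolding ft_def[of u] by simp
    also have "\<dots> = (LINT x|lborel. (?g \<xi> * cnj (ft v \<xi>)) * (u x * cis (- (x * \<xi>))))"
      by simp
    also have "\<dots> = (LINT x|lborel. cis (- (x * \<xi>)) * (?g \<xi> * cnj (ft v \<xi>)) * u x)"
      by (intro Bochner_Integration.integral_cong) auto
    finally show "?g \<xi> * (ft u \<xi> * cnj (ft v \<xi>)) = (LINT x|lborel. cis (- (x * \<xi>)) * (?g \<xi> * cnj (ft v \<xi>)) * u x)" .
  qed
  also have "\<dots> = (LINT x|lborel. LINT \<xi>|lborel. cis (- (x * \<xi>)) * (?g \<xi> * cnj (ft v \<xi>)) * u x)"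
    by (rule Fubini_bounded_kernel[OF Gv u(1)]) auto
  also have "\<dots> = (LINT x|lborel. LINT z|lborel. sqrt (2 * pi) * (complex_of_real (gauss z) * (u x * cnj (v (x + (- (e * z)))))))"
  proof (rule Bochner_Integration.integral_cong[OF refl])
    fix x
    have "(LINT \<xi>|lborel. cis (- (x * \<xi>)) * (?g \<xi> * cnj (ft v \<xi>)) * u x)
       = (LINT \<xi>|lborel. ?g \<xi> * cnj (ft v \<xi>) * cis (- (x * \<xi>))) * u x"
      by (simp add: mult.commute)
    also have "\<dots> = (LINT z|lborel. (sqrt (2 * pi) * u x) * (complex_of_real (gauss z) * cnj (v (x + (- (e * z))))))"
      unfolding h by simp
    also have "\<dots> = (LINT z|lborel. sqrt (2 * pi) * (complex_of_real (gauss z) * (u x * cnj (v (x + (- (e * z)))))))"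
      by (intro Bochner_Integration.integral_cong) auto
    finally show "(LINT \<xi>|lborel. cis (- (x * \<xi>)) * (?g \<xi> * cnj (ft v \<xi>)) * u x) = (LINT z|lborel. sqrt (2 * pi) * (complex_of_real (gauss z) * (u x * cnj (v (x + (- (e * z)))))))" .
  qed
  \<comment> \<open>This exchange rests on square integrability: by Cauchy-Schwarz the inner
    integral is bounded by the product of the norms, uniformly in the translation.\<close>
  also have "\<dots> = (LINT z|lborel. LINT x|lborel. sqrt (2 * pi) * (complex_of_real (gauss z) * (u x * cnj (v (x + (- (e * z)))))))"
  proof (rule lborel_pair.Fubini_integral)
    let ?f = "\<lambda>(z, x). sqrt (2 * pi) * (complex_of_real (gauss z) * (u x * cnj (v (x + (- (e * z))))))"
    show "integrable (lborel \<Otimes>\<^sub>M lborel) ?f"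
    proof (rule lborel_pair.Fubini_integrable)
      show "?f \<in> borel_measurable (lborel \<Otimes>\<^sub>M lborel)" by measurable
      have b: "(LINT x|lborel. norm (u x * cnj (v (x + (- (e * z)))))) \<le> L2_norm u * L2_norm v" for z
        using L2_Cauchy_Schwarz[OF u(2) L2_translate[OF v(2), of "- (e * z)"]]
        by (simp add: norm_mult L2_norm_translate[of v "- (e * z)", simplified])
      show "integrable lborel (\<lambda>z. LINT x|lborel. norm (case (z, x) of (z, x) \<Rightarrow> sqrt (2 * pi) * (complex_of_real (gauss z) * (u x * cnj (v (x + (- (e * z))))))))"
      proof (rule Bochner_Integration.integrable_bound)
        show "integrable lborel (\<lambda>z. sqrt (2 * pi) * (gauss z * (L2_norm u * L2_norm v)))"
          using integrable_gauss by simp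
        show "AE z in lborel. norm (LINT x|lborel. norm (case (z, x) of (z, x) \<Rightarrow> sqrt (2 * pi) * (complex_of_real (gauss z) * (u x * cnj (v (x + (- (e * z)))))))) \<le> norm (sqrt (2 * pi) * (gauss z * (L2_norm u * L2_norm v)))"
          using b by (intro AE_I2) (simp add: norm_mult[of "complex_of_real _"] abs_mult del: norm_mult, intro mult_left_mono, auto)
      qed measurable
      show "AE z in lborel. integrable lborel (\<lambda>x. case (z, x) of (z, x) \<Rightarrow> sqrt (2 * pi) * (complex_of_real (gauss z) * (u x * cnj (v (x + (- (e * z)))))))"
        using integrable_L2_mult(2)[OF u(2) L2_translate[OF v(2), of "- (e * z)" for z]] by (intro AE_I2) simp
    qed
  qed
  also have "\<dots> = sqrt (2 * pi) * gauss_average e u v"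
    unfolding L2_inner_def by simp
  finally show ?thesis .
qed

text \<open>A Gaussian approximate identity: for each z the translates of v converge to v in L2,
  Cauchy-Schwarz supplies the majorant, and the Gaussian has total mass 1.\<close>

lemma L2_inner_translate_limit:
  assumes u: "L2 u" and v: "L2 v"
  shows "(\<lambda>n. gauss_average (1 / real (Suc n)) u v) \<longlonglongrightarrow> L2_inner u v"
proof -
  let ?i = "\<lambda>n z. L2_inner u (\<lambda>x. v (x + (- (1 / real (Suc n) * z))))"
  note [measurable] = u[THEN L2_measurable] v[THEN L2_measurable]
  have "(\<lambda>n. gauss_average (1 / real (Suc n)) u v)
    \<longlonglongrightarrow> (LINT z|lborel. complex_of_real (gauss z) * L2_inner u v)"
  proof (rule integral_dominated_convergence)
    show "integrable lborel (\<lambda>z. gauss z * (L2_norm u * L2_norm v))"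
      using integrable_gauss by simp
    show "(\<lambda>z. complex_of_real (gauss z) * ?i n z) \<in> borel_measurable lborel" for n
      unfolding L2_inner_def by measurable
    show "AE z in lborel. norm (complex_of_real (gauss z) * ?i n z)
       \<le> gauss z * (L2_norm u * L2_norm v)" for n
    proof (rule AE_I2)
      fix z
      have "cmod (?i n z) \<le> L2_norm u * L2_norm v"
        using L2_inner_le[OF u L2_translate[OF v, of "- (1 / real (Suc n) * z)"]]
        unfolding L2_norm_translate[of v "- (1 / real (Suc n) * z)"] .
      then show "norm (complex_of_real (gauss z) * ?i n z)
       \<le> gauss z * (L2_norm u * L2_norm v)"
        by (simp only: norm_mult norm_of_real abs_of_nonneg[OF normal_density_nonneg] mult_left_mono[OF _ normal_density_nonneg])
    qed
    show "AE z in lborel. (\<lambda>n. complex_of_real (gauss z) * ?i n z)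
       \<longlonglongrightarrow> complex_of_real (gauss z) * L2_inner u v"
    proof (rule AE_I2)
      fix z
      have "(\<lambda>n. - (1 / real (Suc n) * z)) \<longlonglongrightarrow> - (0 * z)"
        by (intro tendsto_intros LIMSEQ_Suc[OF lim_1_over_n])
      then have "(\<lambda>n. - (1 / real (Suc n) * z)) \<longlonglongrightarrow> 0" by simp
      from L2_tendsto_inner[OF L2_tendsto_const[OF u] L2_tendsto_translate[OF v this]]
      show "(\<lambda>n. complex_of_real (gauss z) * ?i n z)
         \<longlonglongrightarrow> complex_of_real (gauss z) * L2_inner u v"
        by (intro tendsto_intros)
    qed
  qed simp
  also have "(LINT z|lborel. complex_of_real (gauss z) * L2_inner u v) = L2_inner u v"
    using integral_gauss_cis[of 0] by simp
  finally show ?thesis .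
qed

lemma gauss_scaled_tendsto: "(\<lambda>n. gauss (1 / real (Suc n) * \<xi>)) \<longlonglongrightarrow> gauss 0"
proof -
  have "(\<lambda>n. 1 / real (Suc n) * \<xi>) \<longlonglongrightarrow> 0 * \<xi>"
    by (intro tendsto_intros LIMSEQ_Suc[OF lim_1_over_n])
  moreover have "isCont gauss (0 * \<xi>)" unfolding normal_density_def by (auto intro!: continuous_intros)
  ultimately have "(\<lambda>n. gauss (1 / real (Suc n) * \<xi>)) \<longlonglongrightarrow> gauss (0 * \<xi>)"
    by (rule isCont_tendsto_compose[rotated])
  then show ?thesis by simp
qed

lemma gauss_0: "sqrt (2 * pi) * gauss 0 = 1"
  by (simp add: normal_density_def)

text \<open>Monotone convergence is used because square integrability of \<open>ft v\<close> is
  itself part of the conclusion. The damping factors increase with n, sqrt (2 * pi) normalises their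
  limit to 1, and the damped integrals have a finite limit by the regularised identity.\<close>

lemma Plancherel_L1_L2:
  assumes v: "integrable lborel v" "L2 v"
  shows "L2 (ft v)" "(L2_norm (ft v))^2 = 2 * pi * (L2_norm v)^2"
proof -
  note [measurable] = v(1)
  let ?f = "\<lambda>n \<xi>. sqrt (2 * pi) * gauss (1 / real (Suc n) * \<xi>) * (cmod (ft v \<xi>))^2"
  have I: "integrable lborel (?f n)" for n
  proof (rule Bochner_Integration.integrable_bound)
    let ?C = "LINT x|lborel. cmod (v x)"
    show "integrable lborel (\<lambda>\<xi>. sqrt (2 * pi) * ?C^2 * gauss (1 / real (Suc n) * \<xi>))"
      by (intro integrable_mult_right integrable_gauss_scaled) simp
    show "AE \<xi> in lborel. norm (?f n \<xi>) \<le> norm (sqrt (2 * pi) * ?C^2 * gauss (1 / real (Suc n) * \<xi>))"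
    proof (rule AE_I2)
      fix \<xi>
      have "(cmod (ft v \<xi>))^2 \<le> ?C^2" by (intro power_mono ft_bound v) simp
      from mult_left_mono[OF this, of "sqrt (2 * pi) * gauss (1 / real (Suc n) * \<xi>)"]
      show "norm (?f n \<xi>) \<le> norm (sqrt (2 * pi) * ?C^2 * gauss (1 / real (Suc n) * \<xi>))"
        by (simp add: abs_mult normal_density_nonneg mult_ac)
    qed
  qed measurable
  have lim: "(\<lambda>n. LINT \<xi>|lborel. ?f n \<xi>) \<longlonglongrightarrow> 2 * pi * (L2_norm v)^2"
  proof -
    have "complex_of_real (LINT \<xi>|lborel. ?f n \<xi>)
       = 2 * pi * gauss_average (1 / real (Suc n)) v v" for n
    proof -
      have "complex_of_real (LINT \<xi>|lborel. ?f n \<xi>)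
         = (LINT \<xi>|lborel. complex_of_real (sqrt (2 * pi)) * (complex_of_real (gauss (1 / real (Suc n) * \<xi>)) * (ft v \<xi> * cnj (ft v \<xi>))))"
        unfolding integral_complex_of_real[symmetric]
        by (rule Bochner_Integration.integral_cong[OF refl]) (simp only: of_real_mult complex_norm_square mult.assoc)
      also have "\<dots> = complex_of_real (sqrt (2 * pi)) * (LINT \<xi>|lborel. complex_of_real (gauss (1 / real (Suc n) * \<xi>)) * (ft v \<xi> * cnj (ft v \<xi>)))"
        by (rule integral_mult_right_zero)
      also have "\<dots> = complex_of_real (sqrt (2 * pi)) * (complex_of_real (sqrt (2 * pi)) * gauss_average (1 / real (Suc n)) v v)"
        by (subst Plancherel_regularized[OF v v]) simp_all
      also have "\<dots> = complex_of_real (sqrt (2 * pi) * sqrt (2 * pi)) * gauss_average (1 / real (Suc n)) v v"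
        by (simp only: of_real_mult mult.assoc)
      finally show ?thesis by simp
    qed
    moreover have "(\<lambda>n. 2 * pi * gauss_average (1 / real (Suc n)) v v)
        \<longlonglongrightarrow> complex_of_real (2 * pi) * L2_inner v v"
      using tendsto_mult_left[OF L2_inner_translate_limit[OF v(2) v(2)], of "complex_of_real (2 * pi)"] by simp
    ultimately have "(\<lambda>n. complex_of_real (LINT \<xi>|lborel. ?f n \<xi>)) \<longlonglongrightarrow> complex_of_real (2 * pi * (L2_norm v)^2)"
      by (simp add: L2_inner_self)
    then show ?thesis unfolding tendsto_of_real_iff .
  qed
  have mono: "AE \<xi> in lborel. mono (\<lambda>n. ?f n \<xi>)"
  proof (intro AE_I2 monoI)
    fix \<xi> :: real and m n :: nat assume "m \<le> n"
    have "(1 / real (Suc n) * \<xi>)^2 \<le> (1 / real (Suc m) * \<xi>)^2"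
      using \<open>m \<le> n\<close> unfolding power_mult_distrib
      by (intro mult_right_mono power_mono) (auto simp: frac_le)
    then have "gauss (1 / real (Suc m) * \<xi>) \<le> gauss (1 / real (Suc n) * \<xi>)"
      by (simp add: normal_density_def divide_right_mono)
    then show "?f m \<xi> \<le> ?f n \<xi>" by (intro mult_right_mono mult_left_mono) auto
  qed
  have ptw: "AE \<xi> in lborel. (\<lambda>n. ?f n \<xi>) \<longlonglongrightarrow> (cmod (ft v \<xi>))^2"
  proof (rule AE_I2)
    fix \<xi>
    have "(\<lambda>n. ?f n \<xi>) \<longlonglongrightarrow> sqrt (2 * pi) * gauss 0 * (cmod (ft v \<xi>))^2"
      by (intro tendsto_intros gauss_scaled_tendsto)
    then show "(\<lambda>n. ?f n \<xi>) \<longlonglongrightarrow> (cmod (ft v \<xi>))^2" unfolding gauss_0 by simp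
  qed
  have m: "(\<lambda>\<xi>. (cmod (ft v \<xi>))^2) \<in> borel_measurable lborel" by measurable
  show "L2 (ft v)" unfolding L2_def
    using integrable_monotone_convergence[OF I mono ptw lim m] ft_measurable[OF v(1)] by simp
  show "(L2_norm (ft v))^2 = 2 * pi * (L2_norm v)^2"
    unfolding L2_norm_power2[of "ft v"] by (rule integral_monotone_convergence[OF I mono ptw lim m])
qed

text \<open>Once both transforms are square integrable, their product is an integrable majorant and
  the damping can be removed from the regularised identity directly, without polarisation.\<close>

lemma Parseval_L1_L2:
  assumes u: "integrable lborel u" "L2 u" and v: "integrable lborel v" "L2 v"
  shows "L2_inner (ft u) (ft v) = 2 * pi * L2_inner u v"
proof -
  note [measurable] = u(1) v(1)
  note I = integrable_L2_mult(2)[OF Plancherel_L1_L2(1)[OF u] Plancherel_L1_L2(1)[OF v]]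
  let ?f = "\<lambda>n \<xi>. complex_of_real (gauss (1 / real (Suc n) * \<xi>)) * (ft u \<xi> * cnj (ft v \<xi>))"
  have "(\<lambda>n. LINT \<xi>|lborel. ?f n \<xi>) \<longlonglongrightarrow> (LINT \<xi>|lborel. complex_of_real (gauss 0) * (ft u \<xi> * cnj (ft v \<xi>)))"
  proof (rule integral_dominated_convergence)
    show "integrable lborel (\<lambda>\<xi>. gauss 0 * cmod (ft u \<xi> * cnj (ft v \<xi>)))"
      using integrable_norm[OF I] by simp
    show "AE \<xi> in lborel. norm (?f n \<xi>) \<le> gauss 0 * cmod (ft u \<xi> * cnj (ft v \<xi>))" for n
      by (intro AE_I2, subst norm_mult, intro mult_right_mono)
         (simp_all only: norm_of_real abs_of_nonneg[OF normal_density_nonneg] gauss_bounded norm_ge_zero)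
    show "AE \<xi> in lborel. (\<lambda>n. ?f n \<xi>) \<longlonglongrightarrow> complex_of_real (gauss 0) * (ft u \<xi> * cnj (ft v \<xi>))"
      by (intro AE_I2 tendsto_intros gauss_scaled_tendsto)
  qed measurable
  moreover have "(\<lambda>n. LINT \<xi>|lborel. ?f n \<xi>) \<longlonglongrightarrow> complex_of_real (sqrt (2 * pi)) * L2_inner u v"
    using tendsto_mult_left[OF L2_inner_translate_limit[OF u(2) v(2)], of "complex_of_real (sqrt (2 * pi))"]
    by (subst Plancherel_regularized[OF u v]) simp_all
  ultimately have "(LINT \<xi>|lborel. complex_of_real (gauss 0) * (ft u \<xi> * cnj (ft v \<xi>))) = complex_of_real (sqrt (2 * pi)) * L2_inner u v"
    by (rule LIMSEQ_unique)
  then have "complex_of_real (gauss 0) * L2_inner (ft u) (ft v) = complex_of_real (sqrt (2 * pi)) * L2_inner u v"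
    unfolding L2_inner_def[of "ft u"] by simp
  then have "complex_of_real (sqrt (2 * pi) * gauss 0) * L2_inner (ft u) (ft v) = complex_of_real (sqrt (2 * pi) * sqrt (2 * pi)) * L2_inner u v"
    by (simp only: of_real_mult mult.assoc)
  then show ?thesis unfolding gauss_0 by simp
qed

text \<open>The extension of \<^const>\<open>ft\<close> to square integrable functions, as the closure of its graph.
  In contrast to limits along truncations this is visibly invariant under translation and modulation.\<close>
definition Fourier_pair :: "(real \<Rightarrow> complex) \<Rightarrow> (real \<Rightarrow> complex) \<Rightarrow> bool" where
  "Fourier_pair u U \<longleftrightarrow> (\<exists>v. (\<forall>n. integrable lborel (v n)) \<and> L2_tendsto v u \<and> L2_tendsto (\<lambda>n. ft (v n)) U)"

abbreviation Fourier_pair_real :: "(real \<Rightarrow> real) \<Rightarrow> (real \<Rightarrow> complex) \<Rightarrow> bool" where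
  "Fourier_pair_real u \<equiv> Fourier_pair (\<lambda>x. complex_of_real (u x))"

lemma Fourier_pair_L2: "Fourier_pair u U \<Longrightarrow> L2 u" "Fourier_pair u U \<Longrightarrow> L2 U"
  by (auto simp: Fourier_pair_def L2_tendsto_def)

lemma Fourier_pair_ft: "integrable lborel v \<Longrightarrow> L2 v \<Longrightarrow> Fourier_pair v (ft v)"
  unfolding Fourier_pair_def
  by (intro exI[of _ "\<lambda>n. v"] conjI allI L2_tendsto_const Plancherel_L1_L2(1))

lemma Parseval:
  assumes "Fourier_pair u U" "Fourier_pair v V"
  shows "L2_inner U V = 2 * pi * L2_inner u v"
proof -
  obtain a where a: "\<And>n. integrable lborel (a n)" "L2_tendsto a u" "L2_tendsto (\<lambda>n. ft (a n)) U"
    using assms(1) unfolding Fourier_pair_def by auto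
  obtain b where b: "\<And>n. integrable lborel (b n)" "L2_tendsto b v" "L2_tendsto (\<lambda>n. ft (b n)) V"
    using assms(2) unfolding Fourier_pair_def by auto
  have l: "(\<lambda>n. L2_inner (ft (a n)) (ft (b n))) \<longlonglongrightarrow> L2_inner U V"
    by (rule L2_tendsto_inner[OF a(3) b(3)])
  have e: "L2_inner (ft (a n)) (ft (b n)) = 2 * pi * L2_inner (a n) (b n)" for n
    by (intro Parseval_L1_L2 a b L2_tendstoD(1)[OF a(2)] L2_tendstoD(1)[OF b(2)])
  have "(\<lambda>n. 2 * pi * L2_inner (a n) (b n)) \<longlonglongrightarrow> 2 * pi * L2_inner u v"
    by (intro tendsto_intros L2_tendsto_inner a b)
  with l show ?thesis unfolding e by (rule LIMSEQ_unique)
qed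

lemma Plancherel: "Fourier_pair u U \<Longrightarrow> (L2_norm U)^2 = 2 * pi * (L2_norm u)^2"
  using Parseval[of u U u U] unfolding L2_inner_self by (metis of_real_eq_iff of_real_mult)

lemma Fourier_pair_add:
  assumes "Fourier_pair u U" "Fourier_pair v V"
  shows "Fourier_pair (\<lambda>x. u x + v x) (\<lambda>x. U x + V x)"
proof -
  obtain a where a: "\<And>n. integrable lborel (a n)" "L2_tendsto a u" "L2_tendsto (\<lambda>n. ft (a n)) U"
    using assms(1) unfolding Fourier_pair_def by auto
  obtain b where b: "\<And>n. integrable lborel (b n)" "L2_tendsto b v" "L2_tendsto (\<lambda>n. ft (b n)) V"
    using assms(2) unfolding Fourier_pair_def by auto
  have "(\<lambda>n. ft (\<lambda>x. a n x + b n x)) = (\<lambda>n x. ft (a n) x + ft (b n) x)"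
    by (intro ext ft_add a b)
  then show ?thesis unfolding Fourier_pair_def
    using a b L2_tendsto_add[OF a(2) b(2)] L2_tendsto_add[OF a(3) b(3)]
    by (intro exI[of _ "\<lambda>n x. a n x + b n x"]) auto
qed

lemma Fourier_pair_cmult:
  assumes "Fourier_pair u U"
  shows "Fourier_pair (\<lambda>x. c * u x) (\<lambda>x. c * U x)"
proof -
  obtain a where a: "\<And>n. integrable lborel (a n)" "L2_tendsto a u" "L2_tendsto (\<lambda>n. ft (a n)) U"
    using assms(1) unfolding Fourier_pair_def by auto
  have "(\<lambda>n. ft (\<lambda>x. c * a n x)) = (\<lambda>n x. c * ft (a n) x)"
    by (intro ext ft_cmult)
  then show ?thesis unfolding Fourier_pair_def
    using a L2_tendsto_cmult[OF a(2)] L2_tendsto_cmult[OF a(3)]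
    by (intro exI[of _ "\<lambda>n x. c * a n x"]) auto
qed

lemma Fourier_pair_diff:
  assumes "Fourier_pair u U" "Fourier_pair v V"
  shows "Fourier_pair (\<lambda>x. u x - v x) (\<lambda>x. U x - V x)"
  using Fourier_pair_add[OF assms(1) Fourier_pair_cmult[OF assms(2), of "-1"]] by simp

lemma L2_tendsto_mult_unimodular:
  assumes "L2_tendsto v u" "b \<in> borel_measurable borel" "\<And>x. cmod (b x) = 1"
  shows "L2_tendsto (\<lambda>n x. b x * v n x) (\<lambda>x. b x * u x)"
proof -
  have "L2_norm (\<lambda>x. b x * v n x - b x * u x) = L2_norm (\<lambda>x. v n x - u x)" for n
    unfolding L2_norm_def by (simp add: assms(3) norm_mult flip: right_diff_distrib)
  moreover have "L2 (\<lambda>x. b x * w x)" if "L2 w" for w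
    by (rule L2_mult_bounded[OF that assms(2), of 1]) (simp add: assms(3))
  ultimately show ?thesis using assms(1) by (simp add: L2_tendsto_def)
qed

lemma L2_tendsto_shift:
  assumes "L2_tendsto v u" shows "L2_tendsto (\<lambda>n x. v n (x + t)) (\<lambda>x. u (x + t))"
  unfolding L2_tendsto_def L2_norm_translate[of "\<lambda>x. v n x - u x" t for n]
  using L2_tendstoD(3)[OF assms]
  by (intro conjI allI L2_translate[OF L2_tendstoD(1)[OF assms]] L2_translate[OF L2_tendstoD(2)[OF assms]])

lemma Fourier_pair_translate:
  assumes "Fourier_pair u U"
  shows "Fourier_pair (\<lambda>x. u (x + s)) (\<lambda>\<xi>. cis (s * \<xi>) * U \<xi>)"
proof -
  obtain a where a: "\<And>n. integrable lborel (a n)" "L2_tendsto a u" "L2_tendsto (\<lambda>n. ft (a n)) U"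
    using assms(1) unfolding Fourier_pair_def by auto
  have "(\<lambda>n. ft (\<lambda>x. a n (x + s))) = (\<lambda>n \<xi>. cis (s * \<xi>) * ft (a n) \<xi>)"
    by (intro ext ft_translate)
  then show ?thesis unfolding Fourier_pair_def
    using a L2_tendsto_shift[OF a(2)] L2_tendsto_mult_unimodular[OF a(3), of "\<lambda>\<xi>. cis (s * \<xi>)"]
    by (intro exI[of _ "\<lambda>n x. a n (x + s)"]) (auto intro: integrable_translate)
qed

lemma Fourier_pair_modulate:
  assumes "Fourier_pair u U"
  shows "Fourier_pair (\<lambda>x. cis (r * x) * u x) (\<lambda>\<xi>. U (\<xi> - r))"
proof -
  obtain a where a: "\<And>n. integrable lborel (a n)" "L2_tendsto a u" "L2_tendsto (\<lambda>n. ft (a n)) U"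
    using assms(1) unfolding Fourier_pair_def by auto
  have "(\<lambda>n. ft (\<lambda>x. cis (r * x) * a n x)) = (\<lambda>n \<xi>. ft (a n) (\<xi> + (- r)))"
    by (intro ext) (simp add: ft_modulate)
  then show ?thesis unfolding Fourier_pair_def
    using a L2_tendsto_shift[OF a(3), of "- r"] L2_tendsto_mult_unimodular[OF a(2), of "\<lambda>\<xi>. cis (r * \<xi>)"]
      integrable_mult_cis[OF a(1), of "\<lambda>x. r * x"]
    by (intro exI[of _ "\<lambda>n x. cis (r * x) * a n x"]) (auto simp: mult.commute)
qed

lemma Fourier_pair_cong_AE:
  assumes "Fourier_pair u U" "V \<in> borel_measurable borel" "AE x in lborel. U x = V x"
  shows "Fourier_pair u V"
proof -
  obtain a where a: "\<And>n. integrable lborel (a n)" "L2_tendsto a u" "L2_tendsto (\<lambda>n. ft (a n)) U"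
    using assms(1) unfolding Fourier_pair_def by auto
  note L = L2_tendstoD[OF a(3)]
  have V: "L2 V" by (rule L2_cong_AE[OF L(2) assms(2,3)])
  have "L2_norm (\<lambda>x. ft (a n) x - V x) = L2_norm (\<lambda>x. ft (a n) x - U x)" for n
    using L2_measurable[OF L(1)[of n]] L2_measurable[OF L(2)] assms(2,3) by (intro L2_norm_cong_AE) auto
  then have "L2_tendsto (\<lambda>n. ft (a n)) V" using L V by (simp add: L2_tendsto_def)
  with a show ?thesis unfolding Fourier_pair_def by blast
qed

text \<open>By Plancherel a transform of 0 has norm 0; this is applied to the difference of the two
  pairs.\<close>

lemma Fourier_pair_unique:
  assumes "Fourier_pair u U" "Fourier_pair u V"
  shows "AE x in lborel. U x = V x"
proof -
  have "Fourier_pair (\<lambda>x. u x - u x) (\<lambda>x. U x - V x)" by (rule Fourier_pair_diff[OF assms])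
  from Plancherel[OF this] have "L2_norm (\<lambda>x. U x - V x) = 0" by (simp add: L2_norm_def[of "\<lambda>x. 0"])
  from L2_norm_eq_0[OF L2_diff this] show ?thesis using assms by (auto dest: Fourier_pair_L2)
qed

lemma Fourier_pair_eq_0:
  assumes "Fourier_pair u U" "AE x in lborel. U x = 0"
  shows "AE x in lborel. u x = 0"
proof -
  note L = Fourier_pair_L2[OF assms(1)]
  have "L2_norm U = L2_norm (\<lambda>x. 0)" using assms(2) L2_measurable[OF L(2)] by (intro L2_norm_cong_AE) auto
  then have "L2_norm U = 0" by (simp add: L2_norm_def)
  with Plancherel[OF assms(1)] have "L2_norm u = 0" by simp
  from L2_norm_eq_0[OF L(1) this] show ?thesis .
qed

section \<open>Truncations and existence of the transform on all of L2\<close>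

lemma L2_truncate_tendsto:
  assumes u: "L2 u" shows "L2_tendsto (\<lambda>n x. indicator {- real n..real n} x * u x) u"
proof (rule L2_tendsto_dominated[OF _ _ u])
  note [measurable] = L2_measurable[OF u]
  show "(\<lambda>x. indicator {- real n..real n} x * u x) \<in> borel_measurable borel" for n by measurable
  show "AE x in lborel. (\<lambda>n. indicator {- real n..real n} x * u x) \<longlonglongrightarrow> u x"
  proof (rule AE_I2)
    fix x
    obtain N where N: "\<bar>x\<bar> \<le> real N" using real_arch_simple by blast
    have "\<forall>\<^sub>F n in sequentially. indicator {- real n..real n} x * u x = u x"
      using eventually_ge_at_top[of N]
    proof eventually_elim
      case (elim n)
      have "x \<in> {- real n..real n}" using N elim by (auto simp: abs_le_iff)
      then show ?case by simp
    qed
    then show "(\<lambda>n. indicator {- real n..real n} x * u x) \<longlonglongrightarrow> u x" by (rule tendsto_eventually)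
  qed
qed (use L2_measurable[OF u] in \<open>auto split: split_indicator\<close>)

lemma integrable_truncate:
  assumes u: "L2 (u :: real \<Rightarrow> complex)" shows "integrable lborel (\<lambda>x. indicator {- R..R} x * u x)"
proof -
  have "L2 (indicator {- R..R} :: real \<Rightarrow> complex)" by (rule L2_indicator) (auto simp: emeasure_lborel_Icc_eq)
  from integrable_L2_mult(3)[OF this u] show ?thesis .
qed

text \<open>By Plancherel the transforms of the truncations form a Cauchy sequence, whose limit
  exists by completeness. The truncation radii are selected to meet the rate that
  \<open>L2_complete\<close> demands.\<close>

lemma Fourier_pair_exists:
  assumes u: "L2 u" shows "\<exists>U. Fourier_pair u U"
proof -
  let ?T = "\<lambda>n x. indicator {- real n..real n} x * u x"
  note T = L2_tendstoD[OF L2_truncate_tendsto[OF u]]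
  \<comment> \<open>Chosen such that 2 * pi * (2 * d n)^2 = (1/4)^n, the rate of the transforms
    after the triangle inequality and Plancherel.\<close>
  define d where "d k = (1/2)^k / (2 * sqrt (2 * pi))" for k :: nat
  have dpos: "d k > 0" for k by (simp add: d_def)
  have "\<exists>R. L2_norm (\<lambda>x. ?T R x - u x) < d k" for k
    using order_tendstoD(2)[OF T(3) dpos[of k]] by (auto simp: eventually_sequentially)
  then obtain R where R: "\<And>k. L2_norm (\<lambda>x. ?T (R k) x - u x) < d k" by metis
  define v where "v k = ?T (R k)" for k
  have vI: "integrable lborel (v k)" and vL: "L2 (v k)" for k
    unfolding v_def by (rule integrable_truncate[OF u], rule T(1))
  have vu: "L2_tendsto v u" unfolding L2_tendsto_def
  proof (intro conjI allI vL u)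
    have l0: "(\<lambda>k. (1/2)^k / (2 * sqrt (2 * pi))) \<longlonglongrightarrow> 0"
      by (intro tendsto_divide_zero LIMSEQ_power_zero) simp
    show "(\<lambda>n. L2_norm (\<lambda>x. v n x - u x)) \<longlonglongrightarrow> 0"
      by (rule Lim_null_comparison[OF always_eventually[OF allI] l0])
        (use less_imp_le[OF R] in \<open>simp add: v_def d_def\<close>)
  qed
  have "(L2_norm (\<lambda>\<xi>. ft (v m) \<xi> - ft (v n) \<xi>))^2 \<le> (1/4)^n" if "m \<ge> n" for m n
  proof -
    have "L2_norm (\<lambda>x. v m x - v n x) \<le> L2_norm (\<lambda>x. v m x - u x) + L2_norm (\<lambda>x. u x - v n x)"
      using L2_norm_triangle[OF L2_diff[OF vL u] L2_diff[OF u vL], of m n] by simp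
    also have "\<dots> \<le> d m + d n"
      using R[of m] R[of n] by (simp add: v_def L2_norm_minus_commute[of u])
    also have "\<dots> \<le> 2 * d n"
    proof -
      have "d m \<le> d n" unfolding d_def by (intro divide_right_mono power_decreasing that) simp_all
      then show ?thesis by simp
    qed
    finally have "L2_norm (\<lambda>x. v m x - v n x) \<le> 2 * d n" .
    from power_mono[OF this, of 2] have b: "(L2_norm (\<lambda>x. v m x - v n x))^2 \<le> (2 * d n)^2" by simp
    have "(L2_norm (\<lambda>\<xi>. ft (v m) \<xi> - ft (v n) \<xi>))^2 = 2 * pi * (L2_norm (\<lambda>x. v m x - v n x))^2"
      by (rule Plancherel[OF Fourier_pair_diff]; rule Fourier_pair_ft[OF vI vL])
    also have "\<dots> \<le> 2 * pi * (2 * d n)^2" by (intro mult_left_mono b) simp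
    also have "\<dots> = ((1/2)^n)^2" by (simp add: d_def power_divide power_mult_distrib)
    also have "\<dots> = (1/4::real)^n" by (simp add: power2_eq_square flip: power_mult_distrib)
    finally show ?thesis .
  qed
  then obtain U where "L2_tendsto (\<lambda>n. ft (v n)) U"
    using L2_complete[of "\<lambda>n. ft (v n)"] Plancherel_L1_L2(1)[OF vI vL] by blast
  with vu vI show ?thesis unfolding Fourier_pair_def by blast
qed

text \<open>The integer truncations themselves form the witnessing sequence: they are integrable,
  and their transforms are the \<open>fourier_trunc\<close> of the definition.\<close>

lemma is_fourier_Fourier_pair:
  assumes "is_fourier u U" shows "Fourier_pair_real u U"
proof -
  let ?u = "\<lambda>x. complex_of_real (u x)"
  have u: "L2 ?u" and U: "L2 U" using assms by (auto simp: is_fourier_def)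
  let ?T = "\<lambda>n x. indicator {- real n..real n} x * ?u x"
  have ft: "ft (?T n) = fourier_trunc u (real n)" for n
    by (rule ext) (simp add: ft_def fourier_trunc_def)
  have L: "L2 (ft (?T n))" for n
    by (rule Plancherel_L1_L2(1)[OF integrable_truncate[OF u] L2_tendstoD(1)[OF L2_truncate_tendsto[OF u]]])
  have "(\<lambda>n. \<integral>\<^sup>+ \<xi>. ennreal ((cmod (U \<xi> - fourier_trunc u (real n) \<xi>))^2) \<partial>lborel) \<longlonglongrightarrow> 0"
    using assms unfolding is_fourier_def by (auto elim!: filterlim_compose[OF _ filterlim_real_sequentially])
  moreover have "(\<integral>\<^sup>+ \<xi>. ennreal ((cmod (U \<xi> - fourier_trunc u (real n) \<xi>))^2) \<partial>lborel) = ennreal ((L2_norm (\<lambda>x. ft (?T n) x - U x))^2)" for n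
    unfolding ft[symmetric] L2_norm_minus_commute[of "ft _"] L2_norm_power2 using L2_diff[OF U L[of n]]
    by (intro nn_integral_eq_integral) (auto simp: L2_def)
  ultimately have "(\<lambda>n. ennreal ((L2_norm (\<lambda>x. ft (?T n) x - U x))^2)) \<longlonglongrightarrow> ennreal 0" by simp
  then have "(\<lambda>n. (L2_norm (\<lambda>x. ft (?T n) x - U x))^2) \<longlonglongrightarrow> 0"
    by (subst (asm) tendsto_ennreal_iff) auto
  from tendsto_real_sqrt[OF this] have "(\<lambda>n. L2_norm (\<lambda>x. ft (?T n) x - U x)) \<longlonglongrightarrow> 0" by simp
  then have "L2_tendsto (\<lambda>n. ft (?T n)) U" using L U by (simp add: L2_tendsto_def)
  then show ?thesis unfolding Fourier_pair_def
    by (intro exI[of _ ?T] conjI allI L2_truncate_tendsto[OF u] integrable_truncate[OF u])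
qed

section \<open>Pointwise bounds by duality\<close>

text \<open>The dual function is the sign of \<phi> on E, so that pairing it with \<phi> gives the
  integral of \<bar>\<phi>\<bar> over E. The measure of E controls its transform twice: pointwise
  through the L1 norm, and in L2 through Plancherel.\<close>

lemma set_dual_function:
  fixes \<phi> :: "real \<Rightarrow> real"
  assumes F: "Fourier_pair_real \<phi> U" and E: "E \<in> sets borel" "emeasure lborel E < \<infinity>"
  obtains s where "integrable lborel s" "L2 s" "\<And>\<xi>. cmod (ft s \<xi>) \<le> measure lborel E"
    "(L2_norm (ft s))^2 \<le> 2 * pi * measure lborel E"
    "complex_of_real (LINT x|lborel. indicator E x * \<bar>\<phi> x\<bar>) = L2_inner U (ft s) / (2 * pi)"
proof -
  have \<phi>: "L2 \<phi>" using Fourier_pair_L2(1)[OF F] by simp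
  have [measurable]: "\<phi> \<in> borel_measurable borel" "E \<in> sets borel" using \<phi> E by (auto simp: L2_def)
  define s where "s x = complex_of_real (indicator E x * sgn (\<phi> x))" for x
  have [measurable]: "s \<in> borel_measurable borel" unfolding s_def sgn_real_def by measurable
  have sb: "cmod (s x) \<le> indicator E x" for x by (auto simp: s_def sgn_real_def split: split_indicator)
  have iE: "integrable lborel (indicator E :: real \<Rightarrow> real)" using E by (intro integrable_real_indicator) auto
  have sI: "integrable lborel s"
    by (rule Bochner_Integration.integrable_bound[OF iE]) (use sb in auto)
  have sL: "L2 s"
  proof (rule L2_bound[OF _ L2_indicator[OF E], of _ 1])
    show "AE x in lborel. cmod (s x) \<le> 1 * cmod (indicator E x)"
    proof (rule AE_I2)
      fix x show "cmod (s x) \<le> 1 * cmod (indicator E x)"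
        using sb[of x] by (cases "x \<in> E") simp_all
    qed
  qed measurable
  have s1: "(LINT x|lborel. cmod (s x)) \<le> measure lborel E"
  proof -
    have "(LINT x|lborel. cmod (s x)) \<le> (LINT x|lborel. indicator E x)"
      by (intro integral_mono integrable_norm sI iE sb)
    then show ?thesis by simp
  qed
  have s2: "(L2_norm s)^2 \<le> measure lborel E"
  proof -
    have "(LINT x|lborel. (cmod (s x))^2) \<le> (LINT x|lborel. indicator E x)"
    proof (rule integral_mono)
      show "(cmod (s x))^2 \<le> indicator E x" for x
        using sb[of x] by (cases "x \<in> E") (auto intro: power_le_one)
    qed (use sL iE in \<open>auto simp: L2_def\<close>)
    then show ?thesis by (simp add: L2_norm_power2)
  qed
  have "2 * pi * L2_inner (\<lambda>x. complex_of_real (\<phi> x)) s = L2_inner U (ft s)"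
    using Parseval[OF F Fourier_pair_ft[OF sI sL]] by simp
  moreover have "L2_inner (\<lambda>x. complex_of_real (\<phi> x)) s = complex_of_real (LINT x|lborel. indicator E x * \<bar>\<phi> x\<bar>)"
    unfolding L2_inner_def integral_complex_of_real[symmetric]
    by (rule Bochner_Integration.integral_cong) (auto simp: s_def sgn_real_def split: split_indicator)
  ultimately have "complex_of_real (LINT x|lborel. indicator E x * \<bar>\<phi> x\<bar>) = L2_inner U (ft s) / (2 * pi)"
    by (simp add: field_simps)
  moreover have "(L2_norm (ft s))^2 \<le> 2 * pi * measure lborel E"
    unfolding Plancherel_L1_L2(2)[OF sI sL] using s2 by (intro mult_left_mono) auto
  moreover have "cmod (ft s \<xi>) \<le> measure lborel E" for \<xi>
    using ft_bound[OF sI, of \<xi>] s1 by linarith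
  ultimately show thesis using that sI sL by blast
qed

lemma integrable_indicator_abs:
  fixes \<phi> :: "real \<Rightarrow> real"
  assumes "L2 \<phi>" "E \<in> sets borel" "emeasure lborel E < \<infinity>"
  shows "integrable lborel (\<lambda>x. indicator E x * \<bar>\<phi> x\<bar>)"
proof -
  have "integrable lborel (\<lambda>x. cmod (indicator E x) * cmod (complex_of_real (\<phi> x)))"
    using assms by (intro integrable_L2_mult(1) L2_indicator) auto
  moreover have "(\<lambda>x. cmod (indicator E x) * cmod (complex_of_real (\<phi> x))) = (\<lambda>x. indicator E x * \<bar>\<phi> x\<bar>)"
    by (auto split: split_indicator)
  ultimately show ?thesis by simp
qed

text \<open>Duality takes the place of an inversion formula. With C the L1 norm of U over 2 * pi,
  Parseval bounds the mean of \<bar>\<phi>\<bar> by C even over the set where \<bar>\<phi>\<bar>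
  exceeds C, so this set is null. It is cut to [-n, n] to have finite measure.\<close>

lemma bounded_of_integrable_Fourier:
  fixes \<phi> :: "real \<Rightarrow> real"
  assumes F: "Fourier_pair_real \<phi> U" and U: "integrable lborel U"
  shows "\<exists>C\<ge>0. AE x in lborel. \<bar>\<phi> x\<bar> \<le> C"
proof -
  define C where "C = (LINT \<xi>|lborel. cmod (U \<xi>)) / (2 * pi)"
  have C0: "C \<ge> 0" by (simp add: C_def)
  have \<phi>: "L2 \<phi>" using Fourier_pair_L2(1)[OF F] by simp
  have [measurable]: "\<phi> \<in> borel_measurable borel" using \<phi> by (auto simp: L2_def)
  define E where "E n = {x \<in> {- real n..real n}. \<bar>\<phi> x\<bar> > C}" for n
  have Em [measurable]: "E n \<in> sets borel" for n unfolding E_def by measurable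
  have Ef: "emeasure lborel (E n) < \<infinity>" for n
    by (rule le_less_trans[OF emeasure_mono[of _ "{- real n..real n}"]]) (auto simp: E_def)
  have ae: "AE x in lborel. x \<notin> E n" for n
  proof -
    obtain s where s: "integrable lborel s" "L2 s" "\<And>\<xi>. cmod (ft s \<xi>) \<le> measure lborel (E n)"
      "complex_of_real (LINT x|lborel. indicator (E n) x * \<bar>\<phi> x\<bar>) = L2_inner U (ft s) / (2 * pi)"
      by (rule set_dual_function[OF F Em Ef]) (rule that, assumption+)
    have I: "integrable lborel (\<lambda>x. indicator (E n) x * \<bar>\<phi> x\<bar>)"
      by (rule integrable_indicator_abs[OF \<phi> Em Ef])
    have iE: "integrable lborel (indicator (E n) :: real \<Rightarrow> real)" using Em Ef by (intro integrable_real_indicator) auto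
    have "cmod (L2_inner U (ft s)) \<le> (LINT \<xi>|lborel. cmod (U \<xi> * cnj (ft s \<xi>)))"
      unfolding L2_inner_def by (rule integral_norm_bound)
    also have "\<dots> \<le> (LINT \<xi>|lborel. cmod (U \<xi>) * measure lborel (E n))"
    proof (rule integral_mono)
      show "integrable lborel (\<lambda>\<xi>. cmod (U \<xi> * cnj (ft s \<xi>)))"
        by (intro integrable_norm integrable_L2_mult(2) Fourier_pair_L2(2)[OF F] Plancherel_L1_L2(1) s)
      show "cmod (U \<xi> * cnj (ft s \<xi>)) \<le> cmod (U \<xi>) * measure lborel (E n)" for \<xi>
        by (simp add: norm_mult mult_left_mono s(3))
    qed (use U in auto)
    also have "\<dots> = 2 * pi * C * measure lborel (E n)" by (simp add: C_def)
    finally have "cmod (L2_inner U (ft s)) / (2 * pi) \<le> C * measure lborel (E n)"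
      by (simp add: field_simps)
    moreover have "(LINT x|lborel. indicator (E n) x * \<bar>\<phi> x\<bar>) \<le> cmod (complex_of_real (LINT x|lborel. indicator (E n) x * \<bar>\<phi> x\<bar>))"
      by simp
    ultimately have "(LINT x|lborel. indicator (E n) x * \<bar>\<phi> x\<bar>) \<le> C * measure lborel (E n)"
      unfolding s(4) by (simp add: norm_divide)
    moreover have "(LINT x|lborel. indicator (E n) x * \<bar>\<phi> x\<bar> - C * indicator (E n) x) = (LINT x|lborel. indicator (E n) x * \<bar>\<phi> x\<bar>) - C * measure lborel (E n)"
      using I iE by (subst Bochner_Integration.integral_diff) auto
    moreover have nn: "indicator (E n) x * \<bar>\<phi> x\<bar> - C * indicator (E n) x \<ge> 0" for x
      by (auto simp: E_def split: split_indicator)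
    moreover have "(LINT x|lborel. indicator (E n) x * \<bar>\<phi> x\<bar> - C * indicator (E n) x) \<ge> 0"
      by (intro Bochner_Integration.integral_nonneg nn)
    ultimately have "(LINT x|lborel. indicator (E n) x * \<bar>\<phi> x\<bar> - C * indicator (E n) x) = 0" by linarith
    then have "AE x in lborel. indicator (E n) x * \<bar>\<phi> x\<bar> - C * indicator (E n) x = 0"
      using I iE nn by (subst (asm) integral_nonneg_eq_0_iff_AE) auto
    then show ?thesis by eventually_elim (auto simp: E_def)
  qed
  then have "AE x in lborel. \<forall>n. x \<notin> E n" by (simp add: AE_all_countable)
  then have "AE x in lborel. \<bar>\<phi> x\<bar> \<le> C"
  proof eventually_elim
    case (elim x)
    obtain N where N: "\<bar>x\<bar> \<le> real N" using real_arch_simple by blast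
    then have "x \<in> {- real N..real N}" by (auto simp: abs_le_iff)
    with elim show ?case by (force simp: E_def)
  qed
  with C0 show ?thesis by blast
qed

section \<open>Gaussian decay of the level sets of functions in H^(1/2)\<close>

lemma integral_log_weight:
  fixes M :: real
  assumes "M \<ge> 0"
  shows "integrable lborel (\<lambda>x. indicator {-M..M} x / (1 + \<bar>x\<bar>))"
    and "(LINT x|lborel. indicator {-M..M} x / (1 + \<bar>x\<bar>)) \<le> 2 * ln (1 + M)"
proof -
  have a: "has_bochner_integral lborel (\<lambda>x. 1 / (1 + \<bar>x\<bar>) * indicator {0..M} x) (ln (1 + M) - ln (1 + 0))"
    by (rule has_bochner_integral_FTC_Icc_nonneg[where F="\<lambda>x. ln (1 + x)" and f="\<lambda>x. 1 / (1 + \<bar>x\<bar>)" and a=0 and b=M])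
      (use assms in \<open>auto intro!: derivative_eq_intros simp: divide_simps\<close>)
  have b: "has_bochner_integral lborel (\<lambda>x. 1 / (1 + \<bar>x\<bar>) * indicator {-M..0} x) (- ln (1 - 0) - (- ln (1 - (- M))))"
    by (rule has_bochner_integral_FTC_Icc_nonneg[where F="\<lambda>x. - ln (1 - x)" and f="\<lambda>x. 1 / (1 + \<bar>x\<bar>)" and a="-M" and b=0])
      (use assms in \<open>auto intro!: derivative_eq_intros simp: divide_simps\<close>)
  let ?g = "\<lambda>x. 1 / (1 + \<bar>x\<bar>) * indicator {0..M} x + 1 / (1 + \<bar>x\<bar>) * indicator {-M..0} x"
  have c: "has_bochner_integral lborel ?g (2 * ln (1 + M))"
    using has_bochner_integral_add[OF a b] by simp
  have le: "indicator {-M..M} x / (1 + \<bar>x\<bar>) \<le> ?g x" for x :: real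
    by (auto split: split_indicator)
  show I: "integrable lborel (\<lambda>x. indicator {-M..M} x / (1 + \<bar>x\<bar>))"
  proof (rule Bochner_Integration.integrable_bound[OF integrable.intros[OF c]])
    show "AE x in lborel. norm (indicator {-M..M} x / (1 + \<bar>x\<bar>)) \<le> norm (?g x)"
      using le by (intro AE_I2) (auto split: split_indicator)
  qed measurable
  show "(LINT x|lborel. indicator {-M..M} x / (1 + \<bar>x\<bar>)) \<le> 2 * ln (1 + M)"
    using integral_mono[OF I integrable.intros[OF c] le] has_bochner_integral_integral_eq[OF c] by simp
qed

text \<open>The level set is tested against the solution; low frequencies cost only a logarithm of the cutoff,
  which is then taken Gaussian in the level.\<close>
lemma H_half_level_set:
  fixes \<phi> :: "real \<Rightarrow> real"
  assumes F: "Fourier_pair_real \<phi> U"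
    and W: "integrable lborel (\<lambda>\<xi>. (1 + \<bar>\<xi>\<bar>) * (cmod (U \<xi>))^2)"
  obtains a C where "a > 0" "C \<ge> 0"
    "\<And>t R. t \<ge> 1 \<Longrightarrow> measure lborel {x \<in> {-R..R}. \<bar>\<phi> x\<bar> > t} \<le> C * exp (- (a * t^2))"
proof -
  define K where "K = 1 + (LINT \<xi>|lborel. (1 + \<bar>\<xi>\<bar>) * (cmod (U \<xi>))^2)"
  have K: "K > 0" unfolding K_def by (intro add_pos_nonneg Bochner_Integration.integral_nonneg) auto
  \<comment> \<open>This value makes sqrt K * sqrt (2 * (a * t^2)) equal to pi * t, so the low
    frequencies contribute at most half of the lower bound 2 * pi * t * \<mu> and can be
    absorbed.\<close>
  define a where "a = pi^2 / (2 * K)"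
  have a: "a > 0" using K by (simp add: a_def)
  have \<phi>: "L2 \<phi>" using Fourier_pair_L2(1)[OF F] by simp
  have UL: "L2 U" by (rule Fourier_pair_L2(2)[OF F])
  have [measurable]: "\<phi> \<in> borel_measurable borel" "U \<in> borel_measurable borel" using \<phi> UL by (auto simp: L2_def)
  have main: "measure lborel {x \<in> {-R..R}. \<bar>\<phi> x\<bar> > t} \<le> 2 * K / pi * exp (- (a * t^2))" if t: "t \<ge> 1" for t R
  proof -
    define E where "E = {x \<in> {-R..R}. \<bar>\<phi> x\<bar> > t}"
    define \<mu> where "\<mu> = measure lborel E"
    have Em [measurable]: "E \<in> sets borel" unfolding E_def by measurable
    have Ef: "emeasure lborel E < \<infinity>"
      by (rule le_less_trans[OF emeasure_mono[of _ "{- R..R}"]]) (auto simp: E_def emeasure_lborel_Icc_eq)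
    obtain s where s: "integrable lborel s" "L2 s" "\<And>\<xi>. cmod (ft s \<xi>) \<le> \<mu>"
      "(L2_norm (ft s))^2 \<le> 2 * pi * \<mu>"
      "complex_of_real (LINT x|lborel. indicator E x * \<bar>\<phi> x\<bar>) = L2_inner U (ft s) / (2 * pi)"
      by (rule set_dual_function[OF F Em Ef, folded \<mu>_def]) (rule that)
    have sL: "L2 (ft s)" by (rule Plancherel_L1_L2(1)[OF s(1,2)])
    note [measurable] = L2_measurable[OF sL]
    have \<mu>0: "\<mu> \<ge> 0" by (simp add: \<mu>_def)
    \<comment> \<open>With this cutoff the logarithm ln (1 + M) is a * t^2, while above it the
      weight 1 + \<bar>\<xi>\<bar> is at least exp (a * t^2).\<close>
    define M where "M = exp (a * t^2) - 1"
    have M: "M \<ge> 0" "1 + M = exp (a * t^2)" using a by (auto simp: M_def)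
    \<comment> \<open>On low frequencies \<bar>U\<bar> is the product of \<bar>V\<bar>, which
      carries the root of the H^(1/2) weight, and \<bar>w\<bar>, which carries its reciprocal.
      Cauchy-Schwarz then meets the logarithmic integral of w^2.\<close>
    define V where "V \<xi> = complex_of_real (sqrt (1 + \<bar>\<xi>\<bar>)) * U \<xi>" for \<xi>
    define w where "w \<xi> = complex_of_real (indicator {-M..M} \<xi> / sqrt (1 + \<bar>\<xi>\<bar>))" for \<xi> :: real
    have [measurable]: "V \<in> borel_measurable borel" "w \<in> borel_measurable borel"
      unfolding V_def w_def by measurable
    have V2: "(cmod (V \<xi>))^2 = (1 + \<bar>\<xi>\<bar>) * (cmod (U \<xi>))^2" for \<xi>
      by (simp add: V_def norm_mult power_mult_distrib)
    have w2: "(cmod (w \<xi>))^2 = indicator {-M..M} \<xi> / (1 + \<bar>\<xi>\<bar>)" for \<xi>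
      unfolding w_def norm_of_real by (auto simp: power_divide split: split_indicator)
    have VL: "L2 V" unfolding L2_def V2 using W by simp
    have wL: "L2 w" unfolding L2_def w2 using integral_log_weight(1)[OF M(1)] by simp
    have Vn: "L2_norm V \<le> sqrt K"
      unfolding L2_norm_def V2 K_def by simp
    have wn: "L2_norm w \<le> sqrt (2 * (a * t^2))"
      unfolding L2_norm_def w2 using integral_log_weight(2)[OF M(1)] M(2) by simp
    define h where "h \<xi> = indicator (- {-M..M}) \<xi> * U \<xi>" for \<xi>
    have [measurable]: "h \<in> borel_measurable borel" unfolding h_def by measurable
    have hL: "L2 h" by (rule L2_bound[OF _ UL, of _ 1]) (auto simp: h_def split: split_indicator)
    have hn: "L2_norm h \<le> sqrt (K * exp (- (a * t^2)))"
    proof -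
      have "(cmod (h \<xi>))^2 \<le> (1 + \<bar>\<xi>\<bar>) * (cmod (U \<xi>))^2 * exp (- (a * t^2))" for \<xi>
      proof (cases "\<xi> \<in> {-M..M}")
        case False
        then have "exp (a * t^2) \<le> 1 + \<bar>\<xi>\<bar>" using M by auto
        then have "1 \<le> (1 + \<bar>\<xi>\<bar>) * exp (- (a * t^2))" by (simp add: exp_minus field_simps)
        from mult_right_mono[OF this, of "(cmod (U \<xi>))^2"] show ?thesis
          using False by (simp add: h_def mult_ac)
      qed (simp add: h_def)
      then have "(LINT \<xi>|lborel. (cmod (h \<xi>))^2) \<le> (LINT \<xi>|lborel. (1 + \<bar>\<xi>\<bar>) * (cmod (U \<xi>))^2 * exp (- (a * t^2)))"
        using hL W by (intro integral_mono) (auto simp: L2_def)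
      also have "\<dots> = (LINT \<xi>|lborel. (1 + \<bar>\<xi>\<bar>) * (cmod (U \<xi>))^2) * exp (- (a * t^2))" by simp
      also have "\<dots> \<le> K * exp (- (a * t^2))" by (intro mult_right_mono) (auto simp: K_def)
      finally show ?thesis by (simp add: L2_norm_def)
    qed
    have I1: "integrable lborel (\<lambda>\<xi>. cmod (V \<xi>) * cmod (w \<xi>))" by (rule integrable_L2_mult(1)[OF VL wL])
    have I2: "integrable lborel (\<lambda>\<xi>. cmod (h \<xi>) * cmod (ft s \<xi>))" by (rule integrable_L2_mult(1)[OF hL sL])
    have "cmod (L2_inner U (ft s)) \<le> (LINT \<xi>|lborel. cmod (U \<xi> * cnj (ft s \<xi>)))"
      unfolding L2_inner_def by (rule integral_norm_bound)
    also have "\<dots> \<le> (LINT \<xi>|lborel. \<mu> * (cmod (V \<xi>) * cmod (w \<xi>)) + cmod (h \<xi>) * cmod (ft s \<xi>))"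
    proof (rule integral_mono)
      show "cmod (U \<xi> * cnj (ft s \<xi>)) \<le> \<mu> * (cmod (V \<xi>) * cmod (w \<xi>)) + cmod (h \<xi>) * cmod (ft s \<xi>)" for \<xi>
      proof (cases "\<xi> \<in> {-M..M}")
        case True
        have "cmod (V \<xi>) * cmod (w \<xi>) = cmod (U \<xi>)"
          using True unfolding V_def w_def norm_mult norm_of_real by simp
        then show ?thesis using True mult_left_mono[OF s(3)[of \<xi>], of "cmod (U \<xi>)"]
          by (simp add: h_def norm_mult mult.commute)
      qed (simp add: h_def w_def norm_mult)
    qed (use I1 I2 in \<open>auto intro!: integrable_norm integrable_L2_mult(2) UL sL\<close>)
    also have "\<dots> = \<mu> * (LINT \<xi>|lborel. cmod (V \<xi>) * cmod (w \<xi>)) + (LINT \<xi>|lborel. cmod (h \<xi>) * cmod (ft s \<xi>))"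
      using I1 I2 by simp
    also have "\<dots> \<le> \<mu> * (sqrt K * sqrt (2 * (a * t^2))) + sqrt (K * exp (- (a * t^2))) * sqrt (2 * pi * \<mu>)"
    proof (intro add_mono mult_left_mono \<mu>0)
      show "(LINT \<xi>|lborel. cmod (V \<xi>) * cmod (w \<xi>)) \<le> sqrt K * sqrt (2 * (a * t^2))"
        by (intro order_trans[OF L2_Cauchy_Schwarz[OF VL wL] mult_mono[OF Vn wn]]) (use K in auto)
      have "L2_norm (ft s) \<le> sqrt (2 * pi * \<mu>)" using s(4) by (simp add: real_le_rsqrt)
      then show "(LINT \<xi>|lborel. cmod (h \<xi>) * cmod (ft s \<xi>)) \<le> sqrt (K * exp (- (a * t^2))) * sqrt (2 * pi * \<mu>)"
        by (intro order_trans[OF L2_Cauchy_Schwarz[OF hL sL] mult_mono[OF hn]])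
          (use K in \<open>auto intro!: mult_nonneg_nonneg\<close>)
    qed
    also have "sqrt K * sqrt (2 * (a * t^2)) = pi * t"
    proof -
      have "sqrt K * sqrt (2 * (a * t^2)) = sqrt ((pi * t)^2)"
        unfolding real_sqrt_mult[symmetric] using K by (simp add: a_def power_mult_distrib)
      then show ?thesis using t by simp
    qed
    finally have up: "cmod (L2_inner U (ft s)) \<le> \<mu> * (pi * t) + sqrt (K * exp (- (a * t^2))) * sqrt (2 * pi * \<mu>)" .
    have "t * \<mu> = (LINT x|lborel. t * indicator E x)" by (simp add: \<mu>_def)
    also have "\<dots> \<le> (LINT x|lborel. indicator E x * \<bar>\<phi> x\<bar>)"
      using Ef by (intro integral_mono integrable_indicator_abs[OF \<phi> Em Ef] integrable_mult_right integrable_real_indicator)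
        (auto simp: E_def split: split_indicator)
    also have "\<dots> \<le> cmod (complex_of_real (LINT x|lborel. indicator E x * \<bar>\<phi> x\<bar>))" by simp
    also have "\<dots> = cmod (L2_inner U (ft s)) / (2 * pi)" unfolding s(5) by (simp add: norm_divide)
    finally have "t * \<mu> * (2 * pi) \<le> cmod (L2_inner U (ft s))" by (simp add: field_simps)
    \<comment> \<open>Half of the left-hand side absorbs the low-frequency term pi * t *
      \<mu>.\<close>
    with up have "pi * t * \<mu> \<le> sqrt (K * exp (- (a * t^2))) * sqrt (2 * pi * \<mu>)" by (simp add: algebra_simps)
    moreover have "pi * 1 * \<mu> \<le> pi * t * \<mu>" using t \<mu>0 by (intro mult_right_mono mult_left_mono) auto
    ultimately have "pi * \<mu> \<le> sqrt (K * exp (- (a * t^2))) * sqrt (2 * pi * \<mu>)" by linarith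
    then have "pi * \<mu> \<le> sqrt (K * exp (- (a * t^2)) * (2 * pi * \<mu>))" by (simp only: real_sqrt_mult)
    \<comment> \<open>On the right \<mu> sits under the root; squaring and cancelling one factor
      \<mu> yields a bound linear in exp (- (a * t^2)).\<close>
    from power_mono[OF this, of 2] have "(pi * \<mu>)^2 \<le> K * exp (- (a * t^2)) * (2 * pi * \<mu>)"
      using \<mu>0 K by simp
    then have "\<mu> * (pi * \<mu>) \<le> \<mu> * (2 * K * exp (- (a * t^2)))"
      by (simp add: power2_eq_square algebra_simps)
    then have "pi * \<mu> \<le> 2 * K * exp (- (a * t^2))"
      using \<mu>0 K by (cases "\<mu> = 0") auto
    then have "\<mu> \<le> 2 * K / pi * exp (- (a * t^2))" by (simp add: field_simps)
    then show ?thesis by (simp add: \<mu>_def E_def)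
  qed
  show thesis by (rule that[OF a _ main]) (use K in auto)
qed

text \<open>Unit layers in the level: where k + 1 < \<bar>\<phi>\<bar> \<le> k + 2 the power is at
  most (k + 2) powr q, and the Gaussian decay of the level sets outweighs this growth. Where
  \<bar>\<phi>\<bar> \<le> 1, the assumption q \<ge> 2 compares the power with \<phi>^2.\<close>

lemma H_half_Lq:
  fixes \<phi> :: "real \<Rightarrow> real"
  assumes F: "Fourier_pair_real \<phi> U"
    and W: "integrable lborel (\<lambda>\<xi>. (1 + \<bar>\<xi>\<bar>) * (cmod (U \<xi>))^2)" and q: "q \<ge> 2"
  shows "integrable lborel (\<lambda>x. \<bar>\<phi> x\<bar> powr q)"
proof -
  obtain a C where aC: "a > 0" "C \<ge> 0"
    "\<And>t R. t \<ge> 1 \<Longrightarrow> measure lborel {x \<in> {-R..R}. \<bar>\<phi> x\<bar> > t} \<le> C * exp (- (a * t^2))"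
    by (rule H_half_level_set[OF F W]) (rule that)
  have \<phi>: "L2 \<phi>" using Fourier_pair_L2(1)[OF F] by simp
  have [measurable]: "\<phi> \<in> borel_measurable borel" using \<phi> by (auto simp: L2_def)
  define A where "A k = {x. \<bar>\<phi> x\<bar> > real (Suc k)}" for k
  have [measurable]: "A k \<in> sets borel" for k unfolding A_def by measurable
  have Ak: "emeasure lborel (A k) \<le> ennreal (C * exp (- (a * (real (Suc k))^2)))" for k
  proof -
    define B where "B n = {x \<in> {- real n..real n}. \<bar>\<phi> x\<bar> > real (Suc k)}" for n
    have [measurable]: "B n \<in> sets borel" for n unfolding B_def by measurable
    have AB: "A k = (\<Union>n. B n)"
    proof (intro equalityI subsetI)
      fix x assume "x \<in> A k"
      moreover obtain N where "\<bar>x\<bar> \<le> real N" using real_arch_simple by blast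
      ultimately show "x \<in> (\<Union>n. B n)" by (auto simp: A_def B_def abs_le_iff intro!: exI[of _ N])
    qed (auto simp: A_def B_def)
    \<comment> \<open>The level-set bound does not depend on the window [-n, n], so continuity from
      below carries it over to the whole line.\<close>
    have sup: "(SUP n. emeasure lborel (B n)) = emeasure lborel (\<Union>n. B n)"
      by (rule SUP_emeasure_incseq) (auto simp: incseq_def B_def)
    have "emeasure lborel (B n) \<le> ennreal (C * exp (- (a * (real (Suc k))^2)))" for n
    proof -
      have "emeasure lborel (B n) < \<infinity>"
        by (rule le_less_trans[OF emeasure_mono[of _ "{- real n..real n}"]]) (auto simp: B_def)
      then have "emeasure lborel (B n) = ennreal (measure lborel (B n))"
        by (simp add: emeasure_eq_ennreal_measure)
      then show ?thesis using aC(3)[of "real (Suc k)" "real n"] by (simp add: B_def ennreal_leI)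
    qed
    then show ?thesis unfolding AB sup[symmetric] by (rule SUP_least)
  qed
  have "summable (\<lambda>k. (real (Suc k) + 1) powr q * exp (- (a * (real (Suc k))^2)))"
  proof (rule summable_comparison_test_bigo)
    show "summable (\<lambda>k. norm (1 / (real k)^2))" using inverse_power_summable[of 2] by (simp add: field_simps)
    show "(\<lambda>k. (real (Suc k) + 1) powr q * exp (- (a * (real (Suc k))^2))) \<in> O(\<lambda>k. 1 / (real k)^2)"
      using aC(1) by real_asymp
  qed
  from summable_mult[OF this, of C]
  have summ: "summable (\<lambda>k. (real (Suc k) + 1) powr q * (C * exp (- (a * (real (Suc k))^2))))"
    by (simp only: mult.left_commute)
  have ptw: "ennreal (\<bar>\<phi> x\<bar> powr q) \<le> ennreal ((\<phi> x)^2) + (\<Sum>k. ennreal ((real (Suc k) + 1) powr q) * indicator (A k) x)" for x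
  proof (cases "\<bar>\<phi> x\<bar> \<le> 1")
    case True
    have "\<bar>\<phi> x\<bar> powr q \<le> \<bar>\<phi> x\<bar> powr 2" by (rule powr_mono') (use True q in auto)
    also have "\<dots> = (\<phi> x)^2" by simp
    finally have "ennreal (\<bar>\<phi> x\<bar> powr q) \<le> ennreal ((\<phi> x)^2)" by (rule ennreal_leI)
    then show ?thesis by (rule order_trans) simp
  next
    case False
    \<comment> \<open>The layer with k + 1 < \<bar>\<phi> x\<bar> \<le> k + 2: the ceiling of
      \<bar>\<phi> x\<bar> is k + 2, and it is at least 2 here.\<close>
    define k where "k = nat (\<lceil>\<bar>\<phi> x\<bar>\<rceil> - 2)"
    have ge: "\<lceil>\<bar>\<phi> x\<bar>\<rceil> \<ge> 2" using False by linarith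
    then have "int k + 2 = \<lceil>\<bar>\<phi> x\<bar>\<rceil>" by (simp add: k_def)
    then have k: "real (Suc k) + 1 = real_of_int \<lceil>\<bar>\<phi> x\<bar>\<rceil>"
      by (simp flip: \<open>int k + 2 = _\<close>)
    have "x \<in> A k" unfolding A_def using k by (simp add: ceiling_less_iff) linarith
    have "\<bar>\<phi> x\<bar> powr q \<le> (real (Suc k) + 1) powr q" using q unfolding k by (intro powr_mono2) auto
    then have "ennreal (\<bar>\<phi> x\<bar> powr q) \<le> ennreal ((real (Suc k) + 1) powr q) * indicator (A k) x"
      using \<open>x \<in> A k\<close> by (simp add: ennreal_leI)
    also have "\<dots> \<le> (\<Sum>k. ennreal ((real (Suc k) + 1) powr q) * indicator (A k) x)"
    proof -
      have "b k \<le> (\<Sum>i. b i)" for b :: "nat \<Rightarrow> ennreal"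
        using sum_le_suminf[of b "{k}"] by simp
      from this[of "\<lambda>i. ennreal ((real (Suc i) + 1) powr q) * indicator (A i) x"] show ?thesis .
    qed
    finally show ?thesis by (rule order_trans) simp
  qed
  have "(\<integral>\<^sup>+x. ennreal (\<bar>\<phi> x\<bar> powr q) \<partial>lborel)
     \<le> (\<integral>\<^sup>+x. ennreal ((\<phi> x)^2) + (\<Sum>k. ennreal ((real (Suc k) + 1) powr q) * indicator (A k) x) \<partial>lborel)"
    by (intro nn_integral_mono ptw)
  also have "\<dots> = (\<integral>\<^sup>+x. ennreal ((\<phi> x)^2) \<partial>lborel) + (\<Sum>k. ennreal ((real (Suc k) + 1) powr q) * emeasure lborel (A k))"
    by (simp add: nn_integral_add nn_integral_suminf nn_integral_cmult_indicator)
  also have "\<dots> \<le> (\<integral>\<^sup>+x. ennreal ((\<phi> x)^2) \<partial>lborel) + (\<Sum>k. ennreal ((real (Suc k) + 1) powr q * (C * exp (- (a * (real (Suc k))^2)))))"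
    by (intro add_left_mono suminf_le) (auto simp only: ennreal_mult' powr_ge_zero summableI zero_le intro!: mult_left_mono Ak)
  also have "\<dots> < \<infinity>"
  proof -
    have "(\<integral>\<^sup>+x. ennreal ((\<phi> x)^2) \<partial>lborel) < \<infinity>"
      using \<phi> unfolding L2_def by (simp add: integrable_iff_bounded)
    moreover have "(\<Sum>k. ennreal ((real (Suc k) + 1) powr q * (C * exp (- (a * (real (Suc k))^2))))) < \<infinity>"
      using summ aC(2) by (subst suminf_ennreal2) auto
    ultimately show ?thesis by simp
  qed
  finally show ?thesis by (intro integrableI_nonneg) auto
qed

section \<open>Test functions\<close>

text \<open>Allowing a polynomial factor in 1 / x makes this family of functions, flat at 0, closed
  under differentiation; smoothness then needs only one derivative to be computed.\<close>

definition bump_exp :: "real poly \<Rightarrow> real \<Rightarrow> real" where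
  "bump_exp P x = (if x > 0 then poly P (1 / x) * exp (- (1 / x)) else 0)"

lemma poly_mult_exp_tendsto_0: "((\<lambda>t. poly P t * exp (- t)) \<longlongrightarrow> (0::real)) at_top"
proof -
  have "((\<lambda>t. \<Sum>i\<le>degree P. coeff P i * (t ^ i / exp t)) \<longlongrightarrow> (\<Sum>i\<le>degree P. coeff P i * 0)) at_top"
    by (intro tendsto_sum tendsto_mult tendsto_const tendsto_power_div_exp_0)
  then show ?thesis by (simp add: poly_altdef sum_distrib_right exp_minus divide_inverse mult.assoc)
qed

lemma bump_exp_tendsto_0: "(bump_exp P \<longlongrightarrow> 0) (at 0)"
proof -
  have "((\<lambda>x. poly P (1 / x) * exp (- (1 / x))) \<longlongrightarrow> 0) (at_right 0)"
    by (rule filterlim_compose[OF poly_mult_exp_tendsto_0])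
      (simp add: filterlim_inverse_at_top_right divide_inverse)
  moreover have "\<forall>\<^sub>F x in at_right 0. poly P (1 / x) * exp (- (1 / x)) = bump_exp P x"
    by (auto simp: eventually_at_right_less bump_exp_def eventually_at_filter)
  ultimately have r: "(bump_exp P \<longlongrightarrow> 0) (at_right 0)"
    by (rule Lim_transform_eventually)
  have "\<forall>\<^sub>F x in at_left 0. bump_exp P x = 0"
    by (auto simp: bump_exp_def eventually_at_filter)
  then have l: "(bump_exp P \<longlongrightarrow> 0) (at_left 0)" by (rule tendsto_eventually)
  from l r show ?thesis by (simp add: filterlim_at_split)
qed

text \<open>With t = 1 / x, differentiating P(t) exp(-t) in x gives t^2 (P - P')(t) exp(-t).\<close>

definition bump_deriv :: "real poly \<Rightarrow> real poly" where
  "bump_deriv P = [:0, 0, 1:] * (P - pderiv P)"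

lemma DERIV_bump_exp: "(bump_exp P has_real_derivative bump_exp (bump_deriv P) x) (at x)"
proof -
  consider "x > 0" | "x < 0" | "x = 0" by linarith
  then show ?thesis
  proof cases
    case 1
    have "((\<lambda>x. poly P (1 / x) * exp (- (1 / x))) has_real_derivative bump_exp (bump_deriv P) x) (at x)"
      using 1 by (auto intro!: derivative_eq_intros DERIV_chain'[OF _ poly_DERIV]
          simp: bump_exp_def bump_deriv_def power2_eq_square field_simps)
    then show ?thesis
      by (rule has_field_derivative_transform_within_open[where S="{0<..}"]) (use 1 in \<open>auto simp: bump_exp_def\<close>)
  next
    case 2
    have "((\<lambda>x. 0) has_real_derivative bump_exp (bump_deriv P) x) (at x)"
      using 2 by (simp add: bump_exp_def)
    then show ?thesis
      by (rule has_field_derivative_transform_within_open[where S="{..<0}"]) (use 2 in \<open>auto simp: bump_exp_def\<close>)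
  next
    case 3
    \<comment> \<open>At 0 the difference quotient is again a member of the family: division by h
      multiplies the polynomial by t = 1 / h.\<close>
    have "\<forall>\<^sub>F h in at 0. bump_exp (pCons 0 P) h = (bump_exp P (0 + h) - bump_exp P 0) / h"
      by (auto simp: bump_exp_def eventually_at_filter)
    from Lim_transform_eventually[OF bump_exp_tendsto_0 this] show ?thesis
      using 3 by (simp add: DERIV_def bump_exp_def)
  qed
qed

inductive bump_span :: "real \<Rightarrow> real \<Rightarrow> (real \<Rightarrow> real) \<Rightarrow> bool" for n y where
  base: "bump_span n y (\<lambda>x. a * (bump_exp P (1 + n * (x - y)) * bump_exp Q (1 - n * (x - y))))"
| add: "bump_span n y f \<Longrightarrow> bump_span n y g \<Longrightarrow> bump_span n y (\<lambda>x. f x + g x)"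

lemma bump_span_DERIV:
  "bump_span n y f \<Longrightarrow> \<exists>g. bump_span n y g \<and> (\<forall>x. (f has_real_derivative g x) (at x))"
proof (induction rule: bump_span.induct)
  case (base a P Q)
  let ?g = "\<lambda>x. (a * n) * (bump_exp (bump_deriv P) (1 + n * (x - y)) * bump_exp Q (1 - n * (x - y)))
      + (- a * n) * (bump_exp P (1 + n * (x - y)) * bump_exp (bump_deriv Q) (1 - n * (x - y)))"
  have "bump_span n y ?g" by (intro bump_span.intros)
  moreover have "((\<lambda>x. a * (bump_exp P (1 + n * (x - y)) * bump_exp Q (1 - n * (x - y)))) has_real_derivative ?g x) (at x)" for x
    by (auto intro!: derivative_eq_intros DERIV_chain'[OF _ DERIV_bump_exp] simp: algebra_simps)
  ultimately show ?case by blast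
next
  case (add f g)
  then obtain f' g' where "bump_span n y f'" "\<forall>x. (f has_real_derivative f' x) (at x)"
    "bump_span n y g'" "\<forall>x. (g has_real_derivative g' x) (at x)" by blast
  then show ?case
    by (intro exI[of _ "\<lambda>x. f' x + g' x"]) (auto intro: bump_span.intros DERIV_add)
qed

lemma bump_span_support: "bump_span n y f \<Longrightarrow> n > 0 \<Longrightarrow> \<bar>x\<bar> > \<bar>y\<bar> + 1 / n \<Longrightarrow> f x = 0"
proof (induction rule: bump_span.induct)
  case (base a P Q)
  then have "1 < n * \<bar>x\<bar> - n * \<bar>y\<bar>" by (simp add: field_simps)
  also have "\<dots> \<le> n * \<bar>x - y\<bar>" using base(1) by (simp flip: right_diff_distrib)
  also have "\<dots> = \<bar>n * (x - y)\<bar>" using base(1) by (simp add: abs_mult)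
  finally have "1 + n * (x - y) \<le> 0 \<or> 1 - n * (x - y) \<le> 0" by linarith
  then show ?case by (auto simp: bump_exp_def)
qed simp

lemma bump_span_test_fun:
  assumes "bump_span n y f" "n > 0" shows "test_fun f"
proof -
  have d: "bump_span n y (deriv f)" "f differentiable (at x)" if "bump_span n y f" for f x
  proof -
    obtain g where g: "bump_span n y g" "\<And>x. (f has_real_derivative g x) (at x)"
      using bump_span_DERIV[OF \<open>bump_span n y f\<close>] by blast
    then have "deriv f = g" by (intro ext DERIV_imp_deriv)
    with g show "bump_span n y (deriv f)" "f differentiable (at x)"
      by (auto simp: real_differentiable_def)
  qed
  have "bump_span n y ((deriv ^^ k) f)" for k
    by (induction k) (auto simp: assms(1) intro: d)
  with d(2) bump_span_support[OF assms] show ?thesis unfolding test_fun_def by blast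
qed

definition bump :: "real \<Rightarrow> real" where
  "bump x = bump_exp 1 (1 + x) * bump_exp 1 (1 - x)"

lemma bump_pos: "\<bar>x\<bar> < 1 \<Longrightarrow> bump x > 0"
  by (simp add: bump_def bump_exp_def)

lemma bump_eq_0: "\<bar>x\<bar> \<ge> 1 \<Longrightarrow> bump x = 0"
  by (auto simp: bump_def bump_exp_def)

lemma test_fun_bump: "n > 0 \<Longrightarrow> test_fun (\<lambda>x. bump (n * (x - y)))"
  using bump_span_test_fun[OF bump_span.base[of n y 1 1 1]] by (simp add: bump_def)

lemma test_fun_DERIV: "test_fun \<psi> \<Longrightarrow> (\<psi> has_real_derivative deriv \<psi> x) (at x)"
  unfolding test_fun_def DERIV_deriv_iff_real_differentiable by (metis funpow_0)

lemma test_fun_deriv: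
  assumes "test_fun \<psi>" shows "test_fun (deriv \<psi>)"
proof -
  obtain R where R: "\<And>x. \<bar>x\<bar> > R \<Longrightarrow> \<psi> x = 0" using assms by (auto simp: test_fun_def)
  have "deriv \<psi> x = 0" if "\<bar>x\<bar> > R" for x
  proof (rule DERIV_imp_deriv)
    have o: "open {x::real. \<bar>x\<bar> > R}" by (intro open_Collect_less continuous_intros)
    show "(\<psi> has_real_derivative 0) (at x)"
      by (rule has_field_derivative_transform_within_open[of "\<lambda>x. 0" 0 x "{x. \<bar>x\<bar> > R}"])
        (use that R o in auto)
  qed
  moreover have "((deriv ^^ k) (deriv \<psi>)) differentiable (at x)" for k x
  proof -
    have "(deriv ^^ k) (deriv \<psi>) = (deriv ^^ Suc k) \<psi>" by (simp add: funpow_swap1)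
    moreover have "((deriv ^^ Suc k) \<psi>) differentiable (at x)" using assms unfolding test_fun_def by blast
    ultimately show ?thesis by simp
  qed
  ultimately show ?thesis unfolding test_fun_def by (intro conjI exI[of _ R]) auto
qed

section \<open>Fourier transforms of test functions\<close>

lemma integrable_compact_support:
  fixes f :: "real \<Rightarrow> 'a::{banach, second_countable_topology}"
  assumes "continuous_on UNIV f" "\<And>x. \<bar>x\<bar> > R \<Longrightarrow> f x = 0"
  shows "integrable lborel f"
proof -
  have "integrable lborel (\<lambda>x. indicator {-R..R} x *\<^sub>R f x)"
    by (rule borel_integrable_compact) (auto intro: continuous_on_subset[OF assms(1)])
  moreover have "(\<lambda>x. indicator {-R..R} x *\<^sub>R f x) = f"
    using assms(2) by (force split: split_indicator simp: abs_less_iff not_le)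
  ultimately show ?thesis by simp
qed

lemma test_fun_continuous: "test_fun \<psi> \<Longrightarrow> continuous_on UNIV \<psi>"
  by (intro continuous_at_imp_continuous_on ballI DERIV_isCont[OF test_fun_DERIV])

lemma test_fun_integrable:
  assumes "test_fun \<psi>" shows "integrable lborel (\<lambda>x. complex_of_real (\<psi> x))" "L2 \<psi>"
proof -
  obtain R where R: "\<And>x. \<bar>x\<bar> > R \<Longrightarrow> \<psi> x = 0" using assms by (auto simp: test_fun_def)
  note c = test_fun_continuous[OF assms]
  show "integrable lborel (\<lambda>x. complex_of_real (\<psi> x))"
    by (rule integrable_compact_support[of _ R]) (use c R in \<open>auto intro!: continuous_intros\<close>)
  have "integrable lborel (\<lambda>x. (norm (\<psi> x))^2)"
    by (rule integrable_compact_support[of _ R]) (use c R in \<open>auto intro!: continuous_intros\<close>)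
  then show "L2 \<psi>" using borel_measurable_continuous_onI[OF c] by (simp add: L2_def)
qed

lemma ft_deriv:
  assumes "test_fun \<psi>"
  shows "ft_real (deriv \<psi>) \<xi> = \<i> * \<xi> * ft_real \<psi> \<xi>"
proof -
  obtain R where R: "\<And>x. \<bar>x\<bar> > R \<Longrightarrow> \<psi> x = 0" using assms by (auto simp: test_fun_def)
  note t' = test_fun_deriv[OF assms]
  obtain R' where R': "\<And>x. \<bar>x\<bar> > R' \<Longrightarrow> deriv \<psi> x = 0" using t' by (auto simp: test_fun_def)
  define S where "S = \<bar>R\<bar> + \<bar>R'\<bar> + 1"
  have S: "S > R" "S > R'" "S > 0" by (auto simp: S_def)
  let ?G = "\<lambda>x. complex_of_real (\<psi> x) * cis (- (x * \<xi>))"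
  let ?g = "\<lambda>x. complex_of_real (deriv \<psi> x) * cis (- (x * \<xi>)) - \<i> * \<xi> * (complex_of_real (\<psi> x) * cis (- (x * \<xi>)))"
  have D: "(?G has_vector_derivative ?g x) (at x within A)" for x A
  proof -
    have "((\<lambda>x. complex_of_real (\<psi> x)) has_vector_derivative complex_of_real (deriv \<psi> x)) (at x within A)"
      using test_fun_DERIV[OF assms, of x]
      by (intro has_vector_derivative_of_real) (auto intro: has_vector_derivative_at_within simp: has_real_derivative_iff_has_vector_derivative)
    moreover have "((\<lambda>x. cis (- (x * \<xi>))) has_vector_derivative (- \<xi>) *\<^sub>R (\<i> * cis (- (x * \<xi>)))) (at x within A)"
    proof -
      have "((\<lambda>z. exp (- (\<i> * \<xi> * z))) has_field_derivative - (\<i> * \<xi>) * exp (- (\<i> * \<xi> * complex_of_real x))) (at (complex_of_real x))"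
        by (auto intro!: derivative_eq_intros)
      from has_vector_derivative_real_field[OF this, of A] show ?thesis
        by (simp add: cis_conv_exp scaleR_conv_of_real mult_ac)
    qed
    ultimately have "(?G has_vector_derivative (complex_of_real (\<psi> x) * ((- \<xi>) *\<^sub>R (\<i> * cis (- (x * \<xi>)))) + complex_of_real (deriv \<psi> x) * cis (- (x * \<xi>)))) (at x within A)"
      by (rule has_vector_derivative_mult)
    then show ?thesis by (simp add: scaleR_conv_of_real algebra_simps)
  qed
  have cont: "continuous_on {-S..S} ?g"
    using test_fun_continuous[OF assms] test_fun_continuous[OF t']
    by (intro continuous_intros) (auto intro: continuous_on_subset)
  have "(LINT x|lborel. indicator {-S..S} x *\<^sub>R ?g x) = ?G S - ?G (- S)"
    by (rule integral_FTC_Icc[OF _ D cont]) (use S in auto)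
  also have "\<dots> = 0" using R[of S] R[of "- S"] S by simp
  also have "(\<lambda>x. indicator {-S..S} x *\<^sub>R ?g x) = ?g"
  proof
    fix x show "indicator {-S..S} x *\<^sub>R ?g x = ?g x"
    proof (cases "x \<in> {-S..S}")
      case False
      then have "\<bar>x\<bar> > R" "\<bar>x\<bar> > R'" using S by auto
      then show ?thesis using R R' by simp
    qed simp
  qed
  also have "(LINT x|lborel. ?g x) = ft_real (deriv \<psi>) \<xi> - \<i> * \<xi> * ft_real \<psi> \<xi>"
    unfolding ft_def using integrable_mult_cis[OF test_fun_integrable(1)[OF assms]] integrable_mult_cis[OF test_fun_integrable(1)[OF t']]
    by (subst Bochner_Integration.integral_diff) auto
  finally show ?thesis by simp
qed

lemma pairing_test_fun:
  assumes "Fourier_pair_real u U" "test_fun \<psi>"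
  shows "complex_of_real (LINT x|lborel. u x * \<psi> x) = L2_inner U (ft_real \<psi>) / (2 * pi)"
proof -
  note T = test_fun_integrable[OF assms(2)]
  have "L2_inner U (ft_real \<psi>) = 2 * pi * L2_inner (\<lambda>x. complex_of_real (u x)) (\<lambda>x. complex_of_real (\<psi> x))"
    using T by (intro Parseval assms Fourier_pair_ft) auto
  also have "L2_inner (\<lambda>x. complex_of_real (u x)) (\<lambda>x. complex_of_real (\<psi> x)) = complex_of_real (LINT x|lborel. u x * \<psi> x)"
    unfolding L2_inner_def by (simp flip: integral_complex_of_real)
  finally show ?thesis by (simp add: field_simps)
qed

text \<open>If n \<ge> \<bar>\<xi>\<bar>, then \<bar>x * \<xi>\<bar> \<le> 1 < pi / 2 on the support
  of the bump, so the real part of the transform integrates a nonnegative, nontrivial function.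
  Countably many bumps serve all \<xi>, which lets the exceptional null sets in
  \<open>weak_equation_Fourier\<close> be united.\<close>

lemma ft_bump_nonzero: "\<exists>k. ft_real (\<lambda>x. bump (real (Suc k) * x)) \<xi> \<noteq> 0"
proof -
  obtain k where k: "\<bar>\<xi>\<bar> \<le> real k" using real_arch_simple by blast
  define n where "n = real (Suc k)"
  have n: "n > 0" "\<bar>\<xi>\<bar> \<le> n" using k by (auto simp: n_def)
  have T: "test_fun (\<lambda>x. bump (n * x))" using test_fun_bump[OF n(1), of 0] by simp
  let ?k = "\<lambda>x. bump (n * x) * cos (x * \<xi>)"
  have nn: "?k x \<ge> 0" and pos: "\<bar>x\<bar> < 1 / n \<Longrightarrow> ?k x > 0" for x
  proof -
    have c: "cos (x * \<xi>) > 0" if "\<bar>x\<bar> < 1 / n"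
    proof (rule cos_gt_zero_pi)
      have "\<bar>x * \<xi>\<bar> \<le> 1 / n * n" unfolding abs_mult using that n by (intro mult_mono) auto
      then have "\<bar>x * \<xi>\<bar> \<le> 1" using n by simp
      then show "- (pi / 2) < x * \<xi>" "x * \<xi> < pi / 2" using pi_gt3 by auto
    qed
    have e: "\<bar>x\<bar> < 1 / n \<longleftrightarrow> \<bar>n * x\<bar> < 1" using n by (simp add: abs_mult field_simps)
    show "?k x > 0" if "\<bar>x\<bar> < 1 / n" using c[OF that] bump_pos that e by simp
    then show "?k x \<ge> 0" using bump_eq_0[of "n * x"] e by (cases "\<bar>x\<bar> < 1 / n") (auto simp: not_less)
  qed
  have I: "integrable lborel (\<lambda>x. complex_of_real (bump (n * x)) * cis (- (x * \<xi>)))"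
    by (rule integrable_mult_cis[OF test_fun_integrable(1)[OF T]]) simp
  have Re: "Re (ft_real (\<lambda>x. bump (n * x)) \<xi>) = (LINT x|lborel. ?k x)"
    unfolding ft_def integral_Re[OF I, symmetric] by simp
  have Ik: "integrable lborel ?k" using integrable_Re[OF I] by simp
  have "(LINT x|lborel. ?k x) \<noteq> 0"
  proof
    assume "(LINT x|lborel. ?k x) = 0"
    then have "AE x in lborel. ?k x = 0" using Ik nn by (subst (asm) integral_nonneg_eq_0_iff_AE) auto
    then have "AE x in lborel. x \<notin> {- (1/n)<..<1/n}"
    proof eventually_elim
      case (elim x)
      show ?case
      proof
        assume "x \<in> {- (1/n)<..<1/n}"
        then have "\<bar>x\<bar> < 1 / n" by auto
        from pos[OF this] elim show False by simp
      qed
    qed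
    then have "emeasure lborel {- (1/n)<..<1/n} = 0"
      by (subst (asm) AE_iff_measurable[of "{- (1/n)<..<1/n}"]) auto
    then show False using n by (simp add: emeasure_lborel_Ioo field_simps)
  qed
  with Re show ?thesis unfolding n_def by (metis zero_complex.sel(1))
qed

lemma ft_test_fun_bounded:
  assumes "test_fun \<psi>"
  shows "\<exists>C. \<forall>\<xi>. cmod (ft_real \<psi> \<xi>) \<le> C"
  using ft_bound[OF test_fun_integrable(1)[OF assms]]
  by (intro exI[of _ "LINT x|lborel. cmod (complex_of_real (\<psi> x))"]) simp

text \<open>Testing with all translates of a bump shows that the residual of the equation, multiplied by the
  transform of that bump, has vanishing Fourier transform.\<close>
lemma weak_equation_Fourier:
  assumes \<phi>: "Fourier_pair_real \<phi> U"
    and h: "Fourier_pair_real h (\<lambda>\<xi>. - \<i> * complex_of_real (sgn \<xi>) * U \<xi>)"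
    and w: "Fourier_pair_real w (\<lambda>\<xi>. U \<xi> / (\<i> * complex_of_real \<xi>))"
    and g: "Fourier_pair_real g N"
    and weak: "\<And>\<psi>. test_fun \<psi> \<Longrightarrow> \<beta> * (LINT x|lborel. h x * deriv (deriv \<psi>) x)
          + c * (LINT x|lborel. \<phi> x * deriv \<psi> x) - (LINT x|lborel. g x * deriv \<psi> x)
          = \<gamma> * (LINT x|lborel. w x * \<psi> x)"
  shows "AE \<xi> in lborel. N \<xi> = complex_of_real (c - \<beta> * \<bar>\<xi>\<bar> - \<gamma> / \<xi>^2) * U \<xi>"
proof -
  define H where "H \<xi> = - \<i> * complex_of_real (sgn \<xi>) * U \<xi>" for \<xi>
  define W where "W \<xi> = U \<xi> / (\<i> * complex_of_real \<xi>)" for \<xi>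
  define Q where "Q \<xi> = \<beta> * (H \<xi> * (- complex_of_real (\<xi>^2))) + c * (U \<xi> * (- \<i> * \<xi>)) - N \<xi> * (- \<i> * \<xi>) - \<gamma> * W \<xi>" for \<xi>
  note h' = h[folded H_def] and w' = w[folded W_def]
  note L = Fourier_pair_L2(2)[OF \<phi>] Fourier_pair_L2(2)[OF h'] Fourier_pair_L2(2)[OF w'] Fourier_pair_L2(2)[OF g]
  have ft_cnj: "cnj (ft_real (deriv \<psi>) \<xi>) = - \<i> * \<xi> * cnj (ft_real \<psi> \<xi>)"
    "cnj (ft_real (deriv (deriv \<psi>)) \<xi>) = - complex_of_real (\<xi>^2) * cnj (ft_real \<psi> \<xi>)"
    if "test_fun \<psi>" for \<psi> \<xi>
    unfolding ft_deriv[OF test_fun_deriv[OF that]] ft_deriv[OF that]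
    by (simp_all add: power2_eq_square algebra_simps)
  \<comment> \<open>Q itself may grow like \<xi>^2 times a square integrable function. Distributing
    the powers of \<xi> over transforms of derivatives of \<psi> makes every summand a product of
    two square integrable functions.\<close>
  have pieces: "Q \<xi> * cnj (ft_real \<psi> \<xi>)
     = \<beta> * (H \<xi> * cnj (ft_real (deriv (deriv \<psi>)) \<xi>))
       + c * (U \<xi> * cnj (ft_real (deriv \<psi>) \<xi>))
       - N \<xi> * cnj (ft_real (deriv \<psi>) \<xi>)
       - \<gamma> * (W \<xi> * cnj (ft_real \<psi> \<xi>))"
    if "test_fun \<psi>" for \<psi> \<xi>
    unfolding ft_cnj[OF that] Q_def by (simp add: algebra_simps)
  have LT: "L2 (ft_real \<psi>)" if "test_fun \<psi>" for \<psi>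
    using test_fun_integrable[OF that] by (intro Plancherel_L1_L2(1)) auto
  have I: "integrable lborel (\<lambda>\<xi>. Q \<xi> * cnj (ft_real \<psi> \<xi>))"
    and Z: "(LINT \<xi>|lborel. Q \<xi> * cnj (ft_real \<psi> \<xi>)) = 0" if t: "test_fun \<psi>" for \<psi>
  proof -
    note t' = test_fun_deriv[OF t] and t'' = test_fun_deriv[OF test_fun_deriv[OF t]]
    note J = integrable_L2_mult(2)[OF L(2) LT[OF t'']] integrable_L2_mult(2)[OF L(1) LT[OF t']]
      integrable_L2_mult(2)[OF L(4) LT[OF t']] integrable_L2_mult(2)[OF L(3) LT[OF t]]
    show "integrable lborel (\<lambda>\<xi>. Q \<xi> * cnj (ft_real \<psi> \<xi>))"
      unfolding pieces[OF t] using J by (intro Bochner_Integration.integrable_diff Bochner_Integration.integrable_add integrable_mult_right) auto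
    have "(LINT \<xi>|lborel. Q \<xi> * cnj (ft_real \<psi> \<xi>))
       = \<beta> * L2_inner H (ft_real (deriv (deriv \<psi>)))
         + c * L2_inner U (ft_real (deriv \<psi>))
         - L2_inner N (ft_real (deriv \<psi>))
         - \<gamma> * L2_inner W (ft_real \<psi>)"
      unfolding pieces[OF t] L2_inner_def using J by simp
    also have "\<dots> = 2 * pi * complex_of_real (\<beta> * (LINT x|lborel. h x * deriv (deriv \<psi>) x)
          + c * (LINT x|lborel. \<phi> x * deriv \<psi> x) - (LINT x|lborel. g x * deriv \<psi> x)
          - \<gamma> * (LINT x|lborel. w x * \<psi> x))"
      unfolding of_real_add of_real_diff of_real_mult pairing_test_fun[OF h' t''] pairing_test_fun[OF \<phi> t']
        pairing_test_fun[OF g t'] pairing_test_fun[OF w' t] by (simp add: field_simps)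
    also have "\<dots> = 0" using weak[OF t] by simp
    finally show "(LINT \<xi>|lborel. Q \<xi> * cnj (ft_real \<psi> \<xi>)) = 0" .
  qed
  have Q0: "AE \<xi> in lborel. Q \<xi> * cnj (ft_real (\<lambda>x. bump (n * x)) \<xi>) = 0" if n: "n > 0" for n
  proof -
    let ?\<rho> = "\<lambda>x. bump (n * x)"
    let ?q = "\<lambda>\<xi>. Q \<xi> * cnj (ft_real ?\<rho> \<xi>)"
    have t: "test_fun ?\<rho>" using test_fun_bump[OF n, of 0] by simp
    note t' = test_fun_deriv[OF t] and t'' = test_fun_deriv[OF test_fun_deriv[OF t]]
    have bL: "L2 (\<lambda>\<xi>. V \<xi> * cnj (ft_real \<psi> \<xi>))" if V: "L2 V" and \<psi>: "test_fun \<psi>" for V \<psi>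
    proof -
      obtain C where C: "\<And>\<xi>. cmod (ft_real \<psi> \<xi>) \<le> C" using ft_test_fun_bounded[OF \<psi>] by blast
      have "L2 (\<lambda>\<xi>. cnj (ft_real \<psi> \<xi>) * V \<xi>)"
        by (rule L2_mult_bounded[OF V, of _ C])
          (use C test_fun_integrable(1)[OF \<psi>] in \<open>auto intro!: borel_measurable_cnj ft_measurable\<close>)
      then show ?thesis by (simp add: mult.commute)
    qed
    have qL: "L2 ?q" unfolding pieces[OF t]
      by (intro L2_add L2_diff L2_cmult bL L t t' t'')
    have qI: "integrable lborel ?q" by (rule I[OF t])
    have "ft ?q y = 0" for y
    proof -
      have "test_fun (\<lambda>x. bump (n * (x - (- y))))" by (rule test_fun_bump[OF n])
      then have t2: "test_fun (\<lambda>x. ?\<rho> (x + y))" by (simp only: diff_minus_eq_add)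
      \<comment> \<open>Translating the test function multiplies its transform by an exponential.
        The weak equation for the translate by y is therefore the Fourier integral of
        \<open>?q\<close> at y.\<close>
      have "ft ?q y = (LINT \<xi>|lborel. Q \<xi> * cnj (ft_real (\<lambda>x. ?\<rho> (x + y)) \<xi>))"
        unfolding ft_def[of ?q] ft_translate[of "\<lambda>x. complex_of_real (?\<rho> x)"]
        by (intro Bochner_Integration.integral_cong) (auto simp: cis_cnj mult_ac)
      also have "\<dots> = 0" by (rule Z[OF t2])
      finally show ?thesis .
    qed
    then have "L2_norm (ft ?q) = 0" by (simp add: L2_norm_def)
    with Plancherel_L1_L2(2)[OF qI qL] have "L2_norm ?q = 0" by simp
    from L2_norm_eq_0[OF qL this] show ?thesis .
  qed
  have "AE \<xi> in lborel. \<forall>k. Q \<xi> * cnj (ft_real (\<lambda>x. bump (real (Suc k) * x)) \<xi>) = 0"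
    unfolding AE_all_countable by (intro allI Q0) simp
  moreover have "AE \<xi> in lborel. \<xi> \<noteq> (0::real)" by (rule AE_lborel_singleton)
  ultimately show ?thesis
  proof eventually_elim
    case (elim \<xi>)
    have "Q \<xi> = 0" using elim(1) ft_bump_nonzero[of \<xi>] by (metis complex_cnj_zero_iff mult_eq_0_iff)
    \<comment> \<open>Off the null set {0} the residual Q equals \<i> * \<xi> * (N - m * U) with m
      the symbol in the claim, and the factor \<i> * \<xi> can be cancelled.\<close>
    then have "\<i> * complex_of_real \<xi> * (N \<xi> - complex_of_real (c - \<beta> * \<bar>\<xi>\<bar> - \<gamma> / \<xi>^2) * U \<xi>) = 0"
      using elim(2) unfolding Q_def H_def W_def
      by (cases "\<xi> > 0") (auto simp: field_simps power2_eq_square)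
    then show ?case using elim(2) by simp
  qed
qed

section \<open>The virial identity\<close>

text \<open>Up to the factor - \<i> this is the transform of the antiderivative of \<phi> in
  \<open>is_dinv\<close>.\<close>

abbreviation over_frequency :: "(real \<Rightarrow> complex) \<Rightarrow> real \<Rightarrow> complex" where
  "over_frequency U \<equiv> (\<lambda>\<xi>. complex_of_real (1 / \<xi>) * U \<xi>)"

lemma cmod_cis_minus_1_le: "cmod (cis t - 1) \<le> \<bar>t\<bar>"
  using iexp_approx1[of t 0] by (simp add: cis_conv_exp)

lemma cis_difference_quotient_tendsto:
  "(\<lambda>n. complex_of_real (real (Suc n)) * (cis (1 / real (Suc n) * \<xi>) - 1)) \<longlonglongrightarrow> \<i> * complex_of_real \<xi>"
proof -
  have "((\<lambda>z. exp (\<i> * \<xi> * z)) has_field_derivative \<i> * \<xi>) (at 0)"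
    by (auto intro!: derivative_eq_intros)
  then have d: "((\<lambda>h. (exp (\<i> * \<xi> * (0 + h)) - exp (\<i> * \<xi> * 0)) / h) \<longlongrightarrow> \<i> * \<xi>) (at 0)"
    unfolding DERIV_def .
  have "filterlim (\<lambda>n. complex_of_real (1 / real (Suc n))) (at 0) sequentially"
  proof (rule filterlim_atI)
    show "(\<lambda>n. complex_of_real (1 / real (Suc n))) \<longlonglongrightarrow> 0"
      using tendsto_of_real[OF LIMSEQ_Suc[OF lim_1_over_n], where 'a=complex] by simp
  qed (simp del: of_nat_Suc)
  from filterlim_compose[OF d this] show ?thesis
    by (simp add: cis_conv_exp mult_ac del: of_nat_Suc)
qed

text \<open>The inequality for \<open>cis t - 1\<close> bounds every difference quotient on the
  Fourier side by \<bar>\<xi>\<bar> * \<bar>U\<bar>. Dominated convergence then gives convergence in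
  L2 without differentiating \<phi> pointwise.\<close>

lemma difference_quotient_Fourier:
  fixes \<phi> :: "real \<Rightarrow> real"
  assumes F: "Fourier_pair_real \<phi> U"
    and X: "L2 (\<lambda>\<xi>. complex_of_real \<xi> * U \<xi>)"
  obtains E where
    "\<And>n. Fourier_pair (\<lambda>x. complex_of_real (real (Suc n) * (\<phi> (x + 1 / real (Suc n)) - \<phi> x))) (E n)"
    "L2_tendsto E (\<lambda>\<xi>. \<i> * (complex_of_real \<xi> * U \<xi>))"
proof -
  define E where "E n \<xi> = complex_of_real (real (Suc n)) * (cis (1 / real (Suc n) * \<xi>) * U \<xi> - U \<xi>)" for n \<xi>
  have UL: "L2 U" by (rule Fourier_pair_L2(2)[OF F])
  note [measurable] = L2_measurable[OF UL]
  have "Fourier_pair (\<lambda>x. complex_of_real (real (Suc n)) * (complex_of_real (\<phi> (x + 1 / real (Suc n))) - complex_of_real (\<phi> x))) (E n)" for n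
    unfolding E_def by (intro Fourier_pair_cmult Fourier_pair_diff Fourier_pair_translate[OF F] F)
  then have 1: "Fourier_pair (\<lambda>x. complex_of_real (real (Suc n) * (\<phi> (x + 1 / real (Suc n)) - \<phi> x))) (E n)" for n
    by (simp only: of_real_mult of_real_diff)
  have 2: "L2_tendsto E (\<lambda>\<xi>. \<i> * (complex_of_real \<xi> * U \<xi>))"
  proof (rule L2_tendsto_dominated[OF _ _ X])
    show "E n \<in> borel_measurable borel" for n unfolding E_def by measurable
    show "AE \<xi> in lborel. cmod (E n \<xi>) \<le> cmod (complex_of_real \<xi> * U \<xi>)" for n
    proof (rule AE_I2)
      fix \<xi>
      have "E n \<xi> = complex_of_real (real (Suc n)) * ((cis (1 / real (Suc n) * \<xi>) - 1) * U \<xi>)"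
        by (simp only: E_def left_diff_distrib mult_1_left)
      then have "cmod (E n \<xi>) = real (Suc n) * (cmod (cis (1 / real (Suc n) * \<xi>) - 1) * cmod (U \<xi>))"
        by (simp only: norm_mult norm_of_real abs_of_nat)
      also have "\<dots> \<le> real (Suc n) * (\<bar>1 / real (Suc n) * \<xi>\<bar> * cmod (U \<xi>))"
        by (intro mult_left_mono mult_right_mono cmod_cis_minus_1_le) simp_all
      also have "\<dots> = cmod (complex_of_real \<xi> * U \<xi>)"
        by (simp add: norm_mult abs_mult del: of_nat_Suc)
      finally show "cmod (E n \<xi>) \<le> cmod (complex_of_real \<xi> * U \<xi>)" .
    qed
    show "AE \<xi> in lborel. (\<lambda>n. E n \<xi>) \<longlonglongrightarrow> \<i> * (complex_of_real \<xi> * U \<xi>)"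
    proof (rule AE_I2)
      fix \<xi>
      have "(\<lambda>n. complex_of_real (real (Suc n)) * (cis (1 / real (Suc n) * \<xi>) - 1) * U \<xi>) \<longlonglongrightarrow> \<i> * complex_of_real \<xi> * U \<xi>"
        by (intro tendsto_mult_right cis_difference_quotient_tendsto)
      moreover have "(\<lambda>n. E n \<xi>) = (\<lambda>n. complex_of_real (real (Suc n)) * (cis (1 / real (Suc n) * \<xi>) - 1) * U \<xi>)"
        by (intro ext) (simp only: E_def mult.assoc left_diff_distrib mult_1_left)
      ultimately show "(\<lambda>n. E n \<xi>) \<longlonglongrightarrow> \<i> * (complex_of_real \<xi> * U \<xi>)" by (simp only: mult.assoc)
    qed
  qed measurable
  from that[OF 1 2] show thesis .
qed

lemma Fourier_pair_sin:
  assumes "Fourier_pair g N"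
  shows "Fourier_pair (\<lambda>x. complex_of_real (sin (r * x)) * g x) (\<lambda>\<xi>. 1 / (2 * \<i>) * (N (\<xi> - r) - N (\<xi> - (- r))))"
proof -
  have "Fourier_pair (\<lambda>x. 1 / (2 * \<i>) * (cis (r * x) * g x - cis ((- r) * x) * g x)) (\<lambda>\<xi>. 1 / (2 * \<i>) * (N (\<xi> - r) - N (\<xi> - (- r))))"
    by (intro Fourier_pair_cmult Fourier_pair_diff Fourier_pair_modulate assms)
  moreover have "1 / (2 * \<i>) * (cis (r * x) * g x - cis ((- r) * x) * g x) = complex_of_real (sin (r * x)) * g x" for x
  proof -
    have "cis (r * x) - cis ((- r) * x) = 2 * \<i> * complex_of_real (sin (r * x))"
      by (simp add: complex_eq_iff)
    then show ?thesis by (simp flip: left_diff_distrib)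
  qed
  ultimately show ?thesis by simp
qed

lemma abs_sin_diff_le: "\<bar>sin x - sin y\<bar> \<le> \<bar>x - y\<bar>" for x y :: real
proof -
  have "\<bar>sin ((x - y) / 2)\<bar> * \<bar>cos ((x + y) / 2)\<bar> \<le> \<bar>(x - y) / 2\<bar> * 1"
    by (intro mult_mono abs_sin_x_le_abs_x) auto
  then show ?thesis by (simp add: sin_diff_sin abs_mult)
qed

text \<open>The bound on \<open>G (x + s) - G x - g x * (\<phi> (x + s) - \<phi> x)\<close> is Taylor's formula when \<open>G\<close> is a primitive
  of the nonlinearity at \<open>\<phi>\<close>; \<open>sin (r * x) / r\<close> replaces the unbounded virial multiplier \<open>x\<close>.\<close>
lemma virial_sin:
  fixes \<phi> g G :: "real \<Rightarrow> real"
  assumes F: "Fourier_pair_real \<phi> U" and g: "Fourier_pair_real g N"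
    and X: "L2 (\<lambda>\<xi>. complex_of_real \<xi> * U \<xi>)" and G: "integrable lborel G"
    and T: "\<And>x s. \<bar>G (x + s) - G x - g x * (\<phi> (x + s) - \<phi> x)\<bar> \<le> K * (\<phi> (x + s) - \<phi> x)^2"
  shows "complex_of_real (4 * pi * r * (LINT x|lborel. cos (r * x) * G x))
     = L2_inner (\<lambda>\<xi>. N (\<xi> - r)) (\<lambda>\<xi>. complex_of_real \<xi> * U \<xi>) - L2_inner (\<lambda>\<xi>. N (\<xi> + r)) (\<lambda>\<xi>. complex_of_real \<xi> * U \<xi>)"
proof -
  define s where "s n = 1 / real (Suc n)" for n
  have s: "s n > 0" "real (Suc n) = 1 / s n" for n by (auto simp: s_def)
  have s0: "s \<longlonglongrightarrow> 0" unfolding s_def by (rule LIMSEQ_Suc[OF lim_1_over_n])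
  define D where "D n x = real (Suc n) * (\<phi> (x + s n) - \<phi> x)" for n x
  obtain E where
    E1: "\<And>n. Fourier_pair (\<lambda>x. complex_of_real (real (Suc n) * (\<phi> (x + 1 / real (Suc n)) - \<phi> x))) (E n)" and
    E2: "L2_tendsto E (\<lambda>\<xi>. \<i> * (complex_of_real \<xi> * U \<xi>))"
    by (rule difference_quotient_Fourier[OF F X]) (rule that)
  note E = E1[folded s_def, folded D_def] E2
  note [measurable] = borel_measurable_integrable[OF G]
  have gL: "L2 g" using Fourier_pair_L2(1)[OF g] by simp
  have DL: "L2 (D n)" for n using Fourier_pair_L2(1)[OF E(1)[of n]] by simp
  have [measurable]: "g \<in> borel_measurable borel" "D n \<in> borel_measurable borel" for n
    using gL DL by (auto simp: L2_def)
  \<comment> \<open>The limit of J is computed twice: in x, by moving the difference quotient onto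
    the sine, and in frequency, by Parseval.\<close>
  define J where "J n = (LINT x|lborel. sin (r * x) * g x * D n x)" for n
  have gD: "integrable lborel (\<lambda>x. sin (r * x) * g x * D n x)" for n
  proof -
    have "integrable lborel (\<lambda>x. cmod (complex_of_real (g x)) * cmod (complex_of_real (D n x)))"
      using gL DL by (intro integrable_L2_mult(1)) auto
    then have i: "integrable lborel (\<lambda>x. \<bar>g x\<bar> * \<bar>D n x\<bar>)" by simp
    show ?thesis
      by (rule Bochner_Integration.integrable_bound[OF i])
        (auto simp: abs_mult mult.assoc intro!: mult_left_le_one_le)
  qed
  have Jlim: "J \<longlonglongrightarrow> (LINT x|lborel. (- r * cos (r * x)) * G x)"
  proof -
    \<comment> \<open>A discrete integration by parts: after a translation, P n is the integral of
      sin (r * x) against the difference quotient of G.\<close>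
    define P where "P n = (LINT x|lborel. (sin (r * (x - s n)) - sin (r * x)) / s n * G x)" for n
    have Gs: "integrable lborel (\<lambda>x. sin (r * x) * G (x + s n))" for n
      by (rule Bochner_Integration.integrable_bound[OF integrable_translate[OF G, of "s n"]])
        (auto simp: abs_mult intro!: mult_left_le_one_le)
    have G0: "integrable lborel (\<lambda>x. sin (r * x) * G x)"
      by (rule Bochner_Integration.integrable_bound[OF G])
        (auto simp: abs_mult intro!: mult_left_le_one_le)
    have G1: "integrable lborel (\<lambda>x. sin (r * (x - s n)) * G x)" for n
      by (rule Bochner_Integration.integrable_bound[OF G])
        (auto simp: abs_mult intro!: mult_left_le_one_le)
    have P_eq: "P n = (LINT x|lborel. sin (r * x) * (G (x + s n) - G x) / s n)" for n
    proof -
      have "(LINT x|lborel. sin (r * x) * (G (x + s n) - G x) / s n)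
         = (LINT x|lborel. sin (r * x) * G (x + s n) / s n - sin (r * x) * G x / s n)"
        by (intro Bochner_Integration.integral_cong) (auto simp: algebra_simps diff_divide_distrib)
      also have "\<dots> = (LINT x|lborel. sin (r * x) * G (x + s n)) / s n - (LINT x|lborel. sin (r * x) * G x) / s n"
        using Gs[of n] G0 by simp
      also have "(LINT x|lborel. sin (r * x) * G (x + s n)) = (LINT x|lborel. sin (r * (x - s n)) * G x)"
        using integral_translate[of "\<lambda>x. sin (r * (x - s n)) * G x" "s n"] by simp
      also have "(LINT x|lborel. sin (r * (x - s n)) * G x) / s n - (LINT x|lborel. sin (r * x) * G x) / s n
          = (LINT x|lborel. sin (r * (x - s n)) * G x / s n - sin (r * x) * G x / s n)"
        using G1[of n] G0 by simp
      also have "\<dots> = P n" unfolding P_def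
        by (intro Bochner_Integration.integral_cong) (auto simp: algebra_simps diff_divide_distrib)
      finally show ?thesis ..
    qed
    have Plim: "P \<longlonglongrightarrow> (LINT x|lborel. (- r * cos (r * x)) * G x)"
      unfolding P_def
    proof (rule integral_dominated_convergence)
      show "integrable lborel (\<lambda>x. \<bar>r\<bar> * \<bar>G x\<bar>)" using G by simp
      show "AE x in lborel. norm ((sin (r * (x - s n)) - sin (r * x)) / s n * G x) \<le> \<bar>r\<bar> * \<bar>G x\<bar>" for n
      proof (rule AE_I2)
        fix x
        have "\<bar>sin (r * (x - s n)) - sin (r * x)\<bar> \<le> \<bar>r\<bar> * s n"
          using abs_sin_diff_le[of "r * (x - s n)" "r * x"] s(1)[of n] by (simp add: algebra_simps abs_mult)
        then have "\<bar>(sin (r * (x - s n)) - sin (r * x)) / s n\<bar> \<le> \<bar>r\<bar>"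
          using s(1)[of n] by (simp add: field_simps)
        then show "norm ((sin (r * (x - s n)) - sin (r * x)) / s n * G x) \<le> \<bar>r\<bar> * \<bar>G x\<bar>"
          unfolding real_norm_def abs_mult by (intro mult_right_mono) auto
      qed
      show "AE x in lborel. (\<lambda>n. (sin (r * (x - s n)) - sin (r * x)) / s n * G x) \<longlonglongrightarrow> - r * cos (r * x) * G x"
      proof (rule AE_I2)
        fix x
        have "((\<lambda>h. sin (r * (x - h))) has_real_derivative - r * cos (r * x)) (at 0)"
          by (auto intro!: derivative_eq_intros)
        then have d: "((\<lambda>h. (sin (r * (x - (0 + h))) - sin (r * (x - 0))) / h) \<longlongrightarrow> - r * cos (r * x)) (at 0)"
          unfolding DERIV_def .
        have "filterlim s (at 0) sequentially"
          by (rule filterlim_atI[OF s0]) (use s(1) in \<open>simp add: less_imp_neq[symmetric]\<close>)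
        from filterlim_compose[OF d this]
        have "(\<lambda>n. (sin (r * (x - s n)) - sin (r * x)) / s n) \<longlonglongrightarrow> - r * cos (r * x)" by simp
        then show "(\<lambda>n. (sin (r * (x - s n)) - sin (r * x)) / s n * G x) \<longlonglongrightarrow> - r * cos (r * x) * G x"
          by (intro tendsto_intros)
      qed
    qed measurable
    \<comment> \<open>Replacing the difference quotient of G by g times that of \<phi> costs at most
      K * s n * (D n x)^2 pointwise. Plancherel keeps the integral of (D n)^2 bounded, so the factor
      s n sends the error to 0.\<close>
    have PJ: "norm (P n - J n) \<le> K * s n * (L2_norm (E n))^2 / (2 * pi)" for n
    proof -
      let ?e = "\<lambda>x. sin (r * x) * (G (x + s n) - G x) / s n - sin (r * x) * g x * D n x"
      have iP: "integrable lborel (\<lambda>x. sin (r * x) * (G (x + s n) - G x) / s n)"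
        using Gs[of n] G0 by (simp add: right_diff_distrib diff_divide_distrib)
      have iD: "integrable lborel (\<lambda>x. (D n x)^2)" using DL[of n] by (simp add: L2_def)
      have eq: "P n - J n = (LINT x|lborel. ?e x)"
        unfolding P_eq J_def using iP gD[of n] by simp
      have "norm (P n - J n) \<le> (LINT x|lborel. norm (?e x))"
        unfolding eq by (rule integral_norm_bound)
      also have "\<dots> \<le> (LINT x|lborel. K * s n * (D n x)^2)"
      proof (rule integral_mono)
        fix x
        have D': "D n x = (\<phi> (x + s n) - \<phi> x) / s n"
          unfolding D_def s(2) by (simp only: times_divide_eq_left mult_1_left)
        have eq: "?e x
           = sin (r * x) * (G (x + s n) - G x - g x * (\<phi> (x + s n) - \<phi> x)) / s n"
          unfolding D' by (simp add: algebra_simps diff_divide_distrib add_divide_distrib)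
        have "norm (?e x)
           \<le> 1 * \<bar>G (x + s n) - G x - g x * (\<phi> (x + s n) - \<phi> x)\<bar> / \<bar>s n\<bar>"
          unfolding eq unfolding real_norm_def abs_divide abs_mult
          by (intro divide_right_mono mult_right_mono) auto
        also have "\<dots> \<le> K * (\<phi> (x + s n) - \<phi> x)^2 / s n"
          using T[of x "s n"] s(1)[of n] by (auto simp: intro: divide_right_mono)
        also have "\<dots> = K * s n * (D n x)^2"
          unfolding D' using s(1)[of n] by (simp add: power2_eq_square field_simps)
        finally show "norm (?e x) \<le> K * s n * (D n x)^2" .
      qed (use iP gD[of n] iD in auto)
      also have "\<dots> = K * s n * (L2_norm (\<lambda>x. complex_of_real (D n x)))^2" by (simp add: L2_norm_power2)
      also have "\<dots> = K * s n * (L2_norm (E n))^2 / (2 * pi)" using Plancherel[OF E(1)[of n]] by simp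
      finally show ?thesis .
    qed
    have "(\<lambda>n. K * s n * (L2_norm (E n))^2 / (2 * pi)) \<longlonglongrightarrow> K * 0 * (L2_norm (\<lambda>\<xi>. \<i> * (complex_of_real \<xi> * U \<xi>)))^2 / (2 * pi)"
      by (intro tendsto_intros s0 L2_tendsto_norm E) simp
    then have z: "(\<lambda>n. K * s n * (L2_norm (E n))^2 / (2 * pi)) \<longlonglongrightarrow> 0" by simp
    have "(\<lambda>n. P n - J n) \<longlonglongrightarrow> 0"
      by (rule Lim_null_comparison[OF always_eventually[OF allI] z]) (rule PJ)
    from tendsto_diff[OF Plim this] show ?thesis by simp
  qed
  \<comment> \<open>Multiplication by the sine becomes a difference of two shifts of N; the factor 1
    / (2 * \<i>) turns the 2 * pi of Parseval into the 4 * pi of the conclusion.\<close>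
  define S where "S \<xi> = 1 / (2 * \<i>) * (N (\<xi> - r) - N (\<xi> - (- r)))" for \<xi>
  have FS: "Fourier_pair (\<lambda>x. complex_of_real (sin (r * x)) * complex_of_real (g x)) S"
    unfolding S_def by (rule Fourier_pair_sin[OF g])
  have JS: "complex_of_real (2 * pi * J n) = L2_inner S (E n)" for n
  proof -
    have "L2_inner S (E n) = 2 * pi * L2_inner (\<lambda>x. complex_of_real (sin (r * x)) * complex_of_real (g x)) (\<lambda>x. complex_of_real (D n x))"
      by (rule Parseval[OF FS E(1)])
    also have "L2_inner (\<lambda>x. complex_of_real (sin (r * x)) * complex_of_real (g x)) (\<lambda>x. complex_of_real (D n x)) = complex_of_real (J n)"
      unfolding L2_inner_def J_def by (simp flip: integral_complex_of_real)
    finally show ?thesis by simp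
  qed
  have "(\<lambda>n. complex_of_real (2 * pi * J n)) \<longlonglongrightarrow> L2_inner S (\<lambda>\<xi>. \<i> * (complex_of_real \<xi> * U \<xi>))"
    unfolding JS by (intro L2_tendsto_inner L2_tendsto_const E Fourier_pair_L2(2)[OF FS])
  moreover have "(\<lambda>n. complex_of_real (2 * pi * J n)) \<longlonglongrightarrow> complex_of_real (2 * pi * (LINT x|lborel. (- r * cos (r * x)) * G x))"
    by (intro tendsto_intros Jlim)
  ultimately have "complex_of_real (2 * pi * (LINT x|lborel. (- r * cos (r * x)) * G x)) = L2_inner S (\<lambda>\<xi>. \<i> * (complex_of_real \<xi> * U \<xi>))"
    using LIMSEQ_unique by blast
  also have "(LINT x|lborel. (- r * cos (r * x)) * G x) = - r * (LINT x|lborel. cos (r * x) * G x)"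
    by (simp add: mult.assoc)
  also have "L2_inner S (\<lambda>\<xi>. \<i> * (complex_of_real \<xi> * U \<xi>)) =
      - \<i> * (1 / (2 * \<i>) * (L2_inner (\<lambda>\<xi>. N (\<xi> - r)) (\<lambda>\<xi>. complex_of_real \<xi> * U \<xi>) - L2_inner (\<lambda>\<xi>. N (\<xi> - (- r))) (\<lambda>\<xi>. complex_of_real \<xi> * U \<xi>)))"
  proof -
    have NL: "L2 (\<lambda>\<xi>. N (\<xi> - t))" for t
      using L2_translate[OF Fourier_pair_L2(2)[OF g], of "- t"] by simp
    have "L2_inner S (\<lambda>\<xi>. \<i> * (complex_of_real \<xi> * U \<xi>)) = - \<i> * L2_inner S (\<lambda>\<xi>. complex_of_real \<xi> * U \<xi>)"
      unfolding L2_inner_cmult_right by simp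
    also have "L2_inner S (\<lambda>\<xi>. complex_of_real \<xi> * U \<xi>) = 1 / (2 * \<i>) * L2_inner (\<lambda>\<xi>. N (\<xi> - r) - N (\<xi> - (- r))) (\<lambda>\<xi>. complex_of_real \<xi> * U \<xi>)"
      unfolding S_def L2_inner_cmult_left ..
    also have "L2_inner (\<lambda>\<xi>. N (\<xi> - r) - N (\<xi> - (- r))) (\<lambda>\<xi>. complex_of_real \<xi> * U \<xi>) =
       L2_inner (\<lambda>\<xi>. N (\<xi> - r)) (\<lambda>\<xi>. complex_of_real \<xi> * U \<xi>) - L2_inner (\<lambda>\<xi>. N (\<xi> - (- r))) (\<lambda>\<xi>. complex_of_real \<xi> * U \<xi>)"
      by (rule L2_inner_diff_left[OF NL NL X])
    finally show ?thesis .
  qed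
  also have "- \<i> * (1 / (2 * \<i>) * z) = - (z / 2)" for z :: complex
    by simp
  finally show ?thesis by (simp add: field_simps)
qed

text \<open>The difference of cubes \<xi>^3 - \<eta>^3 with \<eta> = \<xi> - r exposes the factor r.
  As r \<rightarrow> 0 the three remaining terms all tend to 1 / \<xi>^2, which is the source of the
  coefficient 3 * \<gamma>.\<close>

lemma virial_kernel_eq:
  fixes \<xi> r c \<beta> \<gamma> :: real
  assumes "\<xi> \<noteq> 0" "\<xi> - r \<noteq> 0"
  shows "(c - \<beta> * \<bar>\<xi> - r\<bar> - \<gamma> / (\<xi> - r)^2) * \<xi> - (\<xi> - r) * (c - \<beta> * \<bar>\<xi>\<bar> - \<gamma> / \<xi>^2)
    = r * c - \<beta> * (\<bar>\<xi> - r\<bar> * \<xi> - (\<xi> - r) * \<bar>\<xi>\<bar>)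
      - r * \<gamma> * (1 / (\<xi> - r)^2 + 1 / (\<xi> - r) * (1 / \<xi>) + 1 / \<xi>^2)"
proof -
  define \<eta> where "\<eta> = \<xi> - r"
  have r: "r = \<xi> - \<eta>" and nz: "\<xi> \<noteq> 0" "\<eta> \<noteq> 0" using assms by (auto simp: \<eta>_def)
  have "\<xi> / \<eta>^2 - \<eta> / \<xi>^2 = (\<xi> - \<eta>) * (1 / \<eta>^2 + 1 / \<eta> * (1 / \<xi>) + 1 / \<xi>^2)"
    using nz by (simp add: divide_simps) algebra
  then have "\<gamma> * (\<xi> / \<eta>^2 - \<eta> / \<xi>^2) = (\<xi> - \<eta>) * \<gamma> * (1 / \<eta>^2 + 1 / \<eta> * (1 / \<xi>) + 1 / \<xi>^2)"
    by simp
  then show ?thesis unfolding \<eta>_def[symmetric] r by (simp add: algebra_simps)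
qed

text \<open>The expression vanishes unless \<xi> and \<xi> - r have opposite signs, and then both
  are at most \<bar>r\<bar> in size. Since the bound is quadratic in r, the \<beta> term disappears
  after division by r in the limit.\<close>

lemma virial_kernel_abs_le:
  fixes \<xi> r :: real
  shows "\<bar>\<bar>\<xi> - r\<bar> * \<xi> - (\<xi> - r) * \<bar>\<xi>\<bar>\<bar> \<le> 2 * r^2"
proof -
  define \<eta> where "\<eta> = \<xi> - r"
  have r: "r = \<xi> - \<eta>" by (simp add: \<eta>_def)
  have "\<bar>\<bar>\<eta>\<bar> * \<xi> - \<eta> * \<bar>\<xi>\<bar>\<bar> \<le> 2 * (\<xi> - \<eta>)^2"
  proof (cases "\<xi> * \<eta> \<ge> 0")
    case True
    then have "\<bar>\<eta>\<bar> * \<xi> - \<eta> * \<bar>\<xi>\<bar> = 0" by (auto simp: abs_if zero_le_mult_iff)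
    then show ?thesis by simp
  next
    case False
    have "\<bar>\<bar>\<eta>\<bar> * \<xi> - \<eta> * \<bar>\<xi>\<bar>\<bar> \<le> \<bar>\<bar>\<eta>\<bar> * \<xi>\<bar> + \<bar>\<eta> * \<bar>\<xi>\<bar>\<bar>" by linarith
    also have "\<dots> = 2 * (\<bar>\<xi>\<bar> * \<bar>\<eta>\<bar>)" by (simp add: abs_mult)
    also have "\<dots> = - 2 * (\<xi> * \<eta>)" using False by (simp flip: abs_mult)
    also have "\<dots> \<le> 2 * (\<xi> - \<eta>)^2"
    proof -
      have "2 * (\<xi> - \<eta>)^2 + 2 * (\<xi> * \<eta>) = 2 * \<xi>^2 + 2 * \<eta>^2 - 2 * (\<xi> * \<eta>)"
        by (simp add: power2_diff algebra_simps)
      moreover have "0 \<le> \<xi>^2" "0 \<le> \<eta>^2" by simp_all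
      ultimately show ?thesis using False by linarith
    qed
    finally show ?thesis .
  qed
  then show ?thesis unfolding \<eta>_def by simp
qed

text \<open>The two shifted products of \<open>virial_sin\<close> are brought to a common kernel and
  divided by r, and r is sent to 0. Distributing the weights 1 / (\<xi> - r)^2, 1 / (\<xi> - r) * (1
  / \<xi>) and 1 / \<xi>^2 over the two factors leaves inner products of translates of L2 functions,
  which are continuous in r; this is the purpose of V1 and V2.\<close>

lemma virial_identity:
  fixes \<phi> g G :: "real \<Rightarrow> real" and c \<beta> \<gamma> :: real
  defines "m \<equiv> \<lambda>\<xi>. c - \<beta> * \<bar>\<xi>\<bar> - \<gamma> / \<xi>^2"
  assumes F: "Fourier_pair_real \<phi> U"
    and g: "Fourier_pair_real g (\<lambda>\<xi>. complex_of_real (m \<xi>) * U \<xi>)"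
    and X: "L2 (\<lambda>\<xi>. complex_of_real \<xi> * U \<xi>)"
    and V1: "L2 (over_frequency U)"
    and V2: "L2 (\<lambda>\<xi>. complex_of_real (1 / \<xi>^2) * U \<xi>)"
    and G: "integrable lborel G"
    and T: "\<And>x s. \<bar>G (x + s) - G x - g x * (\<phi> (x + s) - \<phi> x)\<bar> \<le> K * (\<phi> (x + s) - \<phi> x)^2"
  shows "4 * pi * (LINT x|lborel. G x) = c * (L2_norm U)^2 - 3 * \<gamma> * (L2_norm (over_frequency U))^2"
proof -
  let ?k = "\<lambda>r \<xi>. complex_of_real (\<bar>\<xi> - r\<bar> * \<xi> - (\<xi> - r) * \<bar>\<xi>\<bar>)"
  let ?N = "\<lambda>\<xi>. complex_of_real (m \<xi>) * U \<xi>"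
  let ?X = "\<lambda>\<xi>. complex_of_real \<xi> * U \<xi>"
  let ?V1 = "over_frequency U"
  let ?V2 = "\<lambda>\<xi>. complex_of_real (1 / \<xi>^2) * U \<xi>"
  note UL = Fourier_pair_L2(2)[OF F] and NL = Fourier_pair_L2(2)[OF g]
  note [measurable] = L2_measurable[OF UL]
  have sh: "L2 (\<lambda>\<xi>. V (\<xi> - r))" if "L2 V" for V :: "real \<Rightarrow> complex" and r
    using L2_translate[OF that, of "- r"] by simp
  define Z where "Z r = L2_inner (\<lambda>\<xi>. ?k r \<xi> * U (\<xi> - r)) U" for r
  have ZL: "L2 (\<lambda>\<xi>. ?k r \<xi> * U (\<xi> - r))" for r
    by (rule L2_mult_bounded[OF sh[OF UL], of _ "2 * r^2"]) (use virial_kernel_abs_le in \<open>auto simp only: norm_of_real, measurable\<close>)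
  have Zb: "cmod (Z r) \<le> 2 * r^2 * (L2_norm U)^2" for r
  proof -
    have "L2_norm (\<lambda>\<xi>. ?k r \<xi> * U (\<xi> - r)) \<le> L2_norm (\<lambda>\<xi>. complex_of_real (2 * r^2) * U (\<xi> - r))"
    proof (rule L2_norm_le)
      show "AE \<xi> in lborel. cmod (?k r \<xi> * U (\<xi> - r)) \<le> cmod (complex_of_real (2 * r^2) * U (\<xi> - r))"
      proof (rule AE_I2)
        fix \<xi>
        have "\<bar>\<bar>\<xi> - r\<bar> * \<xi> - (\<xi> - r) * \<bar>\<xi>\<bar>\<bar> \<le> \<bar>2 * r^2\<bar>"
          using virial_kernel_abs_le[of \<xi> r] by linarith
        then show "cmod (?k r \<xi> * U (\<xi> - r)) \<le> cmod (complex_of_real (2 * r^2) * U (\<xi> - r))"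
          unfolding norm_mult norm_of_real by (rule mult_right_mono) simp
      qed
    qed (use L2_cmult[OF sh[OF UL]] in measurable)
    also have "\<dots> = 2 * r^2 * L2_norm U"
      unfolding L2_norm_cmult using L2_norm_translate[of U "- r"] by (simp add: norm_mult norm_power)
    finally have "L2_norm (\<lambda>\<xi>. ?k r \<xi> * U (\<xi> - r)) * L2_norm U \<le> 2 * r^2 * L2_norm U * L2_norm U"
      by (intro mult_right_mono) auto
    with L2_inner_le[OF ZL UL, of r] show ?thesis by (simp add: Z_def power2_eq_square mult.assoc)
  qed
  have key: "4 * pi * r * (LINT x|lborel. cos (r * x) * G x)
     = Re (complex_of_real (r * c) * L2_inner (\<lambda>\<xi>. U (\<xi> - r)) U - complex_of_real \<beta> * Z r
         - complex_of_real (r * \<gamma>) * (L2_inner (\<lambda>\<xi>. ?V2 (\<xi> - r)) U + L2_inner (\<lambda>\<xi>. ?V1 (\<xi> - r)) ?V1 + L2_inner (\<lambda>\<xi>. U (\<xi> - r)) ?V2))" for r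
  proof -
    let ?R = "\<lambda>\<xi>. complex_of_real (r * c) * (U (\<xi> - r) * cnj (U \<xi>))
        - complex_of_real \<beta> * (?k r \<xi> * U (\<xi> - r) * cnj (U \<xi>))
        - complex_of_real (r * \<gamma>) * (?V2 (\<xi> - r) * cnj (U \<xi>) + ?V1 (\<xi> - r) * cnj (?V1 \<xi>) + U (\<xi> - r) * cnj (?V2 \<xi>))"
    have shift: "L2_inner (\<lambda>\<xi>. ?N (\<xi> + r)) ?X = L2_inner ?N (\<lambda>\<xi>. ?X (\<xi> - r))"
      unfolding L2_inner_def using integral_translate[of "\<lambda>\<xi>. ?N \<xi> * cnj (?X (\<xi> - r))" r] by simp
    have "4 * pi * r * (LINT x|lborel. cos (r * x) * G x) = Re (L2_inner (\<lambda>\<xi>. ?N (\<xi> - r)) ?X) - Re (L2_inner ?N (\<lambda>\<xi>. ?X (\<xi> - r)))"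
      using arg_cong[OF virial_sin[OF F g X G T, of r], of Re] unfolding shift by simp
    \<comment> \<open>Conjugation preserves the real part and puts the shift on the same factor as
      in the first product.\<close>
    also have "Re (L2_inner ?N (\<lambda>\<xi>. ?X (\<xi> - r))) = Re (L2_inner (\<lambda>\<xi>. ?X (\<xi> - r)) ?N)"
    proof -
      have "L2_inner (\<lambda>\<xi>. ?X (\<xi> - r)) ?N = (LINT \<xi>|lborel. cnj (?N \<xi> * cnj (?X (\<xi> - r))))"
        unfolding L2_inner_def by (intro Bochner_Integration.integral_cong) (auto simp: mult_ac)
      also have "\<dots> = cnj (L2_inner ?N (\<lambda>\<xi>. ?X (\<xi> - r)))"
        unfolding L2_inner_def by (rule Bochner_Integration.integral_cnj)
      finally show ?thesis by simp
    qed
    also have "Re (L2_inner (\<lambda>\<xi>. ?N (\<xi> - r)) ?X) - Re (L2_inner (\<lambda>\<xi>. ?X (\<xi> - r)) ?N)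
       = Re (LINT \<xi>|lborel. ?N (\<xi> - r) * cnj (?X \<xi>) - ?X (\<xi> - r) * cnj (?N \<xi>))"
      unfolding L2_inner_def using integrable_L2_mult(2)[OF sh[OF NL] X, of r] integrable_L2_mult(2)[OF sh[OF X] NL, of r]
      by (subst Bochner_Integration.integral_diff) (auto simp only: minus_complex.sel)
    also have "(LINT \<xi>|lborel. ?N (\<xi> - r) * cnj (?X \<xi>) - ?X (\<xi> - r) * cnj (?N \<xi>))
       = (LINT \<xi>|lborel. ?R \<xi>)"
    proof (rule integral_cong_AE)
      have "AE \<xi> in lborel. \<xi> \<noteq> (0::real)" "AE \<xi> in lborel. \<xi> \<noteq> r" by (rule AE_lborel_singleton)+
      then show "AE \<xi> in lborel. ?N (\<xi> - r) * cnj (?X \<xi>) - ?X (\<xi> - r) * cnj (?N \<xi>)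
         = ?R \<xi>"
      proof eventually_elim
        case (elim \<xi>)
        have "?N (\<xi> - r) * cnj (?X \<xi>) - ?X (\<xi> - r) * cnj (?N \<xi>)
           = complex_of_real (m (\<xi> - r) * \<xi> - (\<xi> - r) * m \<xi>) * (U (\<xi> - r) * cnj (U \<xi>))"
          by (simp add: algebra_simps)
        also have "m (\<xi> - r) * \<xi> - (\<xi> - r) * m \<xi> = r * c - \<beta> * (\<bar>\<xi> - r\<bar> * \<xi> - (\<xi> - r) * \<bar>\<xi>\<bar>)
            - r * \<gamma> * (1 / (\<xi> - r)^2 + 1 / (\<xi> - r) * (1 / \<xi>) + 1 / \<xi>^2)"
          unfolding m_def by (rule virial_kernel_eq) (use elim in auto)
        also have "complex_of_real (r * c - \<beta> * (\<bar>\<xi> - r\<bar> * \<xi> - (\<xi> - r) * \<bar>\<xi>\<bar>)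
            - r * \<gamma> * (1 / (\<xi> - r)^2 + 1 / (\<xi> - r) * (1 / \<xi>) + 1 / \<xi>^2)) * (U (\<xi> - r) * cnj (U \<xi>))
          = ?R \<xi>"
          unfolding complex_cnj_mult complex_cnj_complex_of_real of_real_diff[of "_ - _"] of_real_diff[of "r * c"]
            of_real_mult[of \<beta>] of_real_mult[of "r * \<gamma>"] of_real_add of_real_mult[of "1 / (\<xi> - r)"]
          by (simp only: algebra_simps)
        finally show ?case .
      qed
    qed (unfold m_def, measurable)
    also have "\<dots> = complex_of_real (r * c) * L2_inner (\<lambda>\<xi>. U (\<xi> - r)) U - complex_of_real \<beta> * Z r
         - complex_of_real (r * \<gamma>) * (L2_inner (\<lambda>\<xi>. ?V2 (\<xi> - r)) U + L2_inner (\<lambda>\<xi>. ?V1 (\<xi> - r)) ?V1 + L2_inner (\<lambda>\<xi>. U (\<xi> - r)) ?V2)"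
    proof -
      note I = integrable_L2_mult(2)[OF sh[OF UL, of r] UL] integrable_L2_mult(2)[OF ZL[of r] UL]
        integrable_L2_mult(2)[OF sh[OF V2, of r] UL] integrable_L2_mult(2)[OF sh[OF V1, of r] V1] integrable_L2_mult(2)[OF sh[OF UL, of r] V2]
      show ?thesis unfolding L2_inner_def Z_def
        by (subst Bochner_Integration.integral_diff Bochner_Integration.integral_add integral_mult_right_zero
            | intro I Bochner_Integration.integrable_diff Bochner_Integration.integrable_add integrable_mult_right | rule refl)+
    qed
    finally show ?thesis .
  qed
  define s where "s n = 1 / real (Suc n)" for n
  have s: "s n > 0" for n by (auto simp: s_def)
  have s0: "s \<longlonglongrightarrow> 0" unfolding s_def by (rule LIMSEQ_Suc[OF lim_1_over_n])
  have tr: "L2_tendsto (\<lambda>n \<xi>. V (\<xi> - s n)) V" if "L2 V" for V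
    using L2_tendsto_translate[OF that, of "\<lambda>n. - s n"] tendsto_minus[OF s0] by simp
  have l1: "(\<lambda>n. 4 * pi * (LINT x|lborel. cos (s n * x) * G x)) \<longlonglongrightarrow> 4 * pi * (LINT x|lborel. G x)"
  proof (intro tendsto_mult_left integral_dominated_convergence)
    note [measurable] = borel_measurable_integrable[OF G]
    show "integrable lborel (\<lambda>x. \<bar>G x\<bar>)" using G by simp
    show "(\<lambda>x. cos (s n * x) * G x) \<in> borel_measurable lborel" for n by measurable
    show "AE x in lborel. norm (cos (s n * x) * G x) \<le> \<bar>G x\<bar>" for n
      by (intro AE_I2) (auto simp: abs_mult intro!: mult_left_le_one_le)
    show "AE x in lborel. (\<lambda>n. cos (s n * x) * G x) \<longlonglongrightarrow> G x"
    proof (rule AE_I2)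
      fix x
      have "(\<lambda>n. cos (s n * x) * G x) \<longlonglongrightarrow> cos (0 * x) * G x" by (intro tendsto_intros s0)
      then show "(\<lambda>n. cos (s n * x) * G x) \<longlonglongrightarrow> G x" by simp
    qed
  qed (use G in auto)
  have e: "4 * pi * (LINT x|lborel. cos (s n * x) * G x)
     = Re (complex_of_real c * L2_inner (\<lambda>\<xi>. U (\<xi> - s n)) U - complex_of_real (\<beta> / s n) * Z (s n)
         - complex_of_real \<gamma> * (L2_inner (\<lambda>\<xi>. ?V2 (\<xi> - s n)) U + L2_inner (\<lambda>\<xi>. ?V1 (\<xi> - s n)) ?V1 + L2_inner (\<lambda>\<xi>. U (\<xi> - s n)) ?V2))" for n
  proof -
    have "s n * (4 * pi * (LINT x|lborel. cos (s n * x) * G x))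
     = s n * Re (complex_of_real c * L2_inner (\<lambda>\<xi>. U (\<xi> - s n)) U - complex_of_real (\<beta> / s n) * Z (s n)
         - complex_of_real \<gamma> * (L2_inner (\<lambda>\<xi>. ?V2 (\<xi> - s n)) U + L2_inner (\<lambda>\<xi>. ?V1 (\<xi> - s n)) ?V1 + L2_inner (\<lambda>\<xi>. U (\<xi> - s n)) ?V2))"
      using key[of "s n"] s[of n] by (simp add: algebra_simps)
    then show ?thesis using s[of n] by simp
  qed
  have z: "(\<lambda>n. complex_of_real (\<beta> / s n) * Z (s n)) \<longlonglongrightarrow> 0"
  proof (rule Lim_null_comparison)
    have "(\<lambda>n. \<bar>\<beta>\<bar> * (2 * s n * (L2_norm U)^2)) \<longlonglongrightarrow> \<bar>\<beta>\<bar> * (2 * 0 * (L2_norm U)^2)"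
      by (intro tendsto_intros s0)
    then show "(\<lambda>n. \<bar>\<beta>\<bar> * (2 * s n * (L2_norm U)^2)) \<longlonglongrightarrow> 0" by simp
    have "cmod (complex_of_real (\<beta> / s n) * Z (s n)) \<le> \<bar>\<beta>\<bar> * (2 * s n * (L2_norm U)^2)" for n
    proof -
      have "cmod (complex_of_real (\<beta> / s n) * Z (s n)) = \<bar>\<beta>\<bar> / s n * cmod (Z (s n))"
        using s[of n] by (simp add: norm_mult norm_divide)
      also have "\<dots> \<le> \<bar>\<beta>\<bar> / s n * (2 * (s n)^2 * (L2_norm U)^2)"
        using s[of n] by (intro mult_left_mono Zb) simp
      also have "\<dots> = \<bar>\<beta>\<bar> * (2 * s n * (L2_norm U)^2)"
        using s[of n] by (simp add: power2_eq_square)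
      finally show ?thesis .
    qed
    then show "\<forall>\<^sub>F n in sequentially. cmod (complex_of_real (\<beta> / s n) * Z (s n)) \<le> \<bar>\<beta>\<bar> * (2 * s n * (L2_norm U)^2)"
      by simp
  qed
  have l2: "(\<lambda>n. 4 * pi * (LINT x|lborel. cos (s n * x) * G x)) \<longlonglongrightarrow>
      Re (complex_of_real c * L2_inner U U - 0 - complex_of_real \<gamma> * (L2_inner ?V2 U + L2_inner ?V1 ?V1 + L2_inner U ?V2))"
    unfolding e
    by (intro tendsto_Re tendsto_diff tendsto_mult_left tendsto_add z L2_tendsto_inner L2_tendsto_const tr[OF UL] tr[OF V1] tr[OF V2] UL V1 V2)
  have v: "L2_inner ?V2 U = L2_inner ?V1 ?V1" "L2_inner U ?V2 = L2_inner ?V1 ?V1"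
    unfolding L2_inner_def by (intro Bochner_Integration.integral_cong; simp add: power2_eq_square mult_ac)+
  from LIMSEQ_unique[OF l1 l2] show ?thesis
    unfolding v L2_inner_self by simp
qed

section \<open>Homogeneous nonlinearities\<close>

definition pos_power :: "real \<Rightarrow> real \<Rightarrow> real" where
  "pos_power q s = (if s > 0 then s powr q else 0)"

lemma pos_power_measurable [measurable]: "pos_power q \<in> borel_measurable borel"
  unfolding pos_power_def[abs_def] by measurable

lemma pos_power_bounds: "0 \<le> pos_power q s" "pos_power q s \<le> \<bar>s\<bar> powr q"
  by (auto simp: pos_power_def)

lemma DERIV_pos_power:
  assumes "q > 1" shows "(pos_power q has_real_derivative q * pos_power (q - 1) x) (at x)"
proof -
  consider "x > 0" | "x < 0" | "x = 0" by linarith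
  then show ?thesis
  proof cases
    case 1
    have "((\<lambda>x. x powr q) has_real_derivative q * pos_power (q - 1) x) (at x)"
      using 1 has_real_derivative_powr[of x q] by (simp add: pos_power_def)
    then show ?thesis
      by (rule has_field_derivative_transform_within_open[where S="{0<..}"]) (use 1 in \<open>auto simp: pos_power_def\<close>)
  next
    case 2
    have "((\<lambda>x. 0) has_real_derivative q * pos_power (q - 1) x) (at x)"
      using 2 by (simp add: pos_power_def)
    then show ?thesis
      by (rule has_field_derivative_transform_within_open[where S="{..<0}"]) (use 2 in \<open>auto simp: pos_power_def\<close>)
  next
    case 3
    have "((\<lambda>h. \<bar>h\<bar> powr (q - 1)) \<longlongrightarrow> \<bar>0\<bar> powr (q - 1)) (at (0::real))"
      using assms by (intro tendsto_powr' tendsto_intros) auto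
    then have z: "((\<lambda>h::real. \<bar>h\<bar> powr (q - 1)) \<longlongrightarrow> 0) (at 0)" by simp
    have "((\<lambda>h. pos_power (q - 1) h) \<longlongrightarrow> 0) (at 0)"
      by (rule Lim_null_comparison[OF always_eventually[OF allI] z]) (use pos_power_bounds in auto)
    moreover have "\<forall>\<^sub>F h in at 0. pos_power (q - 1) h = (pos_power q (0 + h) - pos_power q 0) / h"
      by (auto simp: pos_power_def eventually_at_filter powr_diff)
    ultimately have "((\<lambda>h. (pos_power q (0 + h) - pos_power q 0) / h) \<longlongrightarrow> 0) (at 0)"
      by (rule Lim_transform_eventually)
    then show ?thesis using 3 by (simp add: DERIV_def pos_power_def)
  qed
qed

text \<open>The two open half lines are the orbits of the scaling, so f is determined there by its
  values at 1 and -1; at 0, scaling by 2 forces f 0 = 0.\<close>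

lemma homogeneous_eq:
  assumes "homogeneous p f" "p > 1"
  shows "f s = f 1 * pos_power p s + f (- 1) * pos_power p (- s)"
proof -
  have h: "f (t * s) = t powr p * f s" if "t > 0" for t s using assms(1) that by (simp add: homogeneous_def)
  consider "s > 0" | "s < 0" | "s = 0" by linarith
  then show ?thesis
  proof cases
    case 1 then show ?thesis using h[of s 1] by (simp add: pos_power_def)
  next
    case 2 then show ?thesis using h[of "- s" "- 1"] by (simp add: pos_power_def)
  next
    case 3
    have "f 0 = 2 powr p * f 0" using h[of 2 0] by simp
    moreover have "2 powr p > 2 powr (0::real)" using assms(2) by (intro powr_less_mono) auto
    ultimately have "f 0 = 0" by auto
    with 3 show ?thesis by (simp add: pos_power_def)
  qed
qed

lemma homogeneous_measurable:
  assumes "homogeneous p f" "p > 1" shows "f \<in> borel_measurable borel"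
proof -
  have "(\<lambda>s. f 1 * pos_power p s + f (- 1) * pos_power p (- s)) \<in> borel_measurable borel" by measurable
  also have "(\<lambda>s. f 1 * pos_power p s + f (- 1) * pos_power p (- s)) = f"
    by (intro ext homogeneous_eq[OF assms, symmetric])
  finally show ?thesis .
qed

lemma homogeneous_abs_le:
  assumes "homogeneous p f" "p > 1"
  shows "\<bar>f s\<bar> \<le> (\<bar>f 1\<bar> + \<bar>f (- 1)\<bar>) * \<bar>s\<bar> powr p"
proof -
  have "\<bar>f s\<bar> \<le> \<bar>f 1\<bar> * pos_power p s + \<bar>f (- 1)\<bar> * pos_power p (- s)"
    using homogeneous_eq[OF assms, of s] abs_triangle_ineq[of "f 1 * pos_power p s" "f (- 1) * pos_power p (- s)"]
    by (simp add: abs_mult pos_power_bounds(1))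
  also have "\<dots> \<le> \<bar>f 1\<bar> * \<bar>s\<bar> powr p + \<bar>f (- 1)\<bar> * \<bar>s\<bar> powr p"
    using pos_power_bounds(2)[of p s] pos_power_bounds(2)[of p "- s"] by (intro add_mono mult_left_mono) auto
  finally show ?thesis by (simp add: algebra_simps)
qed

text \<open>By Euler's relation \<open>s * f s / (p + 1)\<close> is a primitive of \<open>f\<close>.\<close>
lemma homogeneous_Taylor:
  assumes hom: "homogeneous p f" and p: "p > 1"
  shows "\<exists>K\<ge>0. \<forall>x\<in>{-R..R}. \<forall>y\<in>{-R..R}. \<bar>y * f y / (p + 1) - x * f x / (p + 1) - f x * (y - x)\<bar> \<le> K * (y - x)^2"
proof -
  define f' where "f' s = f 1 * (p * pos_power (p - 1) s) - f (- 1) * (p * pos_power (p - 1) (- s))" for s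
  have Df: "(f has_real_derivative f' s) (at s)" for s
  proof -
    have "((\<lambda>s. f 1 * pos_power p s + f (- 1) * pos_power p (- s)) has_real_derivative f' s) (at s)"
      unfolding f'_def by (auto intro!: derivative_eq_intros DERIV_chain'[OF _ DERIV_pos_power] p)
    also have "(\<lambda>s. f 1 * pos_power p s + f (- 1) * pos_power p (- s)) = f"
      by (intro ext homogeneous_eq[OF hom p, symmetric])
    finally show ?thesis .
  qed
  have Euler: "s * f' s = p * f s" for s
    using p by (subst homogeneous_eq[OF hom p]) (auto simp: f'_def pos_power_def powr_diff field_simps)
  have DF: "((\<lambda>s. s * f s / (p + 1)) has_real_derivative f s) (at s)" for s
  proof -
    have "((\<lambda>s. s * f s / (p + 1)) has_real_derivative (1 * f s + f' s * s) / (p + 1)) (at s)"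
      by (intro DERIV_cdivide DERIV_mult DERIV_ident Df)
    also have "(1 * f s + f' s * s) / (p + 1) = f s"
    proof -
      have "1 * f s + f' s * s = (p + 1) * f s" using Euler[of s] by (simp add: algebra_simps)
      then show ?thesis using p by simp
    qed
    finally show ?thesis .
  qed
  \<comment> \<open>A bound for \<bar>f' s\<bar> on [-R, R]: since p - 1 > 0, both one-sided powers
    are at most \<bar>R\<bar> powr (p - 1) there.\<close>
  define K where "K = (\<bar>f 1\<bar> + \<bar>f (- 1)\<bar>) * (p * \<bar>R\<bar> powr (p - 1))"
  have K0: "K \<ge> 0" unfolding K_def
    by (intro mult_nonneg_nonneg add_nonneg_nonneg abs_ge_zero powr_ge_zero) (use p in simp)
  have f'b: "\<bar>f' s\<bar> \<le> K" if "s \<in> {-R..R}" for s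
  proof -
    have sR: "\<bar>s\<bar> powr (p - 1) \<le> \<bar>R\<bar> powr (p - 1)" using that p by (intro powr_mono2) auto
    have "\<bar>f' s\<bar> \<le> \<bar>f 1\<bar> * (p * pos_power (p - 1) s) + \<bar>f (- 1)\<bar> * (p * pos_power (p - 1) (- s))"
      unfolding f'_def using abs_triangle_ineq4[of "f 1 * (p * pos_power (p - 1) s)" "f (- 1) * (p * pos_power (p - 1) (- s))"] p
      by (simp add: abs_mult pos_power_bounds(1))
    also have "\<dots> \<le> \<bar>f 1\<bar> * (p * \<bar>R\<bar> powr (p - 1)) + \<bar>f (- 1)\<bar> * (p * \<bar>R\<bar> powr (p - 1))"
      using pos_power_bounds(2)[of "p - 1" s] pos_power_bounds(2)[of "p - 1" "- s"] sR p
      by (intro add_mono mult_left_mono) auto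
    finally show ?thesis by (simp add: K_def algebra_simps)
  qed
  have "\<bar>y * f y / (p + 1) - x * f x / (p + 1) - f x * (y - x)\<bar> \<le> K * (y - x)^2" if xy: "x \<in> {-R..R}" "y \<in> {-R..R}" for x y
  proof -
    let ?S = "closed_segment x y"
    have S: "?S \<subseteq> {-R..R}" using xy by (intro closed_segment_subset) auto
    \<comment> \<open>The mean value inequality for the primitive minus its linear part f x * z: on
      the segment its derivative f z - f x is at most K * \<bar>y - x\<bar>, by the same inequality
      for f.\<close>
    have "norm ((y * f y / (p + 1) - f x * y) - (x * f x / (p + 1) - f x * x)) \<le> K * \<bar>y - x\<bar> * norm (y - x)"
    proof (rule field_differentiable_bound[where S="?S" and f="\<lambda>z. z * f z / (p + 1) - f x * z" and f'="\<lambda>z. f z - f x"])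
      show "((\<lambda>z. z * f z / (p + 1) - f x * z) has_field_derivative f z - f x) (at z within ?S)" for z
        by (intro DERIV_diff has_field_derivative_at_within[OF DF]) (auto intro!: derivative_eq_intros)
      show "norm (f z - f x) \<le> K * \<bar>y - x\<bar>" if z: "z \<in> ?S" for z
      proof -
        have "norm (f z - f x) \<le> K * norm (z - x)"
          by (rule field_differentiable_bound[where S="{-R..R}" and f'=f'])
            (use f'b S z xy in \<open>auto intro: has_field_derivative_at_within[OF Df]\<close>)
        also have "\<dots> \<le> K * \<bar>y - x\<bar>"
          using z K0 by (intro mult_left_mono) (auto simp: closed_segment_eq_real_ivl split: if_splits)
        finally show ?thesis .
      qed
    qed auto
    then show ?thesis by (simp add: power2_eq_square algebra_simps flip: abs_mult)
  qed
  with K0 show ?thesis by blast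
qed

section \<open>Regularity and the two integral identities\<close>

lemma Fourier_pair_cong_AE_left:
  assumes "Fourier_pair u U" "v \<in> borel_measurable borel" "AE x in lborel. u x = v x"
  shows "Fourier_pair v U"
proof -
  obtain a where a: "\<And>n. integrable lborel (a n)" "L2_tendsto a u" "L2_tendsto (\<lambda>n. ft (a n)) U"
    using assms(1) unfolding Fourier_pair_def by auto
  note L = L2_tendstoD[OF a(2)]
  have v: "L2 v" by (rule L2_cong_AE[OF L(2) assms(2,3)])
  have "L2_norm (\<lambda>x. a n x - v x) = L2_norm (\<lambda>x. a n x - u x)" for n
    using L2_measurable[OF L(1)[of n]] L2_measurable[OF L(2)] assms(2,3) by (intro L2_norm_cong_AE) auto
  then have "L2_tendsto a v" using L v by (simp add: L2_tendsto_def)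
  with a show ?thesis unfolding Fourier_pair_def by blast
qed

lemma L2_cmod:
  assumes "L2 u" shows "L2 (\<lambda>x. complex_of_real (cmod (u x)))"
  by (rule L2_bound[OF _ assms, of _ 1]) (use L2_measurable[OF assms] in auto)

text \<open>The symbol is solved for its dominant term at either end: first \<bar>\<xi>\<bar> for
  large frequencies, using \<beta> \<noteq> 0, then 1 / \<xi>^2, using \<gamma> \<noteq> 0.
  Integrability of U follows by weighting it with sqrt (1 + \<xi>^2).\<close>

lemma solution_regularity:
  fixes c \<beta> \<gamma> :: real
  defines "m \<equiv> \<lambda>\<xi>. c - \<beta> * \<bar>\<xi>\<bar> - \<gamma> / \<xi>^2"
  assumes U: "L2 U" and N: "L2 (\<lambda>\<xi>. complex_of_real (m \<xi>) * U \<xi>)" and \<beta>: "\<beta> \<noteq> 0" and \<gamma>: "\<gamma> \<noteq> 0"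
  shows "L2 (\<lambda>\<xi>. complex_of_real \<xi> * U \<xi>)" "L2 (\<lambda>\<xi>. complex_of_real (1 / \<xi>^2) * U \<xi>)" "integrable lborel U"
proof -
  note [measurable] = L2_measurable[OF U]
  let ?N = "\<lambda>\<xi>. complex_of_real (m \<xi>) * U \<xi>"
  \<comment> \<open>The summand 1 serves \<bar>\<xi>\<bar> \<le> 1. Beyond, c and \<gamma> / \<xi>^2
    together are at most \<bar>c\<bar> + \<bar>\<gamma>\<bar>, and dividing by \<bar>\<beta>\<bar>
    isolates \<bar>\<xi>\<bar>.\<close>
  define a where "a = 1 + (\<bar>c\<bar> + \<bar>\<gamma>\<bar>) / \<bar>\<beta>\<bar>"
  let ?v = "\<lambda>\<xi>. complex_of_real a * complex_of_real (cmod (U \<xi>)) + complex_of_real (1 / \<bar>\<beta>\<bar>) * complex_of_real (cmod (?N \<xi>))"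
  have vL: "L2 (\<lambda>\<xi>. ?v \<xi>)"
    by (intro L2_add L2_cmult L2_cmod U N)
  have X': "\<bar>\<xi>\<bar> * cmod (U \<xi>) \<le> a * cmod (U \<xi>) + 1 / \<bar>\<beta>\<bar> * cmod (?N \<xi>)" for \<xi>
  proof (cases "\<bar>\<xi>\<bar> \<le> 1")
    case True
    then have "\<bar>\<xi>\<bar> * cmod (U \<xi>) \<le> a * cmod (U \<xi>)" by (intro mult_right_mono) (auto simp: a_def intro: add_increasing2)
    then show ?thesis by (rule order_trans) simp
  next
    case False
    then have "1 \<le> \<xi>^2" using one_le_power[of "\<bar>\<xi>\<bar>" 2] by simp
    then have "\<bar>\<gamma> / \<xi>^2\<bar> \<le> \<bar>\<gamma>\<bar> / 1" unfolding abs_divide by (intro divide_left_mono) auto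
    then have "\<bar>\<beta>\<bar> * \<bar>\<xi>\<bar> \<le> \<bar>c\<bar> + \<bar>\<gamma>\<bar> + \<bar>m \<xi>\<bar>"
    proof -
      have "\<beta> * \<bar>\<xi>\<bar> = c - \<gamma> / \<xi>^2 - m \<xi>" by (simp add: m_def)
      then have "\<bar>\<beta> * \<bar>\<xi>\<bar>\<bar> \<le> \<bar>c\<bar> + \<bar>\<gamma> / \<xi>^2\<bar> + \<bar>m \<xi>\<bar>" by linarith
      with \<open>\<bar>\<gamma> / \<xi>^2\<bar> \<le> \<bar>\<gamma>\<bar> / 1\<close> show ?thesis by (simp add: abs_mult)
    qed
    then have "\<bar>\<beta>\<bar> * \<bar>\<xi>\<bar> * cmod (U \<xi>) \<le> (\<bar>c\<bar> + \<bar>\<gamma>\<bar> + \<bar>m \<xi>\<bar>) * cmod (U \<xi>)" by (rule mult_right_mono) simp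
    then have "\<bar>\<beta>\<bar> * \<bar>\<xi>\<bar> * cmod (U \<xi>) / \<bar>\<beta>\<bar> \<le> (\<bar>c\<bar> + \<bar>\<gamma>\<bar> + \<bar>m \<xi>\<bar>) * cmod (U \<xi>) / \<bar>\<beta>\<bar>" by (rule divide_right_mono) simp
    then have "\<bar>\<xi>\<bar> * cmod (U \<xi>) \<le> (\<bar>c\<bar> + \<bar>\<gamma>\<bar>) / \<bar>\<beta>\<bar> * cmod (U \<xi>) + 1 / \<bar>\<beta>\<bar> * cmod (?N \<xi>)"
      using \<beta> by (simp add: norm_mult algebra_simps add_divide_distrib)
    then show ?thesis unfolding a_def distrib_right mult_1_left using norm_ge_zero[of "U \<xi>"] by linarith
  qed
  show X: "L2 (\<lambda>\<xi>. complex_of_real \<xi> * U \<xi>)"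
  proof (rule L2_bound[OF _ vL, of _ 1])
    show "AE \<xi> in lborel. cmod (complex_of_real \<xi> * U \<xi>) \<le> 1 * cmod (?v \<xi>)"
    proof (rule AE_I2)
      fix \<xi>
      have "cmod (complex_of_real \<xi> * U \<xi>) = \<bar>\<xi>\<bar> * cmod (U \<xi>)" by (simp add: norm_mult)
      also have "\<dots> \<le> \<bar>a * cmod (U \<xi>) + 1 / \<bar>\<beta>\<bar> * cmod (?N \<xi>)\<bar>" using X'[of \<xi>] by linarith
      also have "\<dots> = 1 * cmod (?v \<xi>)"
        unfolding of_real_mult[symmetric] of_real_add[symmetric] norm_of_real by simp
      finally show "cmod (complex_of_real \<xi> * U \<xi>) \<le> \<dots>" .
    qed
  qed measurable
  \<comment> \<open>The symbol solved for 1 / \<xi>^2, with \<beta> * \<bar>\<xi>\<bar> written as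
    \<beta> * sgn \<xi> * \<xi> so that the bound just proved for \<xi> * U applies. At 0 both sides
    vanish, because 1 / 0 = 0.\<close>
  let ?w = "\<lambda>\<xi>. complex_of_real (1 / \<gamma>) * (complex_of_real c * U \<xi> - complex_of_real (\<beta> * sgn \<xi>) * (complex_of_real \<xi> * U \<xi>) - ?N \<xi>)"
  have "L2 (\<lambda>\<xi>. ?w \<xi>)"
  proof (intro L2_cmult L2_diff U N L2_mult_bounded[OF X])
    show "cmod (complex_of_real (\<beta> * sgn \<xi>)) \<le> \<bar>\<beta>\<bar>" for \<xi>
      unfolding norm_of_real abs_mult by (rule mult_left_le) (auto simp: abs_sgn_eq)
  qed (unfold sgn_real_def, measurable)
  then show "L2 (\<lambda>\<xi>. complex_of_real (1 / \<xi>^2) * U \<xi>)"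
  proof (rule L2_cong_AE)
    have "?w \<xi> = complex_of_real (1 / \<xi>^2) * U \<xi>" for \<xi>
    proof -
      have "\<xi> * sgn \<xi> = \<bar>\<xi>\<bar>" by (simp add: abs_sgn)
      then have "1 / \<gamma> * (c - \<beta> * sgn \<xi> * \<xi> - m \<xi>) = 1 / \<xi>^2"
        using \<gamma> by (simp add: m_def mult.assoc mult.commute[of "sgn \<xi>"])
      then have "complex_of_real (1 / \<gamma> * (c - \<beta> * sgn \<xi> * \<xi> - m \<xi>)) * U \<xi> = complex_of_real (1 / \<xi>^2) * U \<xi>" by simp
      then show ?thesis by (simp add: algebra_simps)
    qed
    then show "AE \<xi> in lborel. ?w \<xi> = complex_of_real (1 / \<xi>^2) * U \<xi>"
      by simp
  qed measurable
  let ?b = "\<lambda>\<xi>. (cmod (U \<xi>))^2 + (cmod (complex_of_real \<xi> * U \<xi>))^2 + inverse (1 + \<xi>^2)"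
  show "integrable lborel U"
  proof (rule Bochner_Integration.integrable_bound)
    have "integrable lborel (\<lambda>x. inverse (1 + x^2) :: real)"
      using integrable_inverse_1_plus_square by (simp add: set_integrable_def)
    then show "integrable lborel (\<lambda>\<xi>. ?b \<xi>)"
      using U X by (auto simp: L2_def)
    show "AE \<xi> in lborel. norm (U \<xi>) \<le> norm (?b \<xi>)"
    proof (rule AE_I2)
      fix \<xi>
      define t where "t = sqrt (1 + \<xi>^2)"
      have t: "t > 0" "t^2 = 1 + \<xi>^2" by (auto simp: t_def add_pos_nonneg)
      have "2 * (t * cmod (U \<xi>)) * (1 / t) \<le> (t * cmod (U \<xi>))^2 + (1 / t)^2" by (rule sum_squares_bound)
      then have "2 * cmod (U \<xi>) \<le> (1 + \<xi>^2) * (cmod (U \<xi>))^2 + inverse (1 + \<xi>^2)"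
        using t by (simp add: power_mult_distrib power_divide inverse_eq_divide)
      also have "\<dots> = ?b \<xi>"
        by (simp add: norm_mult power_mult_distrib algebra_simps)
      finally show "norm (U \<xi>) \<le> norm (?b \<xi>)"
        using norm_ge_zero[of "U \<xi>"] unfolding real_norm_def by linarith
    qed
  qed measurable
qed

lemma solitary_wave_identities:
  fixes c \<beta> \<gamma> p :: real
  assumes p: "p > 1" and hom: "homogeneous p f" and \<beta>: "\<beta> \<noteq> 0" and \<gamma>: "\<gamma> \<noteq> 0" and sol: "solves \<beta> c \<gamma> f \<phi>"
  obtains U where "Fourier_pair_real \<phi> U"
    "integrable lborel (\<lambda>\<xi>. \<bar>\<xi>\<bar> * (cmod (U \<xi>))^2)" "L2 (over_frequency U)"
    "2 * pi * (LINT x|lborel. \<phi> x * f (\<phi> x))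
      = c * (L2_norm U)^2 - \<beta> * (LINT \<xi>|lborel. \<bar>\<xi>\<bar> * (cmod (U \<xi>))^2) - \<gamma> * (L2_norm (over_frequency U))^2"
    "4 * pi * (LINT x|lborel. \<phi> x * f (\<phi> x)) = (p + 1) * (c * (L2_norm U)^2 - 3 * \<gamma> * (L2_norm (over_frequency U))^2)"
proof -
  from sol obtain h w where X: "in_X \<phi>" and h: "is_hilbert \<phi> h" and w: "is_dinv \<phi> w" and
    weak: "\<And>\<psi>. test_fun \<psi> \<Longrightarrow> \<beta> * (LINT x|lborel. h x * deriv (deriv \<psi>) x)
          + c * (LINT x|lborel. \<phi> x * deriv \<psi> x) - (LINT x|lborel. f (\<phi> x) * deriv \<psi> x)
          = \<gamma> * (LINT x|lborel. w x * \<psi> x)"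
    unfolding solves_def by blast
  from h obtain U where U: "is_fourier \<phi> U" and hU: "is_fourier h (\<lambda>\<xi>. - \<i> * complex_of_real (sgn \<xi>) * U \<xi>)"
    unfolding is_hilbert_def by blast
  from w obtain U2 where U2: "is_fourier \<phi> U2" and wU: "is_fourier w (\<lambda>\<xi>. U2 \<xi> / (\<i> * complex_of_real \<xi>))"
    unfolding is_dinv_def by blast
  from X obtain U3 where U3: "is_fourier \<phi> U3" and W3: "(\<integral>\<^sup>+ \<xi>. ennreal ((1 + \<bar>\<xi>\<bar>) * (cmod (U3 \<xi>))^2) \<partial>lborel) < \<infinity>"
    unfolding in_X_def H_half_def by blast
  note F = is_fourier_Fourier_pair[OF U]
  note UL = Fourier_pair_L2(2)[OF F]
  have \<phi>L: "L2 \<phi>" using Fourier_pair_L2(1)[OF F] by simp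
  have U3L: "L2 U3" by (rule Fourier_pair_L2(2)[OF is_fourier_Fourier_pair[OF U3]])
  note [measurable] = L2_measurable[OF UL] L2_measurable[OF \<phi>L] L2_measurable[OF U3L] homogeneous_measurable[OF hom p]
  \<comment> \<open>The hypotheses supply three transforms of \<phi>; uniqueness up to null sets
    lets U replace the other two.\<close>
  have FW: "Fourier_pair_real w (\<lambda>\<xi>. U \<xi> / (\<i> * complex_of_real \<xi>))"
  proof (rule Fourier_pair_cong_AE[OF is_fourier_Fourier_pair[OF wU]])
    show "AE \<xi> in lborel. U2 \<xi> / (\<i> * complex_of_real \<xi>) = U \<xi> / (\<i> * complex_of_real \<xi>)"
      using Fourier_pair_unique[OF is_fourier_Fourier_pair[OF U2] F] by eventually_elim simp
  qed measurable
  have "L2 (\<lambda>\<xi>. \<i> * (U \<xi> / (\<i> * complex_of_real \<xi>)))" by (rule L2_cmult[OF Fourier_pair_L2(2)[OF FW]])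
  then have V1: "L2 (over_frequency U)" by simp
  have W: "integrable lborel (\<lambda>\<xi>. (1 + \<bar>\<xi>\<bar>) * (cmod (U \<xi>))^2)"
  proof -
    have "integrable lborel (\<lambda>\<xi>. (1 + \<bar>\<xi>\<bar>) * (cmod (U3 \<xi>))^2)"
      using W3 by (intro integrableI_nonneg) auto
    moreover have "AE \<xi> in lborel. (1 + \<bar>\<xi>\<bar>) * (cmod (U3 \<xi>))^2 = (1 + \<bar>\<xi>\<bar>) * (cmod (U \<xi>))^2"
      using Fourier_pair_unique[OF is_fourier_Fourier_pair[OF U3] F] by eventually_elim simp
    ultimately show ?thesis by (subst (asm) integrable_cong_AE) auto
  qed
  have U2i: "integrable lborel (\<lambda>\<xi>. (cmod (U \<xi>))^2)" using UL by (simp add: L2_def)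
  have A: "integrable lborel (\<lambda>\<xi>. \<bar>\<xi>\<bar> * (cmod (U \<xi>))^2)"
    using Bochner_Integration.integrable_diff[OF W U2i] by (simp add: algebra_simps)
  have gL: "L2 (\<lambda>x. f (\<phi> x))" unfolding L2_def
  proof
    show "integrable lborel (\<lambda>x. (norm (f (\<phi> x)))\<^sup>2)"
    proof (rule Bochner_Integration.integrable_bound)
      show "integrable lborel (\<lambda>x. (\<bar>f 1\<bar> + \<bar>f (- 1)\<bar>)^2 * \<bar>\<phi> x\<bar> powr (2 * p))"
        using H_half_Lq[OF F W, of "2 * p"] p by simp
      show "AE x in lborel. norm ((norm (f (\<phi> x)))\<^sup>2) \<le> norm ((\<bar>f 1\<bar> + \<bar>f (- 1)\<bar>)^2 * \<bar>\<phi> x\<bar> powr (2 * p))"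
      proof (rule AE_I2)
        fix x
        have "\<bar>f (\<phi> x)\<bar>^2 \<le> ((\<bar>f 1\<bar> + \<bar>f (- 1)\<bar>) * \<bar>\<phi> x\<bar> powr p)^2"
          by (intro power_mono homogeneous_abs_le[OF hom p]) simp
        also have "\<dots> = (\<bar>f 1\<bar> + \<bar>f (- 1)\<bar>)^2 * \<bar>\<phi> x\<bar> powr (2 * p)"
          by (simp add: power_mult_distrib power2_eq_square flip: powr_add)
        finally show "norm ((norm (f (\<phi> x)))\<^sup>2) \<le> norm ((\<bar>f 1\<bar> + \<bar>f (- 1)\<bar>)^2 * \<bar>\<phi> x\<bar> powr (2 * p))" by simp
      qed
    qed measurable
  qed measurable
  obtain N where N: "Fourier_pair_real (\<lambda>x. f (\<phi> x)) N"
    using Fourier_pair_exists[of "\<lambda>x. complex_of_real (f (\<phi> x))"] gL by auto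
  define m where "m \<xi> = c - \<beta> * \<bar>\<xi>\<bar> - \<gamma> / \<xi>^2" for \<xi>
  have NU: "AE \<xi> in lborel. N \<xi> = complex_of_real (m \<xi>) * U \<xi>"
    unfolding m_def by (rule weak_equation_Fourier[OF F is_fourier_Fourier_pair[OF hU] FW N weak])
  have Fg: "Fourier_pair_real (\<lambda>x. f (\<phi> x)) (\<lambda>\<xi>. complex_of_real (m \<xi>) * U \<xi>)"
    by (rule Fourier_pair_cong_AE[OF N _ NU]) (unfold m_def, measurable)
  note reg = solution_regularity[OF UL Fourier_pair_L2(2)[OF Fg, unfolded m_def] \<beta> \<gamma>]
  obtain C where C: "C \<ge> 0" "AE x in lborel. \<bar>\<phi> x\<bar> \<le> C"
    using bounded_of_integrable_Fourier[OF F reg(3)] by blast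
  \<comment> \<open>The Taylor bound is required at all pairs of points, so \<phi> is changed on a
    null set to make the bound C hold everywhere; transforms and integrals are unaffected.\<close>
  define \<phi>' where "\<phi>' x = (if \<bar>\<phi> x\<bar> \<le> C then \<phi> x else 0)" for x
  have [measurable]: "\<phi>' \<in> borel_measurable borel" unfolding \<phi>'_def by measurable
  have eq: "AE x in lborel. \<phi> x = \<phi>' x" using C(2) by eventually_elim (simp add: \<phi>'_def)
  have \<phi>'R: "\<phi>' x \<in> {-C..C}" for x using C(1) by (auto simp: \<phi>'_def abs_le_iff)
  have F': "Fourier_pair_real \<phi>' U"
    by (rule Fourier_pair_cong_AE_left[OF F]) (use eq in auto)
  have Fg': "Fourier_pair_real (\<lambda>x. f (\<phi>' x)) (\<lambda>\<xi>. complex_of_real (m \<xi>) * U \<xi>)"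
  proof (rule Fourier_pair_cong_AE_left[OF Fg])
    show "AE x in lborel. complex_of_real (f (\<phi> x)) = complex_of_real (f (\<phi>' x))"
      using eq by eventually_elim simp
  qed measurable
  obtain K where K: "\<And>x y. x \<in> {-C..C} \<Longrightarrow> y \<in> {-C..C} \<Longrightarrow>
      \<bar>y * f y / (p + 1) - x * f x / (p + 1) - f x * (y - x)\<bar> \<le> K * (y - x)^2"
    using homogeneous_Taylor[OF hom p, of C] by blast
  have "integrable lborel (\<lambda>x. complex_of_real (\<phi>' x) * complex_of_real (f (\<phi>' x)))"
    by (rule integrable_L2_mult(3)[OF Fourier_pair_L2(1)[OF F'] Fourier_pair_L2(1)[OF Fg']])
  from integrable_Re[OF this] have Gi: "integrable lborel (\<lambda>x. \<phi>' x * f (\<phi>' x))" by simp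
  then have Gi': "integrable lborel (\<lambda>x. \<phi>' x * f (\<phi>' x) / (p + 1))" by simp
  have "4 * pi * (LINT x|lborel. \<phi>' x * f (\<phi>' x) / (p + 1)) = c * (L2_norm U)^2 - 3 * \<gamma> * (L2_norm (over_frequency U))^2"
    by (rule virial_identity[OF F' Fg'[unfolded m_def] reg(1) V1 reg(2) Gi' K[OF \<phi>'R \<phi>'R]])
  moreover have "(LINT x|lborel. \<phi>' x * f (\<phi>' x)) = (LINT x|lborel. \<phi> x * f (\<phi> x))"
  proof (rule integral_cong_AE)
    show "AE x in lborel. \<phi>' x * f (\<phi>' x) = \<phi> x * f (\<phi> x)" using eq by eventually_elim simp
  qed measurable
  ultimately have virial: "4 * pi * (LINT x|lborel. \<phi> x * f (\<phi> x)) = (p + 1) * (c * (L2_norm U)^2 - 3 * \<gamma> * (L2_norm (over_frequency U))^2)"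
    using p by (simp add: field_simps)
  have V1i: "integrable lborel (\<lambda>\<xi>. (cmod (complex_of_real (1 / \<xi>) * U \<xi>))^2)" using V1 by (simp add: L2_def)
  \<comment> \<open>Testing the equation with \<phi> itself amounts to Parseval for the multiplier
    relation.\<close>
  have "L2_inner (\<lambda>\<xi>. complex_of_real (m \<xi>) * U \<xi>) U = 2 * pi * L2_inner (\<lambda>x. complex_of_real (f (\<phi> x))) (\<lambda>x. complex_of_real (\<phi> x))"
    by (rule Parseval[OF Fg F])
  also have "L2_inner (\<lambda>x. complex_of_real (f (\<phi> x))) (\<lambda>x. complex_of_real (\<phi> x)) = complex_of_real (LINT x|lborel. \<phi> x * f (\<phi> x))"
    unfolding L2_inner_def integral_complex_of_real[symmetric] by (simp add: mult.commute)
  also have "L2_inner (\<lambda>\<xi>. complex_of_real (m \<xi>) * U \<xi>) U = complex_of_real (LINT \<xi>|lborel. c * (cmod (U \<xi>))^2 - \<beta> * (\<bar>\<xi>\<bar> * (cmod (U \<xi>))^2) - \<gamma> * (cmod (complex_of_real (1 / \<xi>) * U \<xi>))^2)"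
    unfolding L2_inner_def integral_complex_of_real[symmetric]
  proof (rule Bochner_Integration.integral_cong[OF refl])
    fix \<xi>
    have "complex_of_real (m \<xi>) * U \<xi> * cnj (U \<xi>) = complex_of_real (m \<xi> * (cmod (U \<xi>))^2)"
      by (simp only: of_real_mult complex_norm_square mult.assoc)
    also have "m \<xi> * (cmod (U \<xi>))^2 = c * (cmod (U \<xi>))^2 - \<beta> * (\<bar>\<xi>\<bar> * (cmod (U \<xi>))^2) - \<gamma> * (cmod (complex_of_real (1 / \<xi>) * U \<xi>))^2"
      unfolding m_def by (simp add: norm_mult power_mult_distrib power_divide norm_divide algebra_simps)
    finally show "complex_of_real (m \<xi>) * U \<xi> * cnj (U \<xi>) = complex_of_real (c * (cmod (U \<xi>))^2 - \<beta> * (\<bar>\<xi>\<bar> * (cmod (U \<xi>))^2) - \<gamma> * (cmod (complex_of_real (1 / \<xi>) * U \<xi>))^2)" .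
  qed
  also have "(LINT \<xi>|lborel. c * (cmod (U \<xi>))^2 - \<beta> * (\<bar>\<xi>\<bar> * (cmod (U \<xi>))^2) - \<gamma> * (cmod (complex_of_real (1 / \<xi>) * U \<xi>))^2)
     = c * (L2_norm U)^2 - \<beta> * (LINT \<xi>|lborel. \<bar>\<xi>\<bar> * (cmod (U \<xi>))^2) - \<gamma> * (L2_norm (over_frequency U))^2"
    unfolding L2_norm_power2 using U2i A V1i by simp
  finally have "complex_of_real (2 * pi * (LINT x|lborel. \<phi> x * f (\<phi> x))) = complex_of_real (c * (L2_norm U)^2 - \<beta> * (LINT \<xi>|lborel. \<bar>\<xi>\<bar> * (cmod (U \<xi>))^2) - \<gamma> * (L2_norm (over_frequency U))^2)"
    by simp
  then have energy: "2 * pi * (LINT x|lborel. \<phi> x * f (\<phi> x)) = c * (L2_norm U)^2 - \<beta> * (LINT \<xi>|lborel. \<bar>\<xi>\<bar> * (cmod (U \<xi>))^2) - \<gamma> * (L2_norm (over_frequency U))^2"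
    by (simp only: of_real_eq_iff)
  from that[OF F A V1 energy virial] show thesis .
qed

text \<open>The arithmetic-geometric mean inequality for b * t, b * t and k / t^2, whose product b^2
  * k does not depend on t. The minimum, at t^3 = k / b, has cube 27 * b^2 * k, which is the 27 of
  the theorem. Comparing cubes admits c of either sign.\<close>

lemma cubic_AM_GM:
  fixes b k t c :: real
  assumes "b > 0" "k > 0" "t > 0" "c^3 < 27 * b^2 * k"
  shows "c < 2 * b * t + k / t^2"
proof (rule ccontr)
  define x where "x = b * t"
  define y where "y = k / t^2"
  have xy: "x > 0" "y > 0" using assms by (auto simp: x_def y_def)
  assume "\<not> c < 2 * b * t + k / t^2"
  then have "(2 * x + y)^3 \<le> c^3" using xy by (intro power_mono) (auto simp: x_def y_def)
  \<comment> \<open>The minimum at x = y is a double root, so the square (x - y)^2 splits off and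
    the remaining factor is positive.\<close>
  moreover have "(2 * x + y)^3 - 27 * x^2 * y = (x - y)^2 * (8 * x + y)" by algebra
  moreover have "(x - y)^2 * (8 * x + y) \<ge> 0" using xy by (intro mult_nonneg_nonneg) auto
  moreover have "x^2 * y = b^2 * k" using assms(3) by (simp add: x_def y_def power_mult_distrib)
  ultimately show False using assms(4) by (simp add: mult.assoc)
qed

text \<open>The difference of the two sides of \<open>eq\<close> is an integral of \<bar>U\<bar>^2
  against a weight that \<open>cubic_AM_GM\<close> makes strictly positive at every \<xi> \<noteq>
  0, so its vanishing forces U = 0.\<close>

lemma weighted_integral_eq_0:
  fixes b k c0 :: real
  assumes U: "L2 U" and A: "integrable lborel (\<lambda>\<xi>. \<bar>\<xi>\<bar> * (cmod (U \<xi>))^2)"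
    and V1: "L2 (over_frequency U)"
    and bk: "b > 0" "k > 0" "c0^3 < 27 * b^2 * k"
    and eq: "c0 * (L2_norm U)^2 = 2 * b * (LINT \<xi>|lborel. \<bar>\<xi>\<bar> * (cmod (U \<xi>))^2)
      + k * (L2_norm (over_frequency U))^2"
  shows "AE \<xi> in lborel. U \<xi> = 0"
proof -
  let ?k = "\<lambda>\<xi>. 2 * b * (\<bar>\<xi>\<bar> * (cmod (U \<xi>))^2) + k * (cmod (complex_of_real (1 / \<xi>) * U \<xi>))^2 - c0 * (cmod (U \<xi>))^2"
  have i: "integrable lborel (\<lambda>\<xi>. (cmod (U \<xi>))^2)" "integrable lborel (\<lambda>\<xi>. (cmod (complex_of_real (1 / \<xi>) * U \<xi>))^2)"
    using U V1 by (auto simp: L2_def)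
  have I: "integrable lborel ?k" using i A by auto
  have nz: "AE \<xi> in lborel. \<xi> \<noteq> (0::real)" by (rule AE_lborel_singleton)
  have k: "?k \<xi> = (2 * b * \<bar>\<xi>\<bar> + k / \<bar>\<xi>\<bar>^2 - c0) * (cmod (U \<xi>))^2" for \<xi>
    by (simp add: norm_mult norm_divide power_mult_distrib power_divide algebra_simps)
  have pos: "2 * b * \<bar>\<xi>\<bar> + k / \<bar>\<xi>\<bar>^2 - c0 > 0" if "\<xi> \<noteq> 0" for \<xi>
    using cubic_AM_GM[OF bk(1,2) _ bk(3), of "\<bar>\<xi>\<bar>"] that by simp
  have nn: "AE \<xi> in lborel. 0 \<le> ?k \<xi>"
    using nz by eventually_elim (unfold k, intro mult_nonneg_nonneg, use pos less_imp_le in auto)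
  have "(LINT \<xi>|lborel. ?k \<xi>) = 2 * b * (LINT \<xi>|lborel. \<bar>\<xi>\<bar> * (cmod (U \<xi>))^2)
      + k * (L2_norm (over_frequency U))^2 - c0 * (L2_norm U)^2"
    unfolding L2_norm_power2 using i A by simp
  then have "(LINT \<xi>|lborel. ?k \<xi>) = 0" using eq by simp
  then have "AE \<xi> in lborel. ?k \<xi> = 0" using integral_nonneg_eq_0_iff_AE[OF I nn] by simp
  with nz show ?thesis
  proof eventually_elim
    case (elim \<xi>)
    from elim(2) pos[OF elim(1)] show ?case unfolding k by simp
  qed
qed

lemma homogeneous_signed_power: "homogeneous p (\<lambda>u. \<bar>u\<bar> powr (p - 1) * u)"
  unfolding homogeneous_def
proof (intro allI impI)
  fix t s :: real assume "t > 0"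
  then have "t powr (p - 1) * t = t powr p" by (simp add: powr_diff)
  then show "\<bar>t * s\<bar> powr (p - 1) * (t * s) = t powr p * (\<bar>s\<bar> powr (p - 1) * s)"
    using \<open>t > 0\<close> by (simp add: abs_mult powr_mult)
qed

lemma virial_energy_combination:
  fixes p \<beta> \<gamma> A W Y :: real
  assumes "2 * pi * Y = cB - \<beta> * A - \<gamma> * W" "4 * pi * Y = (p + 1) * (cB - 3 * \<gamma> * W)"
  shows "(p - 1) * cB + 2 * \<beta> * A = (3 * p + 1) * \<gamma> * W"
    "2 * pi * Y * (p - 1) = (p + 1) * (2 * \<gamma> * W - \<beta> * A)"
  using assms by algebra+

theorem theorem3p1:
  fixes p \<beta> c \<gamma> :: real and f :: "real \<Rightarrow> real"
  assumes hp: "p > 1"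
    and hcase:
      "(C2 f \<and> homogeneous p f \<and>
          ((\<beta> < 0 \<and> \<gamma> > 0 \<and> c^3 < 27 * (3*p + 1) * \<gamma> * \<beta>^2 / (p - 1)^3) \<or>
           (\<beta> > 0 \<and> \<gamma> < 0 \<and> c^3 > 27 * (3*p + 1) * \<gamma> * \<beta>^2 / (p - 1)^3)))
       \<or> (f = (\<lambda>u. \<bar>u\<bar> powr (p - 1) * u) \<and> \<beta> > 0 \<and> \<gamma> < 0)
       \<or> (f = (\<lambda>u. - (\<bar>u\<bar> powr (p - 1) * u)) \<and> \<beta> < 0 \<and> \<gamma> > 0)"
  shows "\<not> (\<exists>\<phi>. solves \<beta> c \<gamma> f \<phi> \<and> \<not> (AE x in lborel. \<phi> x = 0))"
proof -
  have hom: "homogeneous p f"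
    using hcase homogeneous_signed_power[of p] unfolding homogeneous_def by auto
  have nz: "\<beta> \<noteq> 0" "\<gamma> \<noteq> 0" using hcase by auto
  have "AE x in lborel. \<phi> x = 0" if sol: "solves \<beta> c \<gamma> f \<phi>" for \<phi>
  proof -
    obtain U where F: "Fourier_pair_real \<phi> U"
      and A: "integrable lborel (\<lambda>\<xi>. \<bar>\<xi>\<bar> * (cmod (U \<xi>))^2)" and V1: "L2 (over_frequency U)"
      and energy: "2 * pi * (LINT x|lborel. \<phi> x * f (\<phi> x))
        = c * (L2_norm U)^2 - \<beta> * (LINT \<xi>|lborel. \<bar>\<xi>\<bar> * (cmod (U \<xi>))^2) - \<gamma> * (L2_norm (over_frequency U))^2"
      and virial: "4 * pi * (LINT x|lborel. \<phi> x * f (\<phi> x)) = (p + 1) * (c * (L2_norm U)^2 - 3 * \<gamma> * (L2_norm (over_frequency U))^2)"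
      by (rule solitary_wave_identities[OF hp hom nz sol]) (rule that)
    define a where "a = (LINT \<xi>|lborel. \<bar>\<xi>\<bar> * (cmod (U \<xi>))^2)"
    define W where "W = (L2_norm (over_frequency U))^2"
    define B where "B = (L2_norm U)^2"
    define Y where "Y = (LINT x|lborel. \<phi> x * f (\<phi> x))"
    have a0: "a \<ge> 0" unfolding a_def by (intro Bochner_Integration.integral_nonneg) auto
    have W0: "W \<ge> 0" by (simp add: W_def)
    note comb = virial_energy_combination[OF energy virial, folded a_def W_def B_def Y_def]
    \<comment> \<open>The last two cases yield only W = 0. This is enough, as the weight 1 / \<xi>
      is nonzero off the null set {0}.\<close>
    have U0: "AE \<xi> in lborel. U \<xi> = 0" if "W = 0"
    proof -
      have "AE \<xi> in lborel. complex_of_real (1 / \<xi>) * U \<xi> = 0"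
        using L2_norm_eq_0[OF V1] that by (simp add: W_def)
      moreover have "AE \<xi> in lborel. \<xi> \<noteq> (0::real)" by (rule AE_lborel_singleton)
      ultimately show ?thesis by eventually_elim simp
    qed
    have "AE \<xi> in lborel. U \<xi> = 0"
      using hcase
    proof (elim disjE conjE)
      assume s: "\<beta> < 0" "\<gamma> > 0" "c^3 < 27 * (3*p + 1) * \<gamma> * \<beta>^2 / (p - 1)^3"
      \<comment> \<open>Clearing the denominator (p - 1)^3 > 0 turns the threshold into c0^3 < 27 *
        b^2 * k for b = - \<beta>, k = (3 * p + 1) * \<gamma> and c0 = (p - 1) * c.\<close>
      have "((p - 1) * c)^3 < 27 * (- \<beta>)^2 * ((3*p + 1) * \<gamma>)"
        using s(3) hp by (simp add: power_mult_distrib pos_less_divide_eq mult_ac)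
      moreover have "(p - 1) * c * B = 2 * (- \<beta>) * a + (3*p + 1) * \<gamma> * W"
        using comb(1) by (simp add: algebra_simps)
      ultimately show ?thesis
        using s hp unfolding a_def W_def B_def
        by (intro weighted_integral_eq_0[OF Fourier_pair_L2(2)[OF F] A V1, of "- \<beta>" "(3*p + 1) * \<gamma>" "(p - 1) * c"]) auto
    next
      assume s: "\<beta> > 0" "\<gamma> < 0" "c^3 > 27 * (3*p + 1) * \<gamma> * \<beta>^2 / (p - 1)^3"
      \<comment> \<open>The mirror image of the previous case under reversal of the signs of
        \<beta>, \<gamma> and c.\<close>
      have "((p - 1) * (- c))^3 < 27 * \<beta>^2 * ((3*p + 1) * (- \<gamma>))"
        using s(3) hp by (simp add: power_mult_distrib pos_divide_less_eq mult_ac)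
      moreover have "(p - 1) * (- c) * B = 2 * \<beta> * a + (3*p + 1) * (- \<gamma>) * W"
        using comb(1) by (simp add: algebra_simps)
      ultimately show ?thesis
        using s hp mult_pos_neg[of "3*p + 1" \<gamma>] unfolding a_def W_def B_def
        by (intro weighted_integral_eq_0[OF Fourier_pair_L2(2)[OF F] A V1, of \<beta> "(3*p + 1) * (- \<gamma>)" "(p - 1) * (- c)"]) auto
    next
      assume s: "f = (\<lambda>u. \<bar>u\<bar> powr (p - 1) * u)" "\<beta> > 0" "\<gamma> < 0"
      have "Y \<ge> 0" unfolding Y_def s(1)
        by (intro Bochner_Integration.integral_nonneg) (simp add: mult.left_commute[of _ "_ powr _"])
      then have "0 \<le> (p + 1) * (2 * \<gamma> * W - \<beta> * a)" using comb(2) hp by (simp flip: comb(2))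
      then have "0 \<le> 2 * \<gamma> * W - \<beta> * a" using hp by (simp add: zero_le_mult_iff)
      moreover have "\<beta> * a \<ge> 0" "\<gamma> * W \<le> 0" using s a0 W0 by (simp_all add: mult_nonpos_nonneg)
      \<comment> \<open>The two summands 2 * \<gamma> * W and - \<beta> * a are nonpositive and
        their sum is nonnegative, so both vanish.\<close>
      ultimately have "\<gamma> * W = 0" by linarith
      then show ?thesis using s U0 by simp
    next
      assume s: "f = (\<lambda>u. - (\<bar>u\<bar> powr (p - 1) * u))" "\<beta> < 0" "\<gamma> > 0"
      have "0 \<le> (LINT x|lborel. \<bar>\<phi> x\<bar> powr (p - 1) * (\<phi> x * \<phi> x))"
        by (intro Bochner_Integration.integral_nonneg) simp
      then have "Y \<le> 0" unfolding Y_def s(1) by (simp add: mult.left_commute)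
      then have "2 * pi * Y * (p - 1) \<le> 0"
        using hp by (intro mult_nonpos_nonneg mult_nonneg_nonpos) auto
      then have "(p + 1) * (2 * \<gamma> * W - \<beta> * a) \<le> 0" unfolding comb(2) .
      then have "2 * \<gamma> * W - \<beta> * a \<le> 0" using hp by (simp add: mult_le_0_iff)
      moreover have "\<beta> * a \<le> 0" "\<gamma> * W \<ge> 0" using s a0 W0 by (simp_all add: mult_nonpos_nonneg)
      ultimately have "\<gamma> * W = 0" by linarith
      then show ?thesis using s U0 by simp
    qed
    from Fourier_pair_eq_0[OF F this] show ?thesis by simp
  qed
  then show ?thesis by blast
qed

end
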